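(* Suppose $\theta^{\ast}<\infty$ and let $\alpha\in(0,1)$. Then, almost surely, $H_{n,n^\alpha}\sim(1-\alpha)C^{\ast}\ln n$ as $n\to\infty$. Furthermore, $$H_{n,n^\alpha}\le(1-\alpha)C^{\ast}\ln n+O(\ln\ln n)\quad\text{a.s.},$$ and this inequality is an equality, i.e. $H_{n,n^\alpha}=(1-\alpha)C^{\ast}\ln n+O(\ln\ln n)$ a.s., whenever there exists $\delta>0$ such that $$\mathrm{L}(-\delta)<\infty\quad\text{and}\quad \int \Big(\sum_{i\in\mathbb N}\mathbf 1_{p_i>0}\Big)^{1+\delta}\nu(\mathrm d\mathbf p)<\infty .$$
   Context: Model. Let $\mathbb N=\{1,2,\dots\}$ and $\mathcal U=\bigcup_{k\ge 0}\mathbb N^k$ with $\mathbb N^0=\{\varnothing\}$; write $|i|=k$ if $i\in\mathbb N^k$ (generation $k$), and $ij\in\mathbb N^{k+1}$ for the $j$-th child of $i\in\mathbb N^k$. Let $\rho=(\rho_1,\rho_2,\dots)$ be a random probability measure on $\mathbb N$, with law $\nu$ (a probability measure on the space of probability measures $\mathbf p=(p_1,p_2,\dots)$ on $\mathbb N$). Standing assumption: $\nu$ is not geometric, i.e. there is no $r\in(0,1)$ such that almost surely all masses of the atoms of $\rho$ belong to $\{r^n:n\in\mathbb Z_+\}$ (in particular $\rho$ is not a.s. a Dirac mass). Let $(\rho(i),i\in\mathcal U)$ be i.i.d. copies of $\rho$, and define $p_\varnothing=1$, $p_{ij}=p_i\rho_j(i)$. Each $i$ with $p_i>0$ is a box,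 of size $p_i$ (individuals with $p_i=0$ are ignored). An infinite sequence of balls is thrown: conditionally on $(\rho(i))_{i\in\mathcal U}$ the balls behave independently, each ball starts in $\varnothing$, and a ball located in box $i$ goes to the sub-box $ij$ with probability $\rho_j(i)=p_{ij}/p_i$ (so each ball occupies exactly one box at each generation). For real $y$, $H_{n,y}$ is the first generation $k$ at which all boxes contain less than $y$ balls when the first $n$ balls have been thrown; $H_{n,n^\alpha}$ is this with $y=n^\alpha$. Constants. $\mathrm L(\theta)=\mathbb E\big[\sum_{j\in\mathbb N}\rho_j^\theta\big]$ for $\theta\in\mathbb R$, with the convention $0^\theta=0$ for all $\theta\in\mathbb{R}$; $\underline\theta=\inf\{\theta\in\mathbb R:\mathrm L(\theta)<\infty\}$; $\varphi(\theta)=\ln \mathrm L(\theta)-\theta\,\mathrm L'(\theta)/\mathrm L(\theta)$ for $\theta>\underline\theta$; $\theta^{\ast}=\sup\{\theta>\underline\theta:\varphi(\theta)>0\}\in(1,\infty]$; $C^{\ast}=\lim_{\theta\uparrow\theta^{\ast}}-\mathrm L(\theta)/\mathrm L'(\theta)$ (an increasing limit). Asymptotic notation: $X_n\le a\ln n+O(\ln\ln n)$ a.s. means that almost surely there is a finite (random) constant $K$ with $X_n\le a\ln n+K\ln\ln n$ for all large $n$; $X_n=a\ln n+O(\ln\ln n)$ a.s. means that almost surely $|X_n-a\ln n|\le K\ln\ln n$ for some finite random $K$ and all large $n$. *)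

theory Defs
  imports "HOL-Probability.Probability" "HOL-Library.Landau_Symbols"
begin

text \<open>
  Children are labelled by \<^typ>\<open>nat\<close>, i.e. from 0 instead of from 1, so the Ulam tree is the type
  \<^typ>\<open>nat list\<close>: the root is the empty list, the generation is the length, and the child
  with label \<open>j\<close> of the node \<open>i\<close> is \<open>i @ [j]\<close>.
\<close>

abbreviation mass_space :: "nat measure measure" where
  "mass_space \<equiv> prob_algebra (count_space UNIV)"


section \<open>Quantities depending only on the law of the random probability measure\<close>

definition geometric_law :: "nat measure measure \<Rightarrow> bool" where
  "geometric_law \<nu> \<longleftrightarrow>
     (\<exists>r::real. 0 < r \<and> r < 1 \<and>
        (AE p in \<nu>. \<forall>j. measure p {j} > 0 \<longrightarrow> (\<exists>n::nat. measure p {j} = r ^ n)))"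

text \<open>The convention \<open>0\<^sup>\<theta> = 0\<close>, for all real \<open>\<theta>\<close>, is the one built into \<open>powr\<close>.\<close>

definition L_fun :: "nat measure measure \<Rightarrow> real \<Rightarrow> ennreal" where
  "L_fun \<nu> \<theta> = (\<integral>\<^sup>+ p. (\<Sum>j. ennreal (measure p {j} powr \<theta>)) \<partial>\<nu>)"

text \<open>Meaningful only where \<^const>\<open>L_fun\<close> is finite, in particular above \<open>\<theta>_low\<close>.\<close>

definition L_real :: "nat measure measure \<Rightarrow> real \<Rightarrow> real" where
  "L_real \<nu> \<theta> = enn2real (L_fun \<nu> \<theta>)"

definition \<theta>_low :: "nat measure measure \<Rightarrow> ereal" where
  "\<theta>_low \<nu> = Inf {ereal \<theta> | \<theta>. L_fun \<nu> \<theta> < \<infinity>}"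

definition \<phi>_fun :: "nat measure measure \<Rightarrow> real \<Rightarrow> real" where
  "\<phi>_fun \<nu> \<theta> = ln (L_real \<nu> \<theta>) - \<theta> * deriv (L_real \<nu>) \<theta> / L_real \<nu> \<theta>"

definition \<theta>_star :: "nat measure measure \<Rightarrow> ereal" where
  "\<theta>_star \<nu> = Sup {ereal \<theta> | \<theta>. \<theta>_low \<nu> < ereal \<theta> \<and> \<phi>_fun \<nu> \<theta> > 0}"

text \<open>The limit is taken over \<^typ>\<open>ereal\<close> so that it also covers \<open>\<theta>_star \<nu> = \<infinity>\<close>.\<close>

definition C_star :: "nat measure measure \<Rightarrow> real" where
  "C_star \<nu> = Lim (at_left (\<theta>_star \<nu>))
     (\<lambda>x. - L_real \<nu> (real_of_ereal x) / deriv (L_real \<nu>) (real_of_ereal x))"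

definition num_atoms_moment :: "nat measure measure \<Rightarrow> real \<Rightarrow> ennreal" where
  "num_atoms_moment \<nu> s =
     (\<integral>\<^sup>+ p. (if finite {i. measure p {i} > 0}
              then ennreal (real (card {i. measure p {i} > 0}) powr s) else \<infinity>) \<partial>\<nu>)"


section \<open>The nested occupancy scheme\<close>

definition env_sigma :: "'w measure \<Rightarrow> (nat list \<Rightarrow> 'w \<Rightarrow> nat measure) \<Rightarrow> 'w measure" where
  "env_sigma M \<rho> =
     vimage_algebra (space M) (\<lambda>\<omega> i. \<rho> i \<omega>) (\<Pi>\<^sub>M i\<in>UNIV. mass_space)"

abbreviation cond_prob_given :: "'w measure \<Rightarrow> 'w measure \<Rightarrow> 'w set \<Rightarrow> 'w \<Rightarrow> real" where
  "cond_prob_given M G A \<equiv> real_cond_exp M G (indicator A)"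

definition cond_indep_sets :: "'w measure \<Rightarrow> 'w measure \<Rightarrow> ('i \<Rightarrow> 'w set set) \<Rightarrow> 'i set \<Rightarrow> bool" where
  "cond_indep_sets M G F I \<longleftrightarrow>
     (\<forall>J\<subseteq>I. J \<noteq> {} \<longrightarrow> finite J \<longrightarrow> (\<forall>A\<in>Pi J F.
        AE \<omega> in M. cond_prob_given M G (\<Inter>j\<in>J. A j) \<omega> = (\<Prod>j\<in>J. cond_prob_given M G (A j) \<omega>)))"

text \<open>
  Balls are numbered from 0, and \<open>\<xi> m \<omega>\<close> is the infinite sequence of child labels chosen by ball
  \<open>m\<close>: the box containing it at generation \<open>k\<close> is \<open>stake k (\<xi> m \<omega>)\<close>.  Hence every ball starts
  in the root and then moves from each box to one of its children. The transition assumption says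
  that, conditionally on the whole environment, a ball located in the box \<open>i\<close> (an event that
  determines the past of the ball) goes to \<open>i @ [j]\<close> with probability \<open>\<rho>\<^sub>j(i)\<close>.
\<close>

locale nested_occupancy = prob_space M
  for M :: "'w measure" +
  fixes \<nu> :: "nat measure measure"
    and \<rho> :: "nat list \<Rightarrow> 'w \<Rightarrow> nat measure"
    and \<xi> :: "nat \<Rightarrow> 'w \<Rightarrow> nat stream"
  assumes law_\<nu>: "\<nu> \<in> space (prob_algebra mass_space)"
    and indep_\<rho>: "indep_vars (\<lambda>_. mass_space) \<rho> UNIV"
    and distr_\<rho>: "\<And>i. distr M mass_space (\<rho> i) = \<nu>"
    and measurable_ball: "\<And>m. \<xi> m \<in> M \<rightarrow>\<^sub>M stream_space (count_space UNIV)"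
    and cond_indep_balls:
      "cond_indep_sets M (env_sigma M \<rho>)
         (\<lambda>m. sets (vimage_algebra (space M) (\<xi> m) (stream_space (count_space UNIV)))) UNIV"
    and transition:
      "\<And>m i j. AE \<omega> in M.
         cond_prob_given M (env_sigma M \<rho>)
           {\<omega> \<in> space M. stake (Suc (length i)) (\<xi> m \<omega>) = i @ [j]} \<omega> =
         measure (\<rho> i \<omega>) {j} *
         cond_prob_given M (env_sigma M \<rho>)
           {\<omega> \<in> space M. stake (length i) (\<xi> m \<omega>) = i} \<omega>"

definition box_size :: "(nat list \<Rightarrow> 'w \<Rightarrow> nat measure) \<Rightarrow> 'w \<Rightarrow> nat list \<Rightarrow> real" where
  "box_size \<rho> \<omega> i = (\<Prod>k<length i. measure (\<rho> (take k i) \<omega>) {i ! k})"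

lemma box_size_root: "box_size \<rho> \<omega> [] = 1"
  by (simp add: box_size_def)

lemma box_size_child: "box_size \<rho> \<omega> (i @ [j]) = box_size \<rho> \<omega> i * measure (\<rho> i \<omega>) {j}"
  by (simp add: box_size_def nth_append)

definition balls_in_box :: "(nat \<Rightarrow> 'w \<Rightarrow> nat stream) \<Rightarrow> 'w \<Rightarrow> nat \<Rightarrow> nat list \<Rightarrow> nat" where
  "balls_in_box \<xi> \<omega> n i = card {m. m < n \<and> stake (length i) (\<xi> m \<omega>) = i}"

text \<open>The infimum is \<open>\<infinity>\<close> if there is no such generation.\<close>

definition height ::
  "(nat list \<Rightarrow> 'w \<Rightarrow> nat measure) \<Rightarrow> (nat \<Rightarrow> 'w \<Rightarrow> nat stream) \<Rightarrow> 'w \<Rightarrow> nat \<Rightarrow> real \<Rightarrow> enat" where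
  "height \<rho> \<xi> \<omega> n y =
     Inf {enat k | k. \<forall>i. length i = k \<and> box_size \<rho> \<omega> i > 0 \<longrightarrow> real (balls_in_box \<xi> \<omega> n i) < y}"

end

theory Submission
  imports Defs "HOL-Real_Asymp.Real_Asymp"
begin

text \<open>
  Write \<open>\<mu> = 1 / C\<^sup>*\<close>, so that \<open>L(\<theta>\<^sup>*) = exp (- \<theta>\<^sup>* \<mu>)\<close>.

  Upper bound: a box of size \<open>p\<close> receives at least \<open>y\<close> of \<open>n\<close> balls with probability at most
  \<open>c (n p / y)\<^sup>\<theta>\<close>. Summing over generation \<open>k\<close> with \<open>\<theta> = \<theta>\<^sup>*\<close> gives
  \<open>c (n / y)\<^sup>\<theta> exp (- \<theta>\<^sup>* \<mu> k)\<close>, and Borel-Cantelli along \<open>n = 2\<^sup>j\<close> concludes.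

  Lower bound: by Chebyshev's inequality it suffices to find a box of size \<open>4 n\<^sup>\<alpha> / n\<close> in generation \<open>k\<close>.
  The probability \<open>u\<^sub>m(x)\<close> that some box of generation \<open>m\<close> is at least \<open>exp (- m \<mu> - a + x)\<close> obeys a
  discrete KPP recursion, and any subsolution of that recursion bounds it from below. The functions
  \<open>\<epsilon> exp (- \<theta> x) t\<^sup>-\<^sup>K G\<^sup>+(x / sqrt t)\<close> with \<open>t = m + t\<^sub>0\<close> and a Gaussian bump \<open>G\<close> are subsolutions at
  \<open>\<theta> = \<theta>\<^sup>*\<close>: tilting by \<open>\<theta>\<close> makes the displacements centred, and \<open>G\<close> is convex where it vanishes.
  Hence \<open>u\<^sub>m\<close> decays at most polynomially, and independent trials in the \<open>O(log k)\<close> first generations,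
  whose boxes are not too small if \<open>L(- \<delta>) < \<infinity>\<close>, make the failure probability summable. For the
  first-order statement one takes \<open>\<theta> < \<theta>\<^sup>*\<close>, where a stationary profile is a subsolution, so that
  lines of descent with nearly optimal speed exist with positive probability, hence almost surely
  by a zero-one law.
\<close>

section \<open>Branching structure of the environment\<close>

text \<open>At the critical exponent the tilted recursion has growth factor exactly 1, so a
  stationary profile has nothing with which to pay for the killing at its boundary. Letting the
  profile spread diffusively with a prefactor \<open>t^(-K)\<close> supplies the payment: the decay
  of the prefactor contributes \<open>K G / t\<close>, which outweighs the concavity of
  \<open>G\<close> in the middle, and near the two zeros the convexity of \<open>G\<close> outweighs
  the drift of the rescaling. The surplus, of order \<open>t^(-K-1)\<close>, covers both the Taylor
  remainder, of order \<open>t^(-K-3/2)\<close>, and the quadratic error of the branching recursion,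
  of order \<open>t^(-2K)\<close>. The quadratic error arises from
  \<open>1 - prod (1 - w) >= S - S^2\<close>, where \<open>S\<close> is the sum of \<open>w\<close>
  over the children. Conservation of mass bounds \<open>S\<close> pointwise: siblings of masses
  \<open>p\<close> satisfy \<open>sum p^\<theta> <= 1\<close> when \<theta> > 1.\<close>

definition bx :: "(nat list \<Rightarrow> nat measure) \<Rightarrow> nat list \<Rightarrow> real" where
  "bx e i = (\<Prod>k<length i. measure (e (take k i)) {i ! k})"

definition subenv :: "(nat list \<Rightarrow> 'a) \<Rightarrow> nat \<Rightarrow> nat list \<Rightarrow> 'a" where
  "subenv e c = (\<lambda>i. e (c # i))"

lemma box_size_eq_bx: "box_size \<rho> \<omega> i = bx (\<lambda>i. \<rho> i \<omega>) i"
  by (simp add: box_size_def bx_def)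

lemma bx_Nil [simp]: "bx e [] = 1"
  by (simp add: bx_def)

lemma bx_Cons: "bx e (c # i) = measure (e []) {c} * bx (subenv e c) i"
  unfolding bx_def length_Cons
  by (subst prod.lessThan_Suc_shift) (simp add: subenv_def)

lemma bx_nonneg [simp]: "bx e i \<ge> 0"
  by (simp add: bx_def prod_nonneg)

lemma bx_snoc: "bx e (i @ [j]) = bx e i * measure (e i) {j}"
  by (simp add: bx_def nth_append)

lemma bx_append: "bx e (i @ j) = bx e i * bx (\<lambda>k. e (i @ k)) j"
  by (induction i arbitrary: e) (simp_all add: bx_Cons subenv_def)

definition graft :: "'a \<times> (nat \<Rightarrow> nat list \<Rightarrow> 'a) \<Rightarrow> nat list \<Rightarrow> 'a" where
  "graft = (\<lambda>(r, Y) i. case i of [] \<Rightarrow> r | c # j \<Rightarrow> Y c j)"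

lemma graft_simps [simp]: "graft (r, Y) [] = r" "subenv (graft (r, Y)) c = Y c" "graft (r, Y) (c # j) = Y c j"
  by (simp_all add: graft_def subenv_def)

section \<open>The product law of the environment and its decomposition at the root\<close>

locale mass_law =
  fixes \<nu> :: "nat measure measure"
  assumes law_nu: "\<nu> \<in> space (prob_algebra mass_space)"
begin

sublocale nu: prob_space \<nu>
  using law_nu by (simp add: space_prob_algebra)

lemma sets_nu [measurable_cong]: "sets \<nu> = sets mass_space"
  using law_nu by (simp add: space_prob_algebra)

lemma space_nu: "space \<nu> = {p. sets p = UNIV \<and> prob_space p}"
proof -
  have "space \<nu> = space mass_space" by (rule sets_eq_imp_space_eq[OF sets_nu])
  thus ?thesis by (simp add: space_prob_algebra)
qed

lemma measurable_mass [measurable]: "(\<lambda>p. measure p {j}) \<in> borel_measurable \<nu>"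
  by measurable

definition PE :: "(nat list \<Rightarrow> nat measure) measure" where
  "PE = PiM UNIV (\<lambda>_. \<nu>)"

sublocale PE_prod: product_prob_space "\<lambda>_. \<nu>" "UNIV :: nat list set"
  by unfold_locales

sublocale PE: prob_space PE
  unfolding PE_def by (rule prob_space_PiM) (rule nu.prob_space_axioms)

lemma sets_PE [measurable_cong]: "sets PE = sets (PiM UNIV (\<lambda>_. \<nu>))"
  by (simp add: PE_def)

lemma measurable_env [measurable]: "(\<lambda>e. e i) \<in> PE \<rightarrow>\<^sub>M \<nu>"
  unfolding PE_def by (rule measurable_component_singleton) simp

lemma measurable_env_mass [measurable]: "(\<lambda>e. measure (e i) {j}) \<in> borel_measurable PE"
  by (rule measurable_compose[OF measurable_env measurable_mass])

lemma measurable_PE_I: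
  assumes "\<And>i. (\<lambda>x. f x i) \<in> N \<rightarrow>\<^sub>M \<nu>"
  shows "f \<in> N \<rightarrow>\<^sub>M PE"
proof -
  have "(\<lambda>x. \<lambda>i\<in>UNIV. f x i) \<in> N \<rightarrow>\<^sub>M PE"
    unfolding PE_def by (rule measurable_restrict) (rule assms)
  moreover have "(\<lambda>x. \<lambda>i\<in>UNIV. f x i) = f" by (intro ext) simp
  ultimately show ?thesis by simp
qed

lemma measurable_subenv [measurable]: "(\<lambda>e. subenv e c) \<in> PE \<rightarrow>\<^sub>M PE"
  by (rule measurable_PE_I) (simp add: subenv_def)

lemma measurable_bx [measurable]: "(\<lambda>e. bx e i) \<in> borel_measurable PE"
  unfolding bx_def by measurable

text \<open>The law of the family of sub-environments, indexed by the children of the root.\<close>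

definition PP :: "(nat \<Rightarrow> nat list \<Rightarrow> nat measure) measure" where
  "PP = PiM UNIV (\<lambda>_. PE)"

sublocale PP_prod: product_prob_space "\<lambda>_. PE" "UNIV :: nat set"
  by unfold_locales

sublocale PP: prob_space PP
  unfolding PP_def by (rule prob_space_PiM) (rule PE.prob_space_axioms)

lemma sets_PP [measurable_cong]: "sets PP = sets (PiM UNIV (\<lambda>_. PE))"
  by (simp add: PP_def)

lemma measurable_PP_component [measurable]: "(\<lambda>Y. Y c) \<in> PP \<rightarrow>\<^sub>M PE"
  unfolding PP_def by (rule measurable_component_singleton) simp

lemma measurable_graft [measurable]: "graft \<in> \<nu> \<Otimes>\<^sub>M PP \<rightarrow>\<^sub>M PE"
proof (rule measurable_PE_I)
  fix i :: "nat list"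
  show "(\<lambda>x. graft x i) \<in> \<nu> \<Otimes>\<^sub>M PP \<rightarrow>\<^sub>M \<nu>"
  proof (cases i)
    case Nil
    thus ?thesis by (simp add: graft_def split_beta)
  next
    case (Cons c j)
    have "(\<lambda>x. (snd x c) j) \<in> \<nu> \<Otimes>\<^sub>M PP \<rightarrow>\<^sub>M \<nu>"
      by (rule measurable_compose[OF measurable_compose[OF measurable_snd measurable_PP_component] measurable_env])
    thus ?thesis by (simp add: graft_def split_beta Cons)
  qed
qed

lemma space_PE: "space PE = UNIV \<rightarrow> space \<nu>"
  by (auto simp: PE_def space_PiM PiE_def)

lemma space_PP: "space PP = UNIV \<rightarrow> space PE"
  by (auto simp: PP_def space_PiM PiE_def)

lemma emeasure_PE_Collect:
  assumes "finite J" "\<And>i. i \<in> J \<Longrightarrow> X i \<in> sets \<nu>"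
  shows "emeasure PE {e \<in> space PE. \<forall>i\<in>J. e i \<in> X i} = (\<Prod>i\<in>J. emeasure \<nu> (X i))"
  unfolding PE_def using PE_prod.emeasure_PiM_Collect[of J X] assms by simp

lemma emeasure_PP_Collect:
  assumes "finite J" "\<And>i. i \<in> J \<Longrightarrow> X i \<in> sets PE"
  shows "emeasure PP {e \<in> space PP. \<forall>i\<in>J. e i \<in> X i} = (\<Prod>i\<in>J. emeasure PE (X i))"
  unfolding PP_def using PP_prod.emeasure_PiM_Collect[of J X] assms by simp

text \<open>The branching property. A product measure is determined by its finite cylinders, and a
  cylinder over \<open>J\<close> splits into a condition at the root and one cylinder in the
  sub-environment of each child below which \<open>J\<close> has an index.\<close>

lemma distr_graft: "distr (\<nu> \<Otimes>\<^sub>M PP) PE graft = PE"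
proof -
  have "PiM UNIV (\<lambda>_. \<nu>) = distr (\<nu> \<Otimes>\<^sub>M PP) PE graft"
  proof (rule measure_eqI_PiM_infinite[OF refl])
    show "sets (distr (\<nu> \<Otimes>\<^sub>M PP) PE graft) = PE_prod.events" by (simp add: PE_def)
    show "finite_measure (PiM (UNIV::nat list set) (\<lambda>_. \<nu>))"
      using PE.finite_measure_axioms by (simp add: PE_def)
  next
    fix A :: "nat list \<Rightarrow> nat measure set" and J
    assume J: "finite J" "J \<subseteq> UNIV" and A: "\<And>i. i \<in> J \<Longrightarrow> A i \<in> sets \<nu>"
    \<comment> \<open>\<open>C\<close> collects the children met by \<open>J\<close>, and
      \<open>D c\<close> is the trace of \<open>J\<close> below \<open>c\<close>; both are
      finite.\<close>
    define C where "C = {c. \<exists>j. c # j \<in> J}"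
    define D where "D c = {j. c # j \<in> J}" for c
    have finD: "finite (D c)" for c
    proof -
      have "(\<lambda>j. c # j) ` D c \<subseteq> J" by (auto simp: D_def)
      thus ?thesis using J(1) by (meson finite_imageD finite_subset inj_onI list.inject)
    qed
    have finC: "finite C"
    proof -
      have "C \<subseteq> hd ` J" by (force simp: C_def image_iff)
      thus ?thesis using J(1) finite_surj by blast
    qed
    define E where "E c = {e \<in> space PE. \<forall>j\<in>D c. e j \<in> A (c # j)}" for c
    have E: "E c \<in> sets PE" for c
      unfolding E_def
    proof (intro sets.sets_Collect_finite_All finD)
      fix j assume "j \<in> D c"
      hence "A (c # j) \<in> sets \<nu>" by (intro A) (simp add: D_def)
      from measurable_sets[OF measurable_env this] show "{e \<in> space PE. e j \<in> A (c # j)} \<in> PE.events"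
        by (simp add: vimage_def Int_def conj_commute)
    qed
    define A0 where "A0 = (if [] \<in> J then A [] else space \<nu>)"
    have A0: "A0 \<in> sets \<nu>" using A by (auto simp: A0_def)
    let ?X = "prod_emb UNIV (\<lambda>_. \<nu>) J (Pi\<^sub>E J A)"
    have X: "?X = {e \<in> space PE. \<forall>i\<in>J. e i \<in> A i}"
      unfolding prod_emb_def space_PE using sets.sets_into_space[OF A]
      by (auto simp: space_PiM PiE_def Pi_def)
    have Xs: "?X \<in> sets PE" unfolding PE_def using J A by (intro sets_PiM_I) auto
    have split: "(\<forall>i\<in>J. P i) \<longleftrightarrow> ([] \<in> J \<longrightarrow> P []) \<and> (\<forall>c\<in>C. \<forall>j\<in>D c. P (c # j))" for P
    proof safe
      fix i assume *: "P []" "\<forall>c\<in>C. \<forall>j\<in>D c. P (c # j)" "i \<in> J"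
      thus "P i" by (cases i) (auto simp: C_def D_def)
    next
      fix i assume *: "[] \<notin> J" "\<forall>c\<in>C. \<forall>j\<in>D c. P (c # j)" "i \<in> J"
      thus "P i" by (cases i) (auto simp: C_def D_def)
    qed (auto simp: C_def D_def)
    have pre: "graft -` ?X \<inter> space (\<nu> \<Otimes>\<^sub>M PP) = A0 \<times> {Y \<in> space PP. \<forall>c\<in>C. Y c \<in> E c}"
    proof (intro set_eqI iffI)
      fix z assume z: "z \<in> graft -` ?X \<inter> space (\<nu> \<Otimes>\<^sub>M PP)"
      obtain r Y where [simp]: "z = (r, Y)" by (cases z)
      have sp: "r \<in> space \<nu>" "Y \<in> space PP" using z by (auto simp: space_pair_measure)
      have "\<forall>i\<in>J. graft z i \<in> A i" using z X by auto
      hence "([] \<in> J \<longrightarrow> r \<in> A []) \<and> (\<forall>c\<in>C. \<forall>j\<in>D c. Y c j \<in> A (c # j))"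
        by (subst (asm) split) simp
      thus "z \<in> A0 \<times> {Y \<in> space PP. \<forall>c\<in>C. Y c \<in> E c}"
        using sp by (auto simp: A0_def E_def space_PP)
    next
      fix z assume z: "z \<in> A0 \<times> {Y \<in> space PP. \<forall>c\<in>C. Y c \<in> E c}"
      obtain r Y where [simp]: "z = (r, Y)" by (cases z)
      have sp: "r \<in> space \<nu>" "Y \<in> space PP" using z sets.sets_into_space[OF A0] by auto
      have "\<forall>i\<in>J. graft z i \<in> A i"
        using z by (subst split) (auto simp: E_def A0_def)
      moreover have "z \<in> space (\<nu> \<Otimes>\<^sub>M PP)" using sp by (simp add: space_pair_measure)
      moreover from this have "graft z \<in> space PE" by (rule measurable_space[OF measurable_graft])
      ultimately show "z \<in> graft -` ?X \<inter> space (\<nu> \<Otimes>\<^sub>M PP)" by (simp add: X)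
    qed
    have "emeasure (PiM UNIV (\<lambda>_. \<nu>)) ?X = (\<Prod>i\<in>J. emeasure \<nu> (A i))"
      using emeasure_PE_Collect[OF J(1) A] X by (simp add: PE_def)
    also have "\<dots> = emeasure \<nu> A0 * (\<Prod>i\<in>J - {[]}. emeasure \<nu> (A i))"
      using J by (auto simp: A0_def prod.remove nu.emeasure_space_1)
    also have "(\<Prod>i\<in>J - {[]}. emeasure \<nu> (A i)) = (\<Prod>(c,j)\<in>Sigma C D. emeasure \<nu> (A (c # j)))"
    proof (rule prod.reindex_bij_witness[of _ "\<lambda>(c,j). c # j" "\<lambda>i. (hd i, tl i)"])
      fix a assume "a \<in> J - {[]}"
      thus "(hd a, tl a) \<in> Sigma C D" by (cases a) (auto simp: C_def D_def)
    qed (auto simp: C_def D_def)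
    also have "\<dots> = (\<Prod>c\<in>C. \<Prod>j\<in>D c. emeasure \<nu> (A (c # j)))"
      using finC finD by (subst prod.Sigma) auto
    also have "\<dots> = (\<Prod>c\<in>C. emeasure PE (E c))"
      unfolding E_def by (intro prod.cong refl emeasure_PE_Collect[symmetric] finD) (auto simp: D_def intro!: A)
    also have "\<dots> = emeasure PP {Y \<in> space PP. \<forall>c\<in>C. Y c \<in> E c}"
      by (intro emeasure_PP_Collect[symmetric] finC E)
    also have "emeasure \<nu> A0 * \<dots> = emeasure (\<nu> \<Otimes>\<^sub>M PP) (A0 \<times> {Y \<in> space PP. \<forall>c\<in>C. Y c \<in> E c})"
      using A0 E finC by (intro PP.emeasure_pair_measure_Times[symmetric] sets.sets_Collect_finite_All
         measurable_sets_Collect[OF measurable_PP_component]) auto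
    also have "\<dots> = emeasure (distr (\<nu> \<Otimes>\<^sub>M PP) PE graft) ?X"
      using Xs by (simp add: emeasure_distr pre)
    finally show "emeasure (PiM UNIV (\<lambda>_. \<nu>)) ?X = emeasure (distr (\<nu> \<Otimes>\<^sub>M PP) PE graft) ?X" .
  qed
  thus ?thesis by (simp add: PE_def)
qed

lemma nn_integral_PE:
  assumes [measurable]: "F \<in> borel_measurable PE"
  shows "(\<integral>\<^sup>+e. F e \<partial>PE) = (\<integral>\<^sup>+r. \<integral>\<^sup>+Y. F (graft (r, Y)) \<partial>PP \<partial>\<nu>)"
proof -
  have "(\<integral>\<^sup>+e. F e \<partial>PE) = (\<integral>\<^sup>+e. F e \<partial>distr (\<nu> \<Otimes>\<^sub>M PP) PE graft)" by (simp add: distr_graft)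
  also have "\<dots> = (\<integral>\<^sup>+z. F (graft z) \<partial>(\<nu> \<Otimes>\<^sub>M PP))" by (rule nn_integral_distr[OF measurable_graft]) simp
  also have "\<dots> = (\<integral>\<^sup>+r. \<integral>\<^sup>+Y. F (graft (r, Y)) \<partial>PP \<partial>\<nu>)"
    by (rule PP.nn_integral_fst[symmetric]) measurable
  finally show ?thesis .
qed

lemma distr_PP_component: "distr PP PE (\<lambda>Y. Y c) = PE"
  unfolding PP_def by (rule distr_PiM_component) (auto intro: PE.prob_space_axioms)

lemma nn_integral_child:
  assumes [measurable]: "f \<in> borel_measurable PE" "g \<in> borel_measurable \<nu>"
  shows "(\<integral>\<^sup>+e. g (e []) * f (subenv e c) \<partial>PE) = (\<integral>\<^sup>+r. g r \<partial>\<nu>) * (\<integral>\<^sup>+e. f e \<partial>PE)"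
proof -
  have "(\<integral>\<^sup>+e. g (e []) * f (subenv e c) \<partial>PE) = (\<integral>\<^sup>+r. \<integral>\<^sup>+Y. g r * f (Y c) \<partial>PP \<partial>\<nu>)"
    by (subst nn_integral_PE) auto
  also have "\<dots> = (\<integral>\<^sup>+r. g r * \<integral>\<^sup>+Y. f (Y c) \<partial>PP \<partial>\<nu>)"
    by (intro nn_integral_cong nn_integral_cmult) measurable
  also have "(\<integral>\<^sup>+Y. f (Y c) \<partial>PP) = (\<integral>\<^sup>+e. f e \<partial>distr PP PE (\<lambda>Y. Y c))"
    by (subst nn_integral_distr) auto
  finally show ?thesis by (simp add: distr_PP_component nn_integral_multc)
qed

text \<open>Given the root, the sub-environments are independent, hence the product under the
  integral. The condition \<open>Q c\<close> may depend on the root as well. \<open>J\<close> is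
  finite here; all children are reached later by letting \<open>J\<close> grow.\<close>

lemma emeasure_children:
  assumes Q: "\<And>c. Measurable.pred (\<nu> \<Otimes>\<^sub>M PE) (\<lambda>(r, e). Q c r e)" and J: "finite J"
  shows "emeasure PE {e \<in> space PE. \<forall>c\<in>J. Q c (e []) (subenv e c)}
    = (\<integral>\<^sup>+r. (\<Prod>c\<in>J. emeasure PE {e \<in> space PE. Q c r e}) \<partial>\<nu>)"
proof -
  have Q': "Measurable.pred N (\<lambda>x. Q c (f x) (g x))"
    if [measurable]: "f \<in> N \<rightarrow>\<^sub>M \<nu>" "g \<in> N \<rightarrow>\<^sub>M PE" for N c and f :: "'a \<Rightarrow> _" and g
    using measurable_compose[OF measurable_Pair[OF that] Q[of c]] by simp
  have [measurable]: "Measurable.pred PE (\<lambda>e. Q c (e []) (subenv e c))" for c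
    by (rule Q') measurable
  have m: "{e \<in> space PE. \<forall>c\<in>J. Q c (e []) (subenv e c)} \<in> sets PE"
    using J by measurable
  have "emeasure PE {e \<in> space PE. \<forall>c\<in>J. Q c (e []) (subenv e c)}
     = (\<integral>\<^sup>+e. indicator {e \<in> space PE. \<forall>c\<in>J. Q c (e []) (subenv e c)} e \<partial>PE)"
    using m by simp
  also have "\<dots> = (\<integral>\<^sup>+r. \<integral>\<^sup>+Y. indicator {e \<in> space PE. \<forall>c\<in>J. Q c (e []) (subenv e c)} (graft (r, Y)) \<partial>PP \<partial>\<nu>)"
    by (subst nn_integral_PE) (use m in auto)
  also have "\<dots> = (\<integral>\<^sup>+r. (\<Prod>c\<in>J. emeasure PE {e \<in> space PE. Q c r e}) \<partial>\<nu>)"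
  proof (rule nn_integral_cong)
    fix r assume r: "r \<in> space \<nu>"
    have Qr: "{e \<in> space PE. Q c r e} \<in> sets PE" for c
      using Q'[of "\<lambda>_. r" PE "\<lambda>e. e" c] r by simp
    have "(\<integral>\<^sup>+Y. indicator {e \<in> space PE. \<forall>c\<in>J. Q c (e []) (subenv e c)} (graft (r, Y)) \<partial>PP)
      = (\<integral>\<^sup>+Y. indicator {Y \<in> space PP. \<forall>c\<in>J. Y c \<in> {e \<in> space PE. Q c r e}} Y \<partial>PP)"
    proof (rule nn_integral_cong)
      fix Y assume Y: "Y \<in> space PP"
      have "(r, Y) \<in> space (\<nu> \<Otimes>\<^sub>M PP)" using r Y by (simp add: space_pair_measure)
      hence "graft (r, Y) \<in> space PE" by (rule measurable_space[OF measurable_graft])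
      thus "(indicator {e \<in> space PE. \<forall>c\<in>J. Q c (e []) (subenv e c)} (graft (r, Y)) :: ennreal)
        = indicator {Y \<in> space PP. \<forall>c\<in>J. Y c \<in> {e \<in> space PE. Q c r e}} Y"
        using Y by (auto simp: indicator_def space_PP Pi_def)
    qed
    also have "\<dots> = emeasure PP {Y \<in> space PP. \<forall>c\<in>J. Y c \<in> {e \<in> space PE. Q c r e}}"
      using J Qr by (intro nn_integral_indicator sets.sets_Collect_finite_All measurable_sets_Collect[OF measurable_PP_component]) auto
    also have "\<dots> = (\<Prod>c\<in>J. emeasure PE {e \<in> space PE. Q c r e})"
      by (rule emeasure_PP_Collect[OF J Qr])
    finally show "(\<integral>\<^sup>+Y. indicator {e \<in> space PE. \<forall>c\<in>J. Q c (e []) (subenv e c)} (graft (r, Y)) \<partial>PP)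
      = (\<Prod>c\<in>J. emeasure PE {e \<in> space PE. Q c r e})" .
  qed
  finally show ?thesis .
qed

section \<open>Moments of the box sizes\<close>

lemma powr_bx_Cons:
  "ennreal (bx e (c # i) powr \<theta>) = ennreal (measure (e []) {c} powr \<theta>) * ennreal (bx (subenv e c) i powr \<theta>)"
  by (simp add: bx_Cons powr_mult ennreal_mult)

lemma nn_integral_bx_powr:
  "(\<integral>\<^sup>+e. ennreal (bx e i powr \<theta>) \<partial>PE)
    = prod_list (map (\<lambda>c. \<integral>\<^sup>+p. ennreal (measure p {c} powr \<theta>) \<partial>\<nu>) i)"
proof (induction i)
  case Nil
  show ?case by (simp add: PE.emeasure_space_1)
next
  case (Cons c i)
  show ?case
    unfolding powr_bx_Cons by (subst nn_integral_child) (auto simp: Cons)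
qed

text \<open>Sums over a generation are written as integrals over a counting measure, so that
  splitting off the first label is an instance of Tonelli's theorem.\<close>

lemma nn_integral_lists_Suc:
  fixes f :: "'c::countable list \<Rightarrow> ennreal"
  shows "(\<integral>\<^sup>+i. f i \<partial>count_space {i. length i = Suc k})
    = (\<integral>\<^sup>+c. \<integral>\<^sup>+i. f (c # i) \<partial>count_space {i. length i = k} \<partial>count_space UNIV)"
proof -
  have "bij_betw (\<lambda>(c, i). c # i) (UNIV \<times> {i :: 'c list. length i = k}) {i. length i = Suc k}"
    by (rule bij_betwI[of _ _ _ "\<lambda>i. (hd i, tl i)"]) (auto simp: length_Suc_conv)
  from nn_integral_bij_count_space[OF this, of f]
  have "(\<integral>\<^sup>+i. f i \<partial>count_space {i. length i = Suc k})
     = (\<integral>\<^sup>+z. f (fst z # snd z) \<partial>count_space (UNIV \<times> {i. length i = k}))"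
    by (simp add: split_beta)
  also have "\<dots> = (\<integral>\<^sup>+z. f (fst z # snd z) \<partial>(count_space UNIV \<Otimes>\<^sub>M count_space {i. length i = k}))"
    by (subst pair_measure_countable) auto
  also have "\<dots> = (\<integral>\<^sup>+c. \<integral>\<^sup>+i. f (c # i) \<partial>count_space {i. length i = k} \<partial>count_space UNIV)"
    by (subst sigma_finite_measure.nn_integral_fst[symmetric])
       (auto intro!: sigma_finite_measure_count_space_countable simp: pair_measure_countable)
  finally show ?thesis .
qed

lemma nn_integral_prod_list:
  fixes l :: "nat \<Rightarrow> ennreal"
  shows "(\<integral>\<^sup>+i. prod_list (map l i) \<partial>count_space {i. length i = k}) = (\<Sum>c. l c) ^ k"
proof (induction k)
  case 0
  have "{i :: nat list. length i = 0} = {[]}" by auto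
  thus ?case by (simp add: nn_integral_count_space_finite)
next
  case (Suc k)
  show ?case
    unfolding nn_integral_lists_Suc
    by (simp add: nn_integral_cmult nn_integral_multc Suc nn_integral_count_space_nat)
qed

lemma L_fun_eq: "L_fun \<nu> \<theta> = (\<Sum>c. \<integral>\<^sup>+p. ennreal (measure p {c} powr \<theta>) \<partial>\<nu>)"
  unfolding L_fun_def by (rule nn_integral_suminf) simp

text \<open>Independence along a line of descent turns the moment of one box into a product over its
  labels, and summing over all label sequences factorizes.\<close>

lemma many_to_one_powr:
  "(\<integral>\<^sup>+i. (\<integral>\<^sup>+e. ennreal (bx e i powr \<theta>) \<partial>PE) \<partial>count_space {i. length i = k}) = L_fun \<nu> \<theta> ^ k"
  unfolding nn_integral_bx_powr nn_integral_prod_list L_fun_eq ..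

lemma mass_sums: "p \<in> space \<nu> \<Longrightarrow> (\<lambda>j. measure p {j}) sums 1"
proof -
  assume p: "p \<in> space \<nu>"
  then interpret p: prob_space p by (simp add: space_nu)
  have "(\<lambda>j. measure p {j}) sums measure p (\<Union>j. {j})"
    using p by (intro p.finite_measure_UNION) (auto simp: space_nu disjoint_family_on_def)
  also have "(\<Union>j. {j}) = space p" using p sets_eq_imp_space_eq[of p "count_space UNIV"] by (auto simp: space_nu)
  finally show ?thesis by (simp add: p.prob_space)
qed

lemma mass_le_1: "p \<in> space \<nu> \<Longrightarrow> measure p {j} \<le> 1"
  by (simp add: space_nu prob_space.prob_le_1)

lemma ex_atom: "p \<in> space \<nu> \<Longrightarrow> \<exists>j. measure p {j} > 0"
proof (rule ccontr)
  assume "p \<in> space \<nu>" and "\<nexists>j. measure p {j} > 0"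
  hence "(\<lambda>j. 0::real) sums 1"
    using mass_sums[of p] by (metis linorder_neqE_linordered_idom measure_nonneg not_le sums_cong)
  thus False by (simp add: sums_iff)
qed

text \<open>Conservation of mass, since \<open>p^\<theta> <= p\<close>. This pointwise bound
  controls the quadratic error in \<open>tilted_step\<close>.\<close>

lemma sum_mass_powr_le:
  assumes "p \<in> space \<nu>" "\<theta> \<ge> 1"
  shows "(\<Sum>c<J. measure p {c} powr \<theta>) \<le> 1"
proof -
  have "(\<Sum>c<J. measure p {c} powr \<theta>) \<le> (\<Sum>c<J. measure p {c})"
  proof (rule sum_mono)
    fix c
    show "measure p {c} powr \<theta> \<le> measure p {c}"
      using powr_mono'[of 1 \<theta> "measure p {c}"] assms mass_le_1[of p c] by simp
  qed
  also have "\<dots> \<le> 1"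
    using mass_sums[OF assms(1)] by (intro sum_le_suminf[of _ "{..<J}", THEN order_trans]) (auto simp: sums_iff)
  finally show ?thesis .
qed

section \<open>Failure probabilities over one generation\<close>

definition split_prob :: real where
  "split_prob = measure \<nu> {p \<in> space \<nu>. \<exists>c d. c \<noteq> d \<and> measure p {c} > 0 \<and> measure p {d} > 0}"

definition inherit :: "(nat list \<Rightarrow> nat measure) set \<Rightarrow> (nat list \<Rightarrow> nat measure) set" where
  "inherit A = {e \<in> space PE. \<exists>c. measure (e []) {c} > 0 \<and> subenv e c \<in> A}"

lemma sets_inherit [measurable]: "A \<in> sets PE \<Longrightarrow> inherit A \<in> sets PE"
proof -
  assume A: "A \<in> sets PE"
  have [measurable]: "Measurable.pred PE (\<lambda>e. subenv e c \<in> A)" for c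
    by (rule pred_sets2[OF A measurable_subenv])
  show ?thesis unfolding inherit_def by measurable
qed

text \<open>For failure, every child of positive mass has to fail, and these failures are
  independent given the root. There is always at least one such child, and with probability
  \<open>split_prob\<close> there are at least two.\<close>

lemma fail_inherit_le:
  assumes A [measurable]: "A \<in> sets PE"
  shows "1 - measure PE (inherit A)
    \<le> (1 - split_prob) * (1 - measure PE A) + split_prob * (1 - measure PE A)^2"
proof -
  define q where "q = 1 - measure PE A"
  have q: "0 \<le> q" "q \<le> 1" by (auto simp: q_def)
  define S2 where "S2 = {p \<in> space \<nu>. \<exists>c d. c \<noteq> d \<and> measure p {c} > 0 \<and> measure p {d} > 0}"
  have S2[measurable]: "S2 \<in> sets \<nu>" unfolding S2_def by measurable
  \<comment> \<open>The conditional probability, given the root, that all of the first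
    \<open>J\<close> children fail, where \<open>q\<close> is the failure probability of a single
    one.\<close>
  define h where "h J p = (\<Prod>c<J. if measure p {c} > 0 then q else 1)" for J :: nat and p :: "nat measure"
  have h01: "0 \<le> h J p" "h J p \<le> 1" for J p
    using q by (auto simp: h_def intro!: prod_nonneg prod_le_1)
  have hdec: "h (Suc J) p \<le> h J p" for J p
    using q h01[of J p] by (auto simp: h_def mult_left_le)
  define Q where "Q c r e \<longleftrightarrow> \<not> (measure r {c} > 0 \<and> e \<in> A)" for c :: nat and r :: "nat measure" and e
  have Q: "Measurable.pred (\<nu> \<Otimes>\<^sub>M PE) (\<lambda>(r, e). Q c r e)" for c
    unfolding Q_def by measurable
  have bound: "ennreal (1 - measure PE (inherit A)) \<le> (\<integral>\<^sup>+p. ennreal (h J p) \<partial>\<nu>)" for J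
  proof -
    have "ennreal (1 - measure PE (inherit A)) = emeasure PE (space PE - inherit A)"
      by (simp add: PE.prob_compl PE.emeasure_eq_measure)
    also have "\<dots> \<le> emeasure PE {e \<in> space PE. \<forall>c\<in>{..<J}. Q c (e []) (subenv e c)}"
    proof (rule emeasure_mono)
      show "{e \<in> space PE. \<forall>c\<in>{..<J}. Q c (e []) (subenv e c)} \<in> PE.events"
        unfolding Q_def by measurable
    qed (auto simp: Q_def inherit_def)
    also have "\<dots> = (\<integral>\<^sup>+r. (\<Prod>c<J. emeasure PE {e \<in> space PE. Q c r e}) \<partial>\<nu>)"
      by (rule emeasure_children[OF Q]) simp
    also have "\<dots> = (\<integral>\<^sup>+p. ennreal (h J p) \<partial>\<nu>)"
    proof (rule nn_integral_cong)
      fix r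
      have "emeasure PE {e \<in> space PE. Q c r e} = ennreal (if measure r {c} > 0 then q else 1)" for c
      proof (cases "measure r {c} > 0")
        case True
        hence "{e \<in> space PE. Q c r e} = space PE - A" by (auto simp: Q_def)
        thus ?thesis using True by (simp add: PE.prob_compl PE.emeasure_eq_measure q_def)
      qed (auto simp: Q_def PE.emeasure_space_1)
      thus "(\<Prod>c<J. emeasure PE {e \<in> space PE. Q c r e}) = ennreal (h J r)"
        using q by (simp add: h_def prod_ennreal)
    qed
    finally show ?thesis .
  qed
  \<comment> \<open>The limit over \<open>J\<close> is taken before estimating, since the position
    of the first two atoms is random.\<close>
  have "ennreal (1 - measure PE (inherit A)) \<le> (INF J. \<integral>\<^sup>+p. ennreal (h J p) \<partial>\<nu>)"
    using bound by (rule INF_greatest)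
  also have "\<dots> = (\<integral>\<^sup>+p. (INF J. ennreal (h J p)) \<partial>\<nu>)"
  proof (rule nn_integral_monotone_convergence_INF_decseq[symmetric])
    show "decseq (\<lambda>J p. ennreal (h J p))"
      by (intro decseq_SucI le_funI ennreal_leI hdec)
    show "(\<integral>\<^sup>+p. ennreal (h 0 p) \<partial>\<nu>) < \<infinity>" by (simp add: h_def nu.emeasure_space_1)
    show "(\<lambda>p. ennreal (h J p)) \<in> borel_measurable \<nu>" for J unfolding h_def by measurable
  qed
  also have "\<dots> \<le> (\<integral>\<^sup>+p. ennreal q * indicator (space \<nu> - S2) p + ennreal (q^2) * indicator S2 p \<partial>\<nu>)"
  proof (rule nn_integral_mono)
    fix p assume p: "p \<in> space \<nu>"
    show "(INF J. ennreal (h J p)) \<le> ennreal q * indicator (space \<nu> - S2) p + ennreal (q^2) * indicator S2 p"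
    proof (cases "p \<in> S2")
      case True
      then obtain c d where cd: "c \<noteq> d" "measure p {c} > 0" "measure p {d} > 0" by (auto simp: S2_def)
      define J where "J = Suc (max c d)"
      have "h J p = (\<Prod>j\<in>{c,d}. if measure p {j} > 0 then q else 1) * (\<Prod>j\<in>{..<J} - {c,d}. if measure p {j} > 0 then q else 1)"
        unfolding h_def by (subst prod.subset_diff[of "{c,d}"]) (auto simp: J_def mult.commute)
      also have "\<dots> \<le> q^2 * 1"
        using q cd by (intro mult_mono prod_le_1 prod_nonneg) (auto simp: power2_eq_square)
      finally have "h J p \<le> q^2" by simp
      hence "(INF J. ennreal (h J p)) \<le> ennreal (q^2)" by (intro INF_lower2[of J] ennreal_leI) auto
      thus ?thesis using True by simp
    next
      case False
      obtain c where c: "measure p {c} > 0" using ex_atom[OF p] by blast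
      define J where "J = Suc c"
      have "h J p = (\<Prod>j\<in>{c}. if measure p {j} > 0 then q else 1) * (\<Prod>j\<in>{..<J} - {c}. if measure p {j} > 0 then q else 1)"
        unfolding h_def by (subst prod.subset_diff[of "{c}"]) (auto simp: J_def mult.commute)
      also have "\<dots> \<le> q * 1"
        using q c by (intro mult_mono prod_le_1 prod_nonneg) auto
      finally have "h J p \<le> q" by simp
      hence "(INF J. ennreal (h J p)) \<le> ennreal q" by (intro INF_lower2[of J] ennreal_leI) auto
      thus ?thesis using False p by simp
    qed
  qed
  also have "\<dots> = ennreal q * ennreal (1 - split_prob) + ennreal (q^2) * ennreal split_prob"
    by (subst nn_integral_add)
       (auto simp: nn_integral_cmult nu.emeasure_eq_measure nu.prob_compl split_prob_def S2_def[symmetric])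
  also have "\<dots> = ennreal ((1 - split_prob) * q + split_prob * q^2)"
    using q by (simp add: ennreal_mult[symmetric] ennreal_plus[symmetric] split_prob_def mult.commute del: ennreal_plus)
  finally show ?thesis
    using q by (subst (asm) ennreal_le_iff) (auto simp: q_def split_prob_def)
qed

section \<open>Lines of descent under a constraint and subsolutions\<close>

text \<open>
  The value \<open>x\<close> moves by \<open>- ln p - \<mu>\<close> along each line of descent, and \<open>B m\<close> is the constraint on it
  when \<open>m\<close> generations remain.
\<close>

primrec good :: "(nat \<Rightarrow> real \<Rightarrow> bool) \<Rightarrow> real \<Rightarrow> nat \<Rightarrow> real \<Rightarrow> (nat list \<Rightarrow> nat measure) \<Rightarrow> bool" where
  "good B \<mu> 0 x e \<longleftrightarrow> B 0 x"
| "good B \<mu> (Suc m) x e \<longleftrightarrow> B (Suc m) x \<and>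
     (\<exists>c. measure (e []) {c} > 0 \<and> good B \<mu> m (x - ln (measure (e []) {c}) - \<mu>) (subenv e c))"

text \<open>Joint measurability is what the induction needs: the recursion shifts \<open>x\<close>
  by a function of the environment.\<close>

lemma measurable_good_pair:
  assumes B [measurable]: "\<And>m. Measurable.pred borel (B m)"
  shows "Measurable.pred (borel \<Otimes>\<^sub>M PE) (\<lambda>(x, e). good B \<mu> m x e)"
proof (induction m)
  case 0
  show ?case by simp
next
  case (Suc m)
  have [measurable]: "Measurable.pred (borel \<Otimes>\<^sub>M PE)
      (\<lambda>z. good B \<mu> m (fst z - ln (measure (snd z []) {c}) - \<mu>) (subenv (snd z) c))" for c
  proof -
    have "(\<lambda>z. (fst z - ln (measure (snd z []) {c}) - \<mu>, subenv (snd z) c)) \<in> borel \<Otimes>\<^sub>M PE \<rightarrow>\<^sub>M borel \<Otimes>\<^sub>M PE"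
      by measurable
    from measurable_compose[OF this Suc] show ?thesis by simp
  qed
  show ?case by (simp add: split_beta)
qed

lemma measurable_good:
  assumes B: "\<And>m. Measurable.pred borel (B m)"
    and [measurable]: "f \<in> borel_measurable N" "g \<in> N \<rightarrow>\<^sub>M PE"
  shows "Measurable.pred N (\<lambda>z. good B \<mu> m (f z) (g z))"
proof -
  have "(\<lambda>z. (f z, g z)) \<in> N \<rightarrow>\<^sub>M borel \<Otimes>\<^sub>M PE" by measurable
  from measurable_compose[OF this measurable_good_pair[OF B]] show ?thesis by simp
qed

text \<open>Let \<open>S\<close> be the sum of \<open>v m\<close> over the positions of the
  children. By the induction hypothesis and independence, the conditional failure probability given
  the root is at most \<open>prod (1 - w) <= exp (- S) <= 1 - S + S^2\<close>. Bounding
  \<open>S^2\<close> by \<open>s^2\<close> and integrating leaves success probability at least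
  \<open>E S - s^2\<close>, which dominates \<open>v (Suc m) x\<close> by
  \<open>step\<close>.\<close>

lemma subsolution_le_prob_good:
  fixes v :: "nat \<Rightarrow> real \<Rightarrow> real"
  assumes B [measurable]: "\<And>m. Measurable.pred borel (B m)"
    and v [measurable]: "\<And>m. v m \<in> borel_measurable borel"
    and v01: "\<And>m x. 0 \<le> v m x" "\<And>m x. v m x \<le> 1"
    and vB: "\<And>m x. 0 < v m x \<Longrightarrow> B m x"
    and step: "\<And>m x. 0 < v (Suc m) x \<Longrightarrow> \<exists>s\<ge>0.
       (\<forall>p\<in>space \<nu>. \<forall>J. (\<Sum>c<J. if measure p {c} > 0 then v m (x - ln (measure p {c}) - \<mu>) else 0) \<le> s) \<and>
       ennreal (v (Suc m) x + s\<^sup>2) \<le> (\<integral>\<^sup>+p. (\<Sum>c. ennreal (if measure p {c} > 0 then v m (x - ln (measure p {c}) - \<mu>) else 0)) \<partial>\<nu>)"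
  shows "v m x \<le> measure PE {e \<in> space PE. good B \<mu> m x e}"
proof (induction m arbitrary: x)
  case 0
  show ?case
  proof (cases "v 0 x > 0")
    case True
    hence "{e \<in> space PE. good B \<mu> 0 x e} = space PE" using vB by auto
    thus ?thesis using v01 by (simp add: PE.prob_space)
  next
    case False
    hence "v 0 x \<le> 0" by simp
    thus ?thesis using measure_nonneg order_trans by blast
  qed
next
  case (Suc m)
  note mg [measurable] = measurable_good[OF B]
  show ?case
  proof (cases "v (Suc m) x > 0")
    case False
    hence "v (Suc m) x \<le> 0" by simp
    thus ?thesis using measure_nonneg order_trans by blast
  next
    case True
    define w where "w c p = (if measure p {c} > 0 then v m (x - ln (measure p {c}) - \<mu>) else 0)"
      for c :: nat and p :: "nat measure"
    have w01: "0 \<le> w c p" "w c p \<le> 1" for c p using v01 by (auto simp: w_def)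
    have [measurable]: "w c \<in> borel_measurable \<nu>" for c unfolding w_def by measurable
    obtain s where s: "s \<ge> 0" "\<And>p J. p \<in> space \<nu> \<Longrightarrow> (\<Sum>c<J. w c p) \<le> s"
      "ennreal (v (Suc m) x + s\<^sup>2) \<le> (\<integral>\<^sup>+p. (\<Sum>c. ennreal (w c p)) \<partial>\<nu>)"
      using step[OF True] unfolding w_def by blast
    define GG where "GG = {e \<in> space PE. good B \<mu> (Suc m) x e}"
    have GGs: "GG \<in> sets PE" unfolding GG_def using mg[where f="\<lambda>_. x" and N=PE and g="\<lambda>e. e" and \<mu>=\<mu> and m="Suc m"] by simp
    define Q where "Q c r e \<longleftrightarrow> \<not> (measure r {c} > 0 \<and> good B \<mu> m (x - ln (measure r {c}) - \<mu>) e)"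
      for c :: nat and r :: "nat measure" and e
    have Q [measurable]: "Measurable.pred (\<nu> \<Otimes>\<^sub>M PE) (\<lambda>(r, e). Q c r e)" for c
      unfolding Q_def split_beta by measurable
    \<comment> \<open>The estimate is proved for the first \<open>J\<close> children, uniformly in
      \<open>J\<close>; monotone convergence then gives the full sum.\<close>
    have key: "(\<integral>\<^sup>+p. (\<Sum>c<J. ennreal (w c p)) \<partial>\<nu>) \<le> emeasure PE GG + ennreal (s\<^sup>2)" for J
    proof -
      define bad where "bad = {e \<in> space PE. \<forall>c\<in>{..<J}. Q c (e []) (subenv e c)}"
      have bads: "bad \<in> sets PE" unfolding bad_def Q_def by measurable
      have "space PE \<subseteq> GG \<union> bad"
        using vB[OF True] by (auto simp: GG_def bad_def Q_def)
      hence "1 \<le> emeasure PE (GG \<union> bad)"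
        using GGs bads emeasure_mono[of "space PE" "GG \<union> bad" PE] by (simp add: PE.emeasure_space_1)
      also have "\<dots> \<le> emeasure PE GG + emeasure PE bad" by (rule emeasure_subadditive[OF GGs bads])
      finally have one: "1 \<le> emeasure PE GG + emeasure PE bad" .
      have eb: "emeasure PE bad = (\<integral>\<^sup>+r. (\<Prod>c<J. emeasure PE {e \<in> space PE. Q c r e}) \<partial>\<nu>)"
        unfolding bad_def by (rule emeasure_children[OF Q]) simp
      have mp: "(\<lambda>r. \<Prod>c<J. emeasure PE {e \<in> space PE. Q c r e}) \<in> borel_measurable \<nu>"
      proof (rule borel_measurable_prod_ennreal)
        fix c
        have "{z \<in> space (\<nu> \<Otimes>\<^sub>M PE). case z of (r, e) \<Rightarrow> Q c r e} \<in> sets (\<nu> \<Otimes>\<^sub>M PE)"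
          using Q[of c] unfolding pred_def .
        also have "{z \<in> space (\<nu> \<Otimes>\<^sub>M PE). case z of (r, e) \<Rightarrow> Q c r e}
          = {z \<in> space (\<nu> \<Otimes>\<^sub>M PE). snd z \<in> {e \<in> space PE. Q c (fst z) e}}"
          by (simp add: space_pair_measure set_eq_iff split_beta)
        finally show "(\<lambda>r. emeasure PE {e \<in> space PE. Q c r e}) \<in> borel_measurable \<nu>"
          by (rule PE.measurable_emeasure[rotated]) blast
      qed
      have "(\<integral>\<^sup>+p. (\<Sum>c<J. ennreal (w c p)) \<partial>\<nu>) + emeasure PE bad
         = (\<integral>\<^sup>+p. (\<Sum>c<J. ennreal (w c p)) + (\<Prod>c<J. emeasure PE {e \<in> space PE. Q c p e}) \<partial>\<nu>)"
        unfolding eb using mp by (intro nn_integral_add[symmetric]) auto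
      also have "\<dots> \<le> (\<integral>\<^sup>+p. ennreal (1 + s\<^sup>2) \<partial>\<nu>)"
      proof (rule nn_integral_mono)
        fix p assume p: "p \<in> space \<nu>"
        have em: "emeasure PE {e \<in> space PE. Q c p e} \<le> ennreal (1 - w c p)" for c
        proof (cases "measure p {c} > 0")
          case True
          let ?y = "x - ln (measure p {c}) - \<mu>"
          have gs: "{e \<in> space PE. good B \<mu> m ?y e} \<in> sets PE"
            using mg[where f="\<lambda>_. ?y" and N=PE and g="\<lambda>e. e" and \<mu>=\<mu> and m=m] by simp
          have "{e \<in> space PE. Q c p e} = space PE - {e \<in> space PE. good B \<mu> m ?y e}"
            using True by (auto simp: Q_def)
          hence "emeasure PE {e \<in> space PE. Q c p e} = ennreal (1 - measure PE {e \<in> space PE. good B \<mu> m ?y e})"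
            using gs by (simp add: PE.emeasure_eq_measure PE.prob_compl)
          also have "\<dots> \<le> ennreal (1 - w c p)"
            using Suc[of ?y] True by (intro ennreal_leI) (simp add: w_def)
          finally show ?thesis .
        qed (auto simp: w_def Q_def PE.emeasure_space_1)
        let ?S = "\<Sum>c<J. w c p"
        have S0: "0 \<le> ?S" "?S \<le> s" using w01 s(2)[OF p] by (auto intro: sum_nonneg)
        have "(\<Prod>c<J. 1 - w c p) \<le> (\<Prod>c<J. exp (- w c p))"
        proof (rule prod_mono)
          fix c
          show "0 \<le> 1 - w c p \<and> 1 - w c p \<le> exp (- w c p)"
            using w01[of c] exp_ge_add_one_self[of "- w c p"] by simp
        qed
        also have "\<dots> = exp (- ?S)" by (simp add: exp_sum sum_negf[symmetric])
        also have "\<dots> \<le> 1 - ?S + ?S\<^sup>2"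
        proof -
          have "1 + ?S \<le> exp ?S" by (rule exp_ge_add_one_self)
          hence "exp (- ?S) \<le> 1 / (1 + ?S)" using S0 by (simp add: exp_minus field_simps)
          also have "\<dots> \<le> 1 - ?S + ?S\<^sup>2"
          proof -
            have "(1 - ?S + ?S\<^sup>2) * (1 + ?S) = 1 + ?S ^ 3" by (simp add: algebra_simps power2_eq_square power3_eq_cube)
            thus ?thesis using S0 by (simp add: divide_le_eq mult.commute)
          qed
          finally show ?thesis .
        qed
        also have "\<dots> \<le> 1 - ?S + s\<^sup>2" using S0 by (simp add: power_mono)
        finally have le: "?S + (\<Prod>c<J. 1 - w c p) \<le> 1 + s\<^sup>2" by simp
        have "(\<Sum>c<J. ennreal (w c p)) + (\<Prod>c<J. emeasure PE {e \<in> space PE. Q c p e})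
           \<le> (\<Sum>c<J. ennreal (w c p)) + (\<Prod>c<J. ennreal (1 - w c p))"
          by (intro add_left_mono prod_mono_ennreal em)
        also have "\<dots> = ennreal (?S + (\<Prod>c<J. 1 - w c p))"
          using w01 by (simp add: sum_ennreal prod_ennreal ennreal_plus sum_nonneg prod_nonneg)
        also have "\<dots> \<le> ennreal (1 + s\<^sup>2)" using le by (rule ennreal_leI)
        finally show "(\<Sum>c<J. ennreal (w c p)) + (\<Prod>c<J. emeasure PE {e \<in> space PE. Q c p e}) \<le> ennreal (1 + s\<^sup>2)" .
      qed
      also have "\<dots> = 1 + ennreal (s\<^sup>2)" by (simp add: nu.emeasure_space_1 ennreal_plus)
      also have "\<dots> \<le> emeasure PE GG + emeasure PE bad + ennreal (s\<^sup>2)" using one by (rule add_right_mono)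
      finally have "(\<integral>\<^sup>+p. (\<Sum>c<J. ennreal (w c p)) \<partial>\<nu>) + emeasure PE bad
        \<le> (emeasure PE GG + ennreal (s\<^sup>2)) + emeasure PE bad" by (simp add: ac_simps)
      \<comment> \<open>The finite term \<open>emeasure PE bad\<close> was added on both sides
        rather than subtracted, because in \<open>ennreal\<close> only finite summands
        cancel.\<close>
      hence "emeasure PE bad + (\<integral>\<^sup>+p. (\<Sum>c<J. ennreal (w c p)) \<partial>\<nu>)
        \<le> emeasure PE bad + (emeasure PE GG + ennreal (s\<^sup>2))" by (simp only: add.commute)
      thus ?thesis unfolding ennreal_add_left_cancel_le using PE.emeasure_finite[of bad] by auto
    qed
    have "(\<integral>\<^sup>+p. (\<Sum>c. ennreal (w c p)) \<partial>\<nu>) = (\<integral>\<^sup>+p. (SUP J. \<Sum>c<J. ennreal (w c p)) \<partial>\<nu>)"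
      by (simp add: suminf_eq_SUP)
    also have "\<dots> = (SUP J. \<integral>\<^sup>+p. (\<Sum>c<J. ennreal (w c p)) \<partial>\<nu>)"
      by (rule nn_integral_monotone_convergence_SUP) (auto intro!: incseq_SucI le_funI)
    also have "\<dots> \<le> emeasure PE GG + ennreal (s\<^sup>2)" by (rule SUP_least) (rule key)
    finally have "ennreal (v (Suc m) x + s\<^sup>2) \<le> emeasure PE GG + ennreal (s\<^sup>2)" using s(3) by (rule order_trans[rotated])
    hence "ennreal (v (Suc m) x + s\<^sup>2) \<le> ennreal (measure PE GG + s\<^sup>2)"
      by (simp add: PE.emeasure_eq_measure ennreal_plus)
    thus ?thesis by (subst (asm) ennreal_le_iff) (auto simp: GG_def)
  qed
qed

end

section \<open>The Laplace transform of the displacements\<close>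

lemma exp_remainder_le: "\<bar>exp u - 1 - u\<bar> \<le> u\<^sup>2 * exp \<bar>u\<bar>" for u :: real
proof -
  have 1: "0 \<le> exp u - 1 - u" using exp_ge_add_one_self[of u] by linarith
  have "1 - u \<le> exp (- u)" using exp_ge_add_one_self[of "- u"] by simp
  hence "(1 - u) * exp u \<le> exp (- u) * exp u" by (intro mult_right_mono) auto
  hence 2: "exp u - 1 - u \<le> u * (exp u - 1)" by (simp add: exp_minus algebra_simps)
  have "u * (exp u - 1) \<le> u\<^sup>2 * exp \<bar>u\<bar>"
  proof (cases "u \<ge> 0")
    case True
    have "exp u - 1 \<le> u * exp u"
      using \<open>(1 - u) * exp u \<le> exp (- u) * exp u\<close> by (simp add: exp_minus algebra_simps)
    hence "u * (exp u - 1) \<le> u * (u * exp u)" using True by (intro mult_left_mono) auto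
    thus ?thesis using True by (simp add: power2_eq_square)
  next
    case False
    have "1 - exp u \<le> - u" using exp_ge_add_one_self[of u] by linarith
    have "u * (exp u - 1) = (- u) * (1 - exp u)" by (simp add: algebra_simps)
    also have "\<dots> \<le> (- u) * (- u)" using False \<open>1 - exp u \<le> - u\<close> by (intro mult_left_mono) auto
    also have "\<dots> = u\<^sup>2 * 1" by (simp add: power2_eq_square)
    also have "\<dots> \<le> u\<^sup>2 * exp \<bar>u\<bar>" by (intro mult_left_mono) auto
    finally show ?thesis .
  qed
  thus ?thesis using 1 2 by simp
qed

lemma power_le_exp:
  fixes \<delta> :: real
  assumes "\<delta> > 0"
  obtains C where "C > 0" "\<And>y. y \<ge> 0 \<Longrightarrow> y ^ n \<le> C * exp (\<delta> * y)"
proof (cases "n = 0")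
  case True
  have "y ^ n \<le> 1 * exp (\<delta> * y)" if "y \<ge> 0" for y :: real
    using assms that True by simp
  thus ?thesis using that[of 1] by simp
next
  case False
  have "y ^ n \<le> (n / \<delta>) ^ n * exp (\<delta> * y)" if y: "y \<ge> 0" for y :: real
  proof -
    have "\<delta> * y / n \<le> exp (\<delta> * y / n)" using exp_ge_add_one_self[of "\<delta> * y / n"] by linarith
    hence "(\<delta> * y / n) ^ n \<le> exp (\<delta> * y / n) ^ n" using y assms by (intro power_mono) auto
    also have "\<dots> = exp (\<delta> * y)" using False by (simp add: exp_of_nat_mult[symmetric])
    finally have "(n / \<delta>) ^ n * (\<delta> * y / n) ^ n \<le> (n / \<delta>) ^ n * exp (\<delta> * y)"
      using assms by (intro mult_left_mono) auto
    moreover have "(n / \<delta>) ^ n * (\<delta> * y / n) ^ n = y ^ n"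
      using False assms by (simp add: power_mult_distrib[symmetric])
    ultimately show ?thesis by simp
  qed
  thus ?thesis using that[of "(n / \<delta>) ^ n"] False assms by simp
qed

locale laplace =
  fixes N :: "real measure" and \<theta>0 :: real
  assumes sets_N [measurable_cong]: "sets N = sets borel"
    and nonneg_N: "AE y in N. 0 \<le> y"
    and int_N: "integrable N (\<lambda>y. exp (- (\<theta>0 * y)))"
begin

text \<open>Up to the sign \<open>(-1)^n\<close>, the \<open>n\<close>-th derivative of the Laplace
  transform \<open>G 0\<close>.\<close>

definition G :: "nat \<Rightarrow> real \<Rightarrow> real" where
  "G n \<theta> = (\<integral>y. y ^ n * exp (- (\<theta> * y)) \<partial>N)"

lemma integrable_G:
  assumes "\<theta> > \<theta>0"
  shows "integrable N (\<lambda>y. y ^ n * exp (- (\<theta> * y)))"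
proof -
  obtain C where C: "C > 0" "\<And>y. y \<ge> 0 \<Longrightarrow> y ^ n \<le> C * exp ((\<theta> - \<theta>0) * y)"
    using power_le_exp[of "\<theta> - \<theta>0" n] assms by auto
  show ?thesis
  proof (rule Bochner_Integration.integrable_bound)
    show "integrable N (\<lambda>y. C * exp (- (\<theta>0 * y)))" using int_N by simp
    show "AE y in N. norm (y ^ n * exp (- (\<theta> * y))) \<le> norm (C * exp (- (\<theta>0 * y)))"
      using nonneg_N
    proof eventually_elim
      case (elim y)
      have "y ^ n * exp (- (\<theta> * y)) \<le> (C * exp ((\<theta> - \<theta>0) * y)) * exp (- (\<theta> * y))"
        using C(2)[OF elim] by (intro mult_right_mono) auto
      also have "\<dots> = C * exp (- (\<theta>0 * y))" by (simp add: exp_add[symmetric] algebra_simps)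
      finally show ?case using elim C(1) by simp
    qed
  qed measurable
qed

lemma G_nonneg: "G n \<theta> \<ge> 0"
  unfolding G_def by (rule integral_nonneg_AE) (use nonneg_N in eventually_elim, simp)

text \<open>\<open>exp_remainder_le\<close> at \<open>u = - h y\<close>, integrated. The factor
  \<open>exp (\<delta> y)\<close> in the remainder is absorbed by lowering the exponent from
  \<theta> to \<open>\<theta> - \<delta>\<close>, which stays above the abscissa \<theta>0.\<close>

lemma G_bound:
  assumes "\<theta> - \<delta> > \<theta>0" "\<bar>h\<bar> \<le> \<delta>"
  shows "\<bar>G n (\<theta> + h) - G n \<theta> + h * G (Suc n) \<theta>\<bar> \<le> h\<^sup>2 * G (n + 2) (\<theta> - \<delta>)"
proof -
  have i: "integrable N (\<lambda>y. y ^ m * exp (- ((\<theta> + h) * y)))" "integrable N (\<lambda>y. y ^ m * exp (- (\<theta> * y)))"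
     "integrable N (\<lambda>y. y ^ m * exp (- ((\<theta> - \<delta>) * y)))" for m
    using assms by (intro integrable_G; linarith)+
  let ?f = "\<lambda>y. y ^ n * exp (- ((\<theta> + h) * y)) - y ^ n * exp (- (\<theta> * y)) + h * (y ^ Suc n * exp (- (\<theta> * y)))"
  have "G n (\<theta> + h) - G n \<theta> + h * G (Suc n) \<theta> = (\<integral>y. ?f y \<partial>N)"
    unfolding G_def using i by (subst Bochner_Integration.integral_add) (auto simp del: power_Suc)
  hence "\<bar>G n (\<theta> + h) - G n \<theta> + h * G (Suc n) \<theta>\<bar> \<le> (\<integral>y. \<bar>?f y\<bar> \<partial>N)"
    using integral_norm_bound[of N ?f] by simp
  also have "\<dots> \<le> (\<integral>y. h\<^sup>2 * (y ^ (n + 2) * exp (- ((\<theta> - \<delta>) * y))) \<partial>N)"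
  proof (rule integral_mono_AE)
    show "integrable N (\<lambda>y. \<bar>?f y\<bar>)"
      by (intro integrable_abs Bochner_Integration.integrable_add Bochner_Integration.integrable_diff integrable_mult_right i)
    show "integrable N (\<lambda>y. h\<^sup>2 * (y ^ (n + 2) * exp (- ((\<theta> - \<delta>) * y))))"
      by (intro integrable_mult_right i)
    show "AE y in N. \<bar>?f y\<bar> \<le> h\<^sup>2 * (y ^ (n + 2) * exp (- ((\<theta> - \<delta>) * y)))"
      using nonneg_N
    proof eventually_elim
      case (elim y)
      have "?f y = y ^ n * exp (- (\<theta> * y)) * (exp (- h * y) - 1 - (- h * y))"
        by (simp add: algebra_simps flip: exp_add)
      hence "\<bar>?f y\<bar> = y ^ n * exp (- (\<theta> * y)) * \<bar>exp (- h * y) - 1 - (- h * y)\<bar>"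
        using elim by (simp add: abs_mult)
      also have "\<dots> \<le> y ^ n * exp (- (\<theta> * y)) * ((- h * y)\<^sup>2 * exp \<bar>- h * y\<bar>)"
        using elim by (intro mult_left_mono exp_remainder_le) auto
      also have "\<dots> \<le> y ^ n * exp (- (\<theta> * y)) * ((- h * y)\<^sup>2 * exp (\<delta> * y))"
        using elim assms by (intro mult_left_mono) (auto simp: abs_mult mult_right_mono)
      also have "\<dots> = h\<^sup>2 * (y ^ (n + 2) * exp (- ((\<theta> - \<delta>) * y)))"
        by (simp add: algebra_simps power2_eq_square flip: exp_add)
      finally show ?case .
    qed
  qed
  also have "\<dots> = h\<^sup>2 * G (n + 2) (\<theta> - \<delta>)" by (simp add: G_def)
  finally show ?thesis .
qed

lemma G_has_derivative:
  assumes "\<theta> > \<theta>0"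
  shows "(G n has_real_derivative - G (Suc n) \<theta>) (at \<theta>)"
proof -
  define \<delta> where "\<delta> = (\<theta> - \<theta>0) / 2"
  have \<delta>: "\<delta> > 0" "\<theta> - \<delta> > \<theta>0" using assms by (auto simp: \<delta>_def field_simps)
  have "((\<lambda>h. (G n (\<theta> + h) - G n \<theta>) / h + G (Suc n) \<theta>) \<longlongrightarrow> 0) (at 0)"
  proof (rule Lim_null_comparison)
    show "\<forall>\<^sub>F h in at 0. norm ((G n (\<theta> + h) - G n \<theta>) / h + G (Suc n) \<theta>) \<le> \<bar>h\<bar> * G (n + 2) (\<theta> - \<delta>)"
      unfolding eventually_at
    proof (intro exI[of _ \<delta>] conjI ballI impI \<delta>(1))
      fix h :: real assume h: "h \<noteq> 0 \<and> dist h 0 < \<delta>"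
      have "\<bar>(G n (\<theta> + h) - G n \<theta>) / h + G (Suc n) \<theta>\<bar> * \<bar>h\<bar> = \<bar>G n (\<theta> + h) - G n \<theta> + h * G (Suc n) \<theta>\<bar>"
      proof -
        have "G n (\<theta> + h) - G n \<theta> + h * G (Suc n) \<theta> = ((G n (\<theta> + h) - G n \<theta>) / h + G (Suc n) \<theta>) * h"
          using h by (simp add: field_simps)
        thus ?thesis by (simp only: abs_mult)
      qed
      also have "\<dots> \<le> h\<^sup>2 * G (n + 2) (\<theta> - \<delta>)"
        using h by (intro G_bound \<delta>) (simp add: dist_real_def)
      also have "\<dots> = (\<bar>h\<bar> * G (n + 2) (\<theta> - \<delta>)) * \<bar>h\<bar>" by (simp add: power2_eq_square)
      finally show "norm ((G n (\<theta> + h) - G n \<theta>) / h + G (Suc n) \<theta>) \<le> \<bar>h\<bar> * G (n + 2) (\<theta> - \<delta>)"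
        using h by (simp add: mult_le_cancel_right)
    qed
    show "((\<lambda>h. \<bar>h\<bar> * G (n + 2) (\<theta> - \<delta>)) \<longlongrightarrow> 0) (at 0)"
      by (auto intro!: tendsto_eq_intros)
  qed
  from tendsto_diff[OF this tendsto_const[of "G (Suc n) \<theta>"]]
  show ?thesis by (simp add: DERIV_def)
qed

lemma isCont_G: "\<theta> > \<theta>0 \<Longrightarrow> isCont (G n) \<theta>"
  using G_has_derivative DERIV_isCont by blast

end

section \<open>The intensity measure of the displacements\<close>

context mass_law
begin

text \<open>The intensity of the point process of displacements \<open>- ln p\<close>, over the
  children of positive mass. Its total mass, the mean number of such children, may be infinite. It
  turns expected sums over children into integrals, and \<open>L_fun\<close> becomes its Laplace
  transform.\<close>

definition lam :: "real measure" where
  "lam = distr (density (\<nu> \<Otimes>\<^sub>M count_space UNIV) (\<lambda>(p, j). if measure p {j} > 0 then 1 else 0)) borel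
     (\<lambda>(p, j). - ln (measure p {j}))"

lemma measurable_mass_pair [measurable]:
  "(\<lambda>z. measure (fst z) {snd z}) \<in> borel_measurable (\<nu> \<Otimes>\<^sub>M count_space (UNIV :: nat set))"
  by (rule measurable_compose_countable'[where f="\<lambda>j z. measure (fst z) {j}" and g=snd and I=UNIV]) auto

lemma sets_lam [measurable_cong, simp]: "sets lam = sets borel"
  by (simp add: lam_def)

lemma nn_integral_lam:
  assumes [measurable]: "g \<in> borel_measurable borel"
  shows "(\<integral>\<^sup>+y. g y \<partial>lam) = (\<integral>\<^sup>+p. (\<Sum>j. if measure p {j} > 0 then g (- ln (measure p {j})) else 0) \<partial>\<nu>)"
proof -
  interpret c: sigma_finite_measure "count_space (UNIV :: nat set)"
    by (rule sigma_finite_measure_count_space_countable) simp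
  have "(\<integral>\<^sup>+y. g y \<partial>lam) = (\<integral>\<^sup>+z. (if measure (fst z) {snd z} > 0 then g (- ln (measure (fst z) {snd z})) else 0) \<partial>(\<nu> \<Otimes>\<^sub>M count_space UNIV))"
    unfolding lam_def split_beta
    by (subst nn_integral_distr, simp, simp, subst nn_integral_density) (auto intro!: nn_integral_cong)
  also have "\<dots> = (\<integral>\<^sup>+p. \<integral>\<^sup>+j. (if measure p {j} > 0 then g (- ln (measure p {j})) else 0) \<partial>count_space UNIV \<partial>\<nu>)"
    by (subst c.nn_integral_fst[symmetric]) (simp_all cong: if_cong)
  finally show ?thesis by (simp add: nn_integral_count_space_nat)
qed

lemma AE_lam:
  assumes [measurable]: "Measurable.pred borel P"
  shows "(AE y in lam. P y) \<longleftrightarrow> (AE p in \<nu>. \<forall>j. measure p {j} > 0 \<longrightarrow> P (- ln (measure p {j})))"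
proof -
  have "(AE y in lam. P y) \<longleftrightarrow> (\<integral>\<^sup>+y. indicator {y. \<not> P y} y \<partial>lam) = 0"
    by (subst nn_integral_0_iff_AE) (auto simp: indicator_def)
  also have "\<dots> \<longleftrightarrow> (AE p in \<nu>. (\<Sum>j. if measure p {j} > 0 then indicator {y. \<not> P y} (- ln (measure p {j})) else 0) = (0::ennreal))"
    by (subst nn_integral_lam, simp, subst nn_integral_0_iff_AE) auto
  also have "\<dots> \<longleftrightarrow> (AE p in \<nu>. \<forall>j. measure p {j} > 0 \<longrightarrow> P (- ln (measure p {j})))"
    by (intro AE_cong) (auto simp: suminf_eq_zero_iff indicator_def)
  finally show ?thesis .
qed

lemma lam_nonneg: "AE y in lam. 0 \<le> y"
  by (subst AE_lam) (auto intro!: AE_I2 simp: mass_le_1 ln_le_zero_iff)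

lemma L_fun_lam: "L_fun \<nu> \<theta> = (\<integral>\<^sup>+y. ennreal (exp (- (\<theta> * y))) \<partial>lam)"
  unfolding L_fun_def
  by (subst nn_integral_lam, simp, intro nn_integral_cong suminf_cong)
     (auto simp: powr_def zero_less_measure_iff)

lemma integrable_lam_iff: "integrable lam (\<lambda>y. exp (- (\<theta> * y))) \<longleftrightarrow> L_fun \<nu> \<theta> < \<infinity>"
  unfolding L_fun_lam integrable_iff_bounded by simp

lemma L_real_lam: "L_real \<nu> \<theta> = (\<integral>y. exp (- (\<theta> * y)) \<partial>lam)"
  unfolding L_real_def L_fun_lam by (rule integral_eq_nn_integral[symmetric]) auto

lemma L_fun_1: "L_fun \<nu> 1 = 1"
proof -
  have "L_fun \<nu> 1 = (\<integral>\<^sup>+p. 1 \<partial>\<nu>)"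
    unfolding L_fun_def
  proof (rule nn_integral_cong)
    fix p assume "p \<in> space \<nu>"
    from mass_sums[OF this] show "(\<Sum>j. ennreal (measure p {j} powr 1)) = 1"
      by (simp add: suminf_ennreal_eq sums_iff)
  qed
  thus ?thesis by (simp add: nu.emeasure_space_1)
qed

text \<open>Finiteness at exponent 1 is conservation of mass, so the transform is smooth on all of
  \<open>(1, \<infinity>)\<close>, the range in which it is differentiated.\<close>

sublocale lap: laplace lam 1
  by unfold_locales (auto simp: lam_nonneg integrable_lam_iff[of 1, simplified] L_fun_1)

lemma L_real_eq_G: "L_real \<nu> = lap.G 0"
  by (simp add: fun_eq_iff L_real_lam lap.G_def)

lemma deriv_L_real: "\<theta> > 1 \<Longrightarrow> deriv (L_real \<nu>) \<theta> = - lap.G 1 \<theta>"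
  unfolding L_real_eq_G using lap.G_has_derivative[of \<theta> 0] by (intro DERIV_imp_deriv) simp

lemma theta_low_le_1: "\<theta>_low \<nu> \<le> 1"
  unfolding \<theta>_low_def by (intro Inf_lower CollectI exI[of _ 1]) (auto simp: L_fun_1 one_ereal_def)

end

section \<open>Nondegeneracy and the critical exponent\<close>

locale nongeom_law = mass_law +
  assumes nongeom: "\<not> geometric_law \<nu>"
begin

text \<open>If all displacements were equal to \<open>c\<close>, every positive mass would be
  \<open>exp (- c)\<close>, a power of one fixed number, and the law would be geometric. In this
  form the standing assumption enters all later arguments.\<close>

lemma not_AE_const: "\<not> (AE y in lam. y = c)"
proof
  assume *: "AE y in lam. y = c"
  hence AEc: "AE p in \<nu>. \<forall>j. measure p {j} > 0 \<longrightarrow> - ln (measure p {j}) = c"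
    by (subst (asm) AE_lam) auto
  have "AE p in \<nu>. 0 \<le> c"
    using AEc AE_space
  proof eventually_elim
    case (elim p)
    then obtain j where j: "measure p {j} > 0" "- ln (measure p {j}) = c" using ex_atom by blast
    thus ?case using mass_le_1[OF elim(2), of j] by (auto simp: ln_le_zero_iff)
  qed
  hence c: "0 \<le> c" by simp
  \<comment> \<open>\<open>c = 0\<close> means that all masses are 1; then the zeroth power of an
    arbitrary ratio in \<open>(0, 1)\<close>, here 1/2, does it.\<close>
  define r where "r = (if c = 0 then 1/2 else exp (- c))"
  define n :: nat where "n = (if c = 0 then 0 else 1)"
  have "AE p in \<nu>. \<forall>j. measure p {j} > 0 \<longrightarrow> (\<exists>n::nat. measure p {j} = r ^ n)"
    using AEc
  proof eventually_elim
    case (elim p)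
    have "measure p {j} = r ^ n" if j: "measure p {j} > 0" for j
    proof -
      have "measure p {j} = exp (- c)" using elim j by (metis exp_ln minus_minus)
      thus ?thesis by (simp add: r_def n_def)
    qed
    thus ?case by blast
  qed
  moreover have "0 < r" "r < 1" using c by (auto simp: r_def)
  ultimately show False using nongeom unfolding geometric_law_def by blast
qed

lemma G_pos:
  assumes "\<theta> > 1"
  shows "lap.G n \<theta> > 0"
proof (rule ccontr)
  assume "\<not> lap.G n \<theta> > 0"
  hence "lap.G n \<theta> = 0" using lap.G_nonneg[of n \<theta>] by linarith
  hence "AE y in lam. y ^ n * exp (- (\<theta> * y)) = 0"
    unfolding lap.G_def
    by (subst (asm) integral_nonneg_eq_0_iff_AE[OF lap.integrable_G[OF assms]]) (use lam_nonneg in auto)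
  hence "AE y in lam. y = 0" by eventually_elim auto
  thus False using not_AE_const by blast
qed

text \<open>Minus the logarithmic derivative of \<open>L\<close>, that is, the mean displacement
  under the law tilted by \<theta>. Its reciprocal is the quotient whose limit is
  \<open>C_star\<close>.\<close>

definition \<mu> :: "real \<Rightarrow> real" where "\<mu> \<theta> = lap.G 1 \<theta> / lap.G 0 \<theta>"

lemma mu_pos: "\<theta> > 1 \<Longrightarrow> \<mu> \<theta> > 0"
  by (simp add: \<mu>_def G_pos)

lemma isCont_mu: "\<theta> > 1 \<Longrightarrow> isCont \<mu> \<theta>"
  unfolding \<mu>_def using G_pos[of \<theta> 0] by (intro continuous_intros lap.isCont_G) auto

lemma phi_eq: "\<theta> > 1 \<Longrightarrow> \<phi>_fun \<nu> \<theta> = ln (lap.G 0 \<theta>) + \<theta> * \<mu> \<theta>"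
  using deriv_L_real[of \<theta>] by (simp add: \<phi>_fun_def L_real_eq_G \<mu>_def)

text \<open>\<open>L 1 - L 2\<close> is the integral of \<open>exp (- y) - exp (- 2 y)\<close>,
  which is nonnegative and vanishes only if all displacements are zero.\<close>

lemma G0_2_less: "lap.G 0 2 < 1"
proof (rule ccontr)
  assume "\<not> lap.G 0 2 < 1"
  have i: "integrable lam (\<lambda>y. exp (- y))" "integrable lam (\<lambda>y. exp (- (2 * y)))"
    using lap.int_N lap.integrable_G[of 2 0] by auto
  have L1: "(\<integral>y. exp (- y) \<partial>lam) = 1"
    using L_real_lam[of 1] by (simp add: L_real_def L_fun_1)
  have nn: "AE y in lam. 0 \<le> exp (- y) - exp (- (2 * y))"
    using lam_nonneg by eventually_elim auto
  have "(\<integral>y. exp (- y) - exp (- (2 * y)) \<partial>lam) = 1 - lap.G 0 2"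
    using i L1 by (simp add: lap.G_def)
  moreover have "(\<integral>y. exp (- y) - exp (- (2 * y)) \<partial>lam) \<ge> 0" by (rule integral_nonneg_AE[OF nn])
  ultimately have "(\<integral>y. exp (- y) - exp (- (2 * y)) \<partial>lam) = 0" using \<open>\<not> lap.G 0 2 < 1\<close> by linarith
  hence "AE y in lam. exp (- y) - exp (- (2 * y)) = 0"
    using i nn by (subst (asm) integral_nonneg_eq_0_iff_AE) auto
  hence "AE y in lam. y = 0" by eventually_elim simp
  thus False using not_AE_const by blast
qed

text \<open>Right-continuity at 1. The derivative formula holds only strictly above 1, so dominated
  convergence takes its place.\<close>

lemma G0_tendsto_1: "(\<lambda>n. lap.G 0 (1 + 1 / real (Suc n))) \<longlonglongrightarrow> 1"
proof -
  have "(\<lambda>n. \<integral>y. exp (- ((1 + 1 / real (Suc n)) * y)) \<partial>lam) \<longlonglongrightarrow> (\<integral>y. exp (- y) \<partial>lam)"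
  proof (rule integral_dominated_convergence[where w="\<lambda>y. exp (- y)"])
    show "integrable lam (\<lambda>y. exp (- y))" using lap.int_N by simp
    have "(\<lambda>n. exp (- ((1 + 1 / real (Suc n)) * y))) \<longlonglongrightarrow> exp (- ((1 + 0) * y))" for y
      by (intro tendsto_intros LIMSEQ_Suc[OF lim_1_over_n])
    thus "AE y in lam. (\<lambda>n. exp (- ((1 + 1 / real (Suc n)) * y))) \<longlonglongrightarrow> exp (- y)" by simp
    show "AE y in lam. norm (exp (- ((1 + 1 / real (Suc n)) * y))) \<le> exp (- y)" for n
      using lam_nonneg by eventually_elim (simp add: field_simps)
  qed auto
  moreover have "(\<integral>y. exp (- y) \<partial>lam) = 1" using L_real_lam[of 1] by (simp add: L_real_def L_fun_1)
  ultimately show ?thesis by (simp add: lap.G_def)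
qed

text \<open>If \<open>\<phi> \<le> 0\<close> on \<open>(1, \<infinity>)\<close>, then \<open>ln L(\<theta>) / \<theta>\<close> is nondecreasing there, contradicting
  \<open>L(2) < 1 = L(1+)\<close>.\<close>

lemma ex_phi_pos: "\<exists>\<theta>>1. \<phi>_fun \<nu> \<theta> > 0"
proof (rule ccontr)
  assume "\<not> ?thesis"
  hence neg: "ln (lap.G 0 \<theta>) + \<theta> * \<mu> \<theta> \<le> 0" if "\<theta> > 1" for \<theta>
    using that phi_eq[OF that] by force
  define h where "h \<theta> = ln (lap.G 0 \<theta>) / \<theta>" for \<theta>
  have dh: "\<exists>y. (h has_real_derivative y) (at \<theta>) \<and> 0 \<le> y" if "\<theta> > 1" for \<theta>
  proof -
    \<comment> \<open>This derivative is \<open>- \<phi> / \<theta>^2\<close>.\<close>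
    have "(h has_real_derivative ((- lap.G 1 \<theta> / lap.G 0 \<theta>) * \<theta> - ln (lap.G 0 \<theta>) * 1) / (\<theta> * \<theta>)) (at \<theta>)"
      unfolding h_def using that G_pos[OF that, of 0] lap.G_has_derivative[OF that, of 0]
      by (auto intro!: derivative_eq_intros)
    moreover have "0 \<le> ((- lap.G 1 \<theta> / lap.G 0 \<theta>) * \<theta> - ln (lap.G 0 \<theta>) * 1) / (\<theta> * \<theta>)"
      using neg[OF that] that by (intro divide_nonneg_nonneg) (auto simp: \<mu>_def field_simps)
    ultimately show ?thesis by blast
  qed
  have h2: "h 2 < 0" using G0_2_less G_pos[of 2 0] by (simp add: h_def)
  have "lap.G 0 \<theta> \<le> exp (h 2)" if \<theta>: "1 < \<theta>" "\<theta> \<le> 2" for \<theta>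
  proof -
    have "h \<theta> \<le> h 2" by (rule DERIV_nonneg_imp_nondecreasing[OF \<theta>(2)]) (use \<theta> dh in auto)
    hence "ln (lap.G 0 \<theta>) \<le> \<theta> * h 2" using \<theta> by (simp add: h_def field_simps)
    also have "\<dots> \<le> 1 * h 2" using h2 \<theta> by (intro mult_right_mono_neg) auto
    finally show ?thesis using G_pos[of \<theta> 0] \<theta> by (metis exp_le_cancel_iff exp_ln mult_1)
  qed
  hence "lap.G 0 (1 + 1 / real (Suc n)) \<le> exp (h 2)" for n
    by simp
  hence "1 \<le> exp (h 2)" by (intro LIMSEQ_le_const2[OF G0_tendsto_1]) auto
  thus False using h2 by simp
qed

lemma isCont_phi: "\<theta> > 1 \<Longrightarrow> isCont (\<phi>_fun \<nu>) \<theta>"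
proof -
  assume \<theta>: "\<theta> > 1"
  have "isCont (\<lambda>\<theta>. ln (lap.G 0 \<theta>) + \<theta> * \<mu> \<theta>) \<theta>"
    using G_pos[OF \<theta>, of 0] by (intro continuous_intros isCont_mu[OF \<theta>] lap.isCont_G[OF \<theta>]) auto
  moreover have "\<forall>\<^sub>F x in nhds \<theta>. \<phi>_fun \<nu> x = ln (lap.G 0 x) + x * \<mu> x"
    using eventually_nhds_in_open[of "{1<..}" \<theta>] \<theta> by (auto elim!: eventually_mono simp: phi_eq)
  ultimately show ?thesis by (simp cong: isCont_cong)
qed

text \<open>\<open>t\<close> is a zero of the continuous function \<phi>: a positive value would
  push the supremum beyond \<open>t\<close>, and a negative value would keep the points with
  \<open>\<phi> > 0\<close> away from \<open>t\<close>. Those points therefore approach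
  \<open>t\<close> strictly from below. The value of \<open>C_star\<close> is then continuity of
  \<open>\<mu>\<close> at \<open>t\<close>.\<close>

lemma theta_star_props:
  assumes fin: "\<theta>_star \<nu> < \<infinity>"
  obtains t where "t > 1" "\<theta>_star \<nu> = ereal t" "ln (lap.G 0 t) + t * \<mu> t = 0"
    "\<And>\<eta>. \<eta> > 0 \<Longrightarrow> \<exists>\<theta>>1. t - \<eta> < \<theta> \<and> \<theta> < t \<and> ln (lap.G 0 \<theta>) + \<theta> * \<mu> \<theta> > 0"
    "C_star \<nu> = 1 / \<mu> t"
proof -
  define S where "S = {ereal \<theta> | \<theta>. \<theta>_low \<nu> < ereal \<theta> \<and> \<phi>_fun \<nu> \<theta> > 0}"
  have star: "\<theta>_star \<nu> = Sup S" by (simp add: \<theta>_star_def S_def)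
  have low: "\<theta>_low \<nu> < ereal \<theta>" if "\<theta> > 1" for \<theta>
    using le_less_trans[OF theta_low_le_1, of "ereal \<theta>"] that by (simp add: one_ereal_def)
  obtain \<theta>1 where \<theta>1: "\<theta>1 > 1" "\<phi>_fun \<nu> \<theta>1 > 0" using ex_phi_pos by blast
  have up: "ereal \<theta> \<le> \<theta>_star \<nu>" if "\<theta> > 1" "\<phi>_fun \<nu> \<theta> > 0" for \<theta>
    unfolding star using low[OF that(1)] that by (intro Sup_upper) (auto simp: S_def)
  obtain t where t: "\<theta>_star \<nu> = ereal t"
    using up[OF \<theta>1] fin by (cases "\<theta>_star \<nu>") auto
  have t1: "t > 1" using up[OF \<theta>1] \<theta>1 t by simp
  have near: "\<exists>\<theta>>1. t - \<eta> < \<theta> \<and> \<theta> \<le> t \<and> \<phi>_fun \<nu> \<theta> > 0" if "\<eta> > 0" for \<eta>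
  proof -
    define z where "z = max (t - \<eta>) 1"
    have "ereal z < ereal t" using that t1 by (simp add: z_def)
    also have "ereal t = Sup S" using star t by simp
    finally have "ereal z < Sup S" .
    then obtain s where s: "s \<in> S" "ereal z < s" by (auto simp: less_Sup_iff)
    then obtain \<theta> where \<theta>: "s = ereal \<theta>" "\<phi>_fun \<nu> \<theta> > 0" by (auto simp: S_def)
    have "s \<le> ereal t" using s star t by (metis Sup_upper)
    thus ?thesis using s \<theta> by (intro exI[of _ \<theta>]) (auto simp: z_def)
  qed
  have not_pos: "\<not> \<phi>_fun \<nu> t > 0"
  proof
    assume "\<phi>_fun \<nu> t > 0"
    hence "\<forall>\<^sub>F x in at t. \<phi>_fun \<nu> x > 0"
      using isCont_phi[OF t1] by (auto simp: isCont_def dest: order_tendstoD(1))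
    then obtain d where d: "d > 0" "\<And>x. x \<noteq> t \<Longrightarrow> dist x t < d \<Longrightarrow> \<phi>_fun \<nu> x > 0"
      by (auto simp: eventually_at)
    have "\<phi>_fun \<nu> (t + d / 2) > 0" using d by (intro d(2)) (auto simp: dist_real_def)
    hence "ereal (t + d / 2) \<le> ereal t" using up[of "t + d / 2"] t1 d t by auto
    thus False using d by simp
  qed
  have not_neg: "\<not> \<phi>_fun \<nu> t < 0"
  proof
    assume neg: "\<phi>_fun \<nu> t < 0"
    hence "\<forall>\<^sub>F x in at t. \<phi>_fun \<nu> x < 0"
      using isCont_phi[OF t1] by (auto simp: isCont_def dest: order_tendstoD(2))
    then obtain d where d: "d > 0" "\<And>x. x \<noteq> t \<Longrightarrow> dist x t < d \<Longrightarrow> \<phi>_fun \<nu> x < 0"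
      by (auto simp: eventually_at)
    obtain \<theta> where \<theta>: "t - d < \<theta>" "\<theta> \<le> t" "\<phi>_fun \<nu> \<theta> > 0" using near[OF d(1)] by blast
    show False using d(2)[of \<theta>] neg \<theta> by (cases "\<theta> = t") (auto simp: dist_real_def)
  qed
  have z: "\<phi>_fun \<nu> t = 0" using not_pos not_neg by linarith
  have "\<exists>\<theta>>1. t - \<eta> < \<theta> \<and> \<theta> < t \<and> ln (lap.G 0 \<theta>) + \<theta> * \<mu> \<theta> > 0" if "\<eta> > 0" for \<eta>
  proof -
    obtain \<theta> where \<theta>: "\<theta> > 1" "t - \<eta> < \<theta>" "\<theta> \<le> t" "\<phi>_fun \<nu> \<theta> > 0"
      using near[OF \<open>\<eta> > 0\<close>] by blast
    hence "\<theta> \<noteq> t" using z by auto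
    thus ?thesis using \<theta> phi_eq[OF \<theta>(1)] by (intro exI[of _ \<theta>]) auto
  qed
  moreover have "C_star \<nu> = 1 / \<mu> t"
  proof -
    have "((\<lambda>x. 1 / \<mu> x) \<longlongrightarrow> 1 / \<mu> t) (at_left t)"
    proof (intro tendsto_intros)
      show "(\<mu> \<longlongrightarrow> \<mu> t) (at_left t)"
        using isCont_mu[OF t1] unfolding isCont_def by (rule filterlim_mono[OF _ order_refl at_le]) simp
    qed (use mu_pos[OF t1] in simp)
    moreover have "\<forall>\<^sub>F x in at_left t. - L_real \<nu> x / deriv (L_real \<nu>) x = 1 / \<mu> x"
      unfolding eventually_at_left_field using t1
      by (intro exI[of _ 1]) (auto simp: L_real_eq_G[symmetric] deriv_L_real \<mu>_def)
    ultimately have "((\<lambda>x. - L_real \<nu> x / deriv (L_real \<nu>) x) \<longlongrightarrow> 1 / \<mu> t) (at_left t)"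
      by (subst tendsto_cong)
    hence "((\<lambda>x. - L_real \<nu> (real_of_ereal x) / deriv (L_real \<nu>) (real_of_ereal x)) \<longlongrightarrow> 1 / \<mu> t) (at_left (ereal t))"
      by (simp add: at_left_ereal filterlim_filtermap)
    thus ?thesis unfolding C_star_def t
      by (intro tendsto_Lim) (auto simp: at_left_ereal filtermap_bot_iff)
  qed
  ultimately show ?thesis using that t1 t z phi_eq[OF t1] by metis
qed

end

section \<open>The Gaussian bump\<close>

text \<open>Positive exactly on \<open>(0, 2 c)\<close>; for \<open>b c\<^sup>2 = 2\<close> it is convex near both zeros, so that its positive part
  can serve as a profile of a subsolution.\<close>

definition bump :: "real \<Rightarrow> real \<Rightarrow> real \<Rightarrow> real" where
  "bump b c y = exp (- b * (y - c)\<^sup>2) - exp (- b * c\<^sup>2)"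

definition bump1 :: "real \<Rightarrow> real \<Rightarrow> real \<Rightarrow> real" where
  "bump1 b c y = - 2 * b * (y - c) * exp (- b * (y - c)\<^sup>2)"

definition bump2 :: "real \<Rightarrow> real \<Rightarrow> real \<Rightarrow> real" where
  "bump2 b c y = (4 * b\<^sup>2 * (y - c)\<^sup>2 - 2 * b) * exp (- b * (y - c)\<^sup>2)"

definition bump3 :: "real \<Rightarrow> real \<Rightarrow> real \<Rightarrow> real" where
  "bump3 b c y = (12 * b\<^sup>2 * (y - c) - 8 * b ^ 3 * (y - c) ^ 3) * exp (- b * (y - c)\<^sup>2)"

lemma borel_measurable_bump [measurable]: "bump b c \<in> borel_measurable borel"
  unfolding bump_def by measurable

lemma bump_derivs:
  "(bump b c has_real_derivative bump1 b c y) (at y)"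
  "(bump1 b c has_real_derivative bump2 b c y) (at y)"
  "(bump2 b c has_real_derivative bump3 b c y) (at y)"
  unfolding bump_def bump1_def bump2_def bump3_def
  by (auto intro!: derivative_eq_intros simp: algebra_simps power2_eq_square power3_eq_cube)

text \<open>The Gaussian beats the cubic factor, because
  \<open>exp (b z^2) >= 1 + (b z^2)^2 / 2\<close> grows like \<open>z^4\<close>. The bound is
  global, so the Taylor constant in \<open>bump_taylor\<close> does not depend on the base
  point.\<close>

lemma bump3_bounded:
  assumes b: "b > 0"
  shows "\<bar>bump3 b c y\<bar> \<le> (12 * b\<^sup>2 + 8 * b ^ 3) * (1 + 2 / b\<^sup>2)"
proof -
  define z where "z = y - c"
  have "b * z\<^sup>2 \<ge> 0" using b by simp
  from exp_lower_Taylor_quadratic[OF this] have e: "1 + (b * z\<^sup>2)\<^sup>2 / 2 \<le> exp (b * z\<^sup>2)"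
    using \<open>b * z\<^sup>2 \<ge> 0\<close> by linarith
  have p: "z ^ 4 \<ge> 0" by simp
  have "1 + z ^ 4 \<le> (1 + 2 / b\<^sup>2) * (1 + (b * z\<^sup>2)\<^sup>2 / 2)"
  proof -
    have "(1 + 2 / b\<^sup>2) * (1 + (b * z\<^sup>2)\<^sup>2 / 2) = 1 + z ^ 4 + 2 / b\<^sup>2 + (b * z\<^sup>2)\<^sup>2 / 2"
      using b by (simp add: field_simps power2_eq_square power4_eq_xxxx)
    thus ?thesis using b by (simp add: add_nonneg_nonneg)
  qed
  also have "\<dots> \<le> (1 + 2 / b\<^sup>2) * exp (b * z\<^sup>2)" using e by (intro mult_left_mono) auto
  finally have "(1 + z ^ 4) * exp (- (b * z\<^sup>2)) \<le> ((1 + 2 / b\<^sup>2) * exp (b * z\<^sup>2)) * exp (- (b * z\<^sup>2))"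
    by (intro mult_right_mono) auto
  hence q: "(1 + z ^ 4) * exp (- (b * z\<^sup>2)) \<le> 1 + 2 / b\<^sup>2" by (simp add: mult.assoc flip: exp_add)
  have z1: "\<bar>z\<bar> \<le> 1 + z ^ 4" "\<bar>z\<bar> ^ 3 \<le> 1 + z ^ 4"
  proof -
    have "\<bar>z\<bar> \<le> 1 + \<bar>z\<bar> ^ 4 \<and> \<bar>z\<bar> ^ 3 \<le> 1 + \<bar>z\<bar> ^ 4"
    proof (cases "\<bar>z\<bar> \<le> 1")
      case True
      have "\<bar>z\<bar> ^ 3 \<le> 1" using True by (intro power_le_one) auto
      thus ?thesis using True zero_le_power[of "\<bar>z\<bar>" 4] by linarith
    next
      case False
      hence "\<bar>z\<bar> ^ 1 \<le> \<bar>z\<bar> ^ 4" "\<bar>z\<bar> ^ 3 \<le> \<bar>z\<bar> ^ 4" by (intro power_increasing; simp)+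
      thus ?thesis by simp
    qed
    thus "\<bar>z\<bar> \<le> 1 + z ^ 4" "\<bar>z\<bar> ^ 3 \<le> 1 + z ^ 4" by (auto simp: power_even_abs)
  qed
  have "\<bar>12 * b\<^sup>2 * z - 8 * b ^ 3 * z ^ 3\<bar> \<le> 12 * b\<^sup>2 * \<bar>z\<bar> + 8 * b ^ 3 * \<bar>z\<bar> ^ 3"
    using abs_triangle_ineq4[of "12 * b\<^sup>2 * z" "8 * b ^ 3 * z ^ 3"] b by (simp add: abs_mult power_abs)
  also have "\<dots> \<le> 12 * b\<^sup>2 * (1 + z ^ 4) + 8 * b ^ 3 * (1 + z ^ 4)"
    using z1 b by (intro add_mono mult_left_mono) auto
  finally have "\<bar>12 * b\<^sup>2 * z - 8 * b ^ 3 * z ^ 3\<bar> \<le> (12 * b\<^sup>2 + 8 * b ^ 3) * (1 + z ^ 4)"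
    by (simp add: algebra_simps)
  hence "\<bar>bump3 b c y\<bar> \<le> ((12 * b\<^sup>2 + 8 * b ^ 3) * (1 + z ^ 4)) * exp (- (b * z\<^sup>2))"
    unfolding bump3_def z_def[symmetric] by (simp add: abs_mult mult_right_mono)
  also have "\<dots> = (12 * b\<^sup>2 + 8 * b ^ 3) * ((1 + z ^ 4) * exp (- (b * z\<^sup>2)))" by simp
  also have "\<dots> \<le> (12 * b\<^sup>2 + 8 * b ^ 3) * (1 + 2 / b\<^sup>2)" using q b by (intro mult_left_mono) auto
  finally show ?thesis .
qed

lemma bump_taylor:
  assumes "b > 0"
  obtains C where "C > 0"
    "\<And>y d. bump b c (y + d) \<ge> bump b c y + bump1 b c y * d + bump2 b c y * d\<^sup>2 / 2 - C * \<bar>d\<bar> ^ 3"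
proof -
  define C where "C = (12 * b\<^sup>2 + 8 * b ^ 3) * (1 + 2 / b\<^sup>2)"
  have C: "C > 0" using assms by (auto simp: C_def intro!: mult_pos_pos add_pos_pos)
  have "bump b c (y + d) \<ge> bump b c y + bump1 b c y * d + bump2 b c y * d\<^sup>2 / 2 - C * \<bar>d\<bar> ^ 3" for y d
  proof (cases "d = 0")
    case False
    define D where "D n = (if n = 0 then bump b c else if n = 1 then bump1 b c else if n = 2 then bump2 b c else bump3 b c)" for n :: nat
    have "\<exists>t. (if y + d < y then y + d < t \<and> t < y else y < t \<and> t < y + d) \<and>
      bump b c (y + d) = (\<Sum>m<3. (D m y / fact m) * (y + d - y) ^ m) + (D 3 t / fact 3) * (y + d - y) ^ 3"
    proof (rule Taylor[where a="min y (y + d)" and b="max y (y + d)"])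
      have "m < 3 \<Longrightarrow> (D m has_real_derivative D (Suc m) t) (at t)" for m t
        using bump_derivs[of b c t] by (auto simp: D_def numeral_3_eq_3 less_Suc_eq)
      thus "\<forall>m t. m < 3 \<and> min y (y + d) \<le> t \<and> t \<le> max y (y + d) \<longrightarrow> (D m has_real_derivative D (Suc m) t) (at t)"
        by blast
    qed (use False in \<open>auto simp: D_def\<close>)
    then obtain t where t: "bump b c (y + d) = (\<Sum>m<3. (D m y / fact m) * d ^ m) + (D 3 t / fact 3) * d ^ 3" by auto
    have sm: "(\<Sum>m<3. (D m y / fact m) * d ^ m) = bump b c y + bump1 b c y * d + bump2 b c y * d\<^sup>2 / 2"
      by (simp add: D_def numeral_3_eq_3 fact_numeral power2_eq_square)
    have "D 3 t / fact 3 * d ^ 3 \<ge> - (C * \<bar>d\<bar> ^ 3)"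
    proof -
      have "\<bar>D 3 t / fact 3 * d ^ 3\<bar> = \<bar>bump3 b c t\<bar> / 6 * \<bar>d\<bar> ^ 3"
        by (simp add: D_def abs_mult power_abs fact_numeral)
      also have "\<dots> \<le> C * \<bar>d\<bar> ^ 3"
        using bump3_bounded[OF assms, of c t] C unfolding C_def[symmetric] by (intro mult_right_mono) auto
      finally show ?thesis by linarith
    qed
    thus ?thesis unfolding t sm by linarith
  qed simp
  thus ?thesis using that C by blast
qed

lemma bump_le_1: "b > 0 \<Longrightarrow> bump b c y \<le> 1"
proof -
  assume "b > 0"
  hence "exp (- b * (y - c)\<^sup>2) \<le> 1" by simp
  thus ?thesis unfolding bump_def using exp_ge_zero[of "- b * c\<^sup>2"] by linarith
qed

lemma bump_pos_iff:
  assumes "b > 0" "c > 0"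
  shows "bump b c y > 0 \<longleftrightarrow> 0 < y \<and> y < 2 * c"
proof -
  have "bump b c y > 0 \<longleftrightarrow> (y - c)\<^sup>2 < c\<^sup>2" using assms by (simp add: bump_def)
  also have "\<dots> \<longleftrightarrow> \<bar>y - c\<bar> < \<bar>c\<bar>" by (metis abs_le_square_iff not_le)
  also have "\<dots> \<longleftrightarrow> 0 < y \<and> y < 2 * c" using assms by auto
  finally show ?thesis .
qed

text \<open>Factor out \<open>exp (- b c^2)\<close> and use \<open>exp u - 1 >= u\<close>. The bound
  is needed close to the left zero, where the bump grows only linearly.\<close>

lemma bump_lower:
  assumes "b > 0" "0 \<le> y" "y \<le> c"
  shows "exp (- b * c\<^sup>2) * (b * c * y) \<le> bump b c y"
proof -
  define u where "u = 2 * b * c * y - b * y\<^sup>2"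
  have "b * c * y \<le> u"
  proof -
    have "b * y * y \<le> b * y * c" using assms by (intro mult_left_mono) auto
    thus ?thesis by (simp add: u_def power2_eq_square algebra_simps)
  qed
  also have "\<dots> \<le> exp u - 1" using exp_ge_add_one_self[of u] by linarith
  finally have "exp (- b * c\<^sup>2) * (b * c * y) \<le> exp (- b * c\<^sup>2) * (exp u - 1)" by (intro mult_left_mono) auto
  also have "\<dots> = bump b c y"
    by (simp add: bump_def u_def algebra_simps power2_eq_square flip: exp_add)
  finally show ?thesis .
qed

text \<open>With centre \<open>s\<close>, the standard deviation, and \<open>b s^2 = 2\<close>,
  everything becomes a function of \<open>w = (y - s) / s\<close> alone. The constant 38/100 is
  \<open>2 (1 - (9/10)^2)\<close>, used in \<open>exp (38/100) >= 1 + 38/100\<close>.\<close>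

lemma bump_interior:
  assumes s: "s > 0" and y: "0 < y" "y < 2 * s"
  defines "b \<equiv> 2 / s\<^sup>2"
  defines "w \<equiv> (y - s) / s"
  shows "\<bar>w\<bar> < 1" "s\<^sup>2 * bump2 b s y = (16 * w\<^sup>2 - 4) * exp (- 2 * w\<^sup>2)"
    "y * bump1 b s y = - 4 * (1 + w) * w * exp (- 2 * w\<^sup>2)" "bump b s y = exp (- 2 * w\<^sup>2) - exp (- 2)"
    "exp (- 2 * w\<^sup>2) \<ge> exp (- 2)" "exp (- 2 * w\<^sup>2) \<le> 1"
    "\<bar>w\<bar> \<le> 9/10 \<Longrightarrow> exp (- 2 * w\<^sup>2) - exp (- 2) \<ge> 38 / 100 * exp (- 2)"
proof -
  have yw: "y = s * (1 + w)" "y - s = s * w" using s by (simp_all add: w_def field_simps)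
  show w: "\<bar>w\<bar> < 1" using s y by (auto simp: w_def abs_if field_simps)
  have e: "b * (y - s)\<^sup>2 = 2 * w\<^sup>2" "b * s\<^sup>2 = 2" unfolding yw(2) using s by (simp_all add: b_def power_mult_distrib)
  show "s\<^sup>2 * bump2 b s y = (16 * w\<^sup>2 - 4) * exp (- 2 * w\<^sup>2)"
  proof -
    have "s\<^sup>2 * bump2 b s y = (4 * (b * s\<^sup>2) * (b * (y - s)\<^sup>2) - 2 * (b * s\<^sup>2)) * exp (- (b * (y - s)\<^sup>2))"
      by (simp add: bump2_def algebra_simps power2_eq_square)
    thus ?thesis unfolding e by simp
  qed
  show "y * bump1 b s y = - 4 * (1 + w) * w * exp (- 2 * w\<^sup>2)"
  proof -
    have "y * bump1 b s y = - 2 * (b * s\<^sup>2) * ((1 + w) * w) * exp (- (b * (y - s)\<^sup>2))"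
      by (simp add: bump1_def yw(2)) (simp add: yw(1) power2_eq_square)
    thus ?thesis unfolding e by (simp add: algebra_simps)
  qed
  show "bump b s y = exp (- 2 * w\<^sup>2) - exp (- 2)" using e by (simp add: bump_def)
  have "w\<^sup>2 \<le> 1" using w by (simp add: abs_square_le_1)
  thus "exp (- 2 * w\<^sup>2) \<ge> exp (- 2)" by simp
  show "exp (- 2 * w\<^sup>2) \<le> 1" by simp
  assume "\<bar>w\<bar> \<le> 9/10"
  hence "\<bar>w\<bar>\<^sup>2 \<le> (9/10)\<^sup>2" by (intro power_mono) auto
  hence "- 2 + 38/100 \<le> - 2 * w\<^sup>2" by (simp add: power2_eq_square)
  hence "exp (- 2 + 38/100) \<le> exp (- 2 * w\<^sup>2)" by (simp only: exp_le_cancel_iff)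
  hence "exp (- 2) * exp (38/100) \<le> exp (- 2 * w\<^sup>2)" by (simp only: exp_add)
  moreover have "exp (- 2 :: real) * (1 + 38/100) \<le> exp (- 2) * exp (38/100)"
    by (intro mult_left_mono exp_ge_add_one_self) auto
  ultimately have "exp (- 2) * (1 + 38/100) \<le> exp (- 2 * w\<^sup>2)" by (rule order_trans[rotated])
  thus "exp (- 2 * w\<^sup>2) - exp (- 2) \<ge> 38 / 100 * exp (- 2)" by (simp only: distrib_left)
qed

lemma square_lower: "9/10 \<le> \<bar>w\<bar> \<Longrightarrow> 81/100 \<le> w\<^sup>2" for w :: real
proof -
  assume "9/10 \<le> \<bar>w\<bar>"
  hence "(9/10)\<^sup>2 \<le> \<bar>w\<bar>\<^sup>2" by (intro power_mono) auto
  thus ?thesis by (simp add: power2_eq_square)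
qed

lemma exp_minus_2_ge: "exp (- 2 :: real) \<ge> 1 / 9"
proof -
  have "exp (2 :: real) = exp 1 * exp 1" by (simp flip: exp_add)
  also have "\<dots> \<le> 3 * 3" using exp_le by (intro mult_mono) auto
  finally show ?thesis by (simp add: exp_minus field_simps)
qed

text \<open>For \<open>g = t^(-100) G (x / sqrt t)\<close> the left-hand side is
  \<open>t^101\<close> times \<open>(s^2 / 2) g_xx - g_t\<close>, so the bump yields a strict
  subsolution of the heat equation run backwards from the end of the line of descent. For
  \<open>|w| > 9/10\<close> the differential part alone is at least \<open>exp (- 2)\<close>; for
  smaller \<open>|w|\<close> the bump is bounded below and the factor 100 compensates.\<close>

lemma bump_generator:
  assumes s: "s > 0" and y: "0 < y" "y < 2 * s"
  defines "b \<equiv> 2 / s\<^sup>2"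
  shows "(y * bump1 b s y + s\<^sup>2 * bump2 b s y) / 2 + 100 * bump b s y \<ge> exp (- 2)"
proof -
  define w where "w = (y - s) / s"
  note I = bump_interior[OF s y, folded b_def w_def]
  define E where "E = exp (- 2 * w\<^sup>2)"
  have E: "E \<ge> exp (- 2)" "E \<le> 1" using I by (auto simp: E_def)
  have eq: "(y * bump1 b s y + s\<^sup>2 * bump2 b s y) / 2 + 100 * bump b s y
     = 2 * E * (3 * w\<^sup>2 - w - 1) + 100 * (E - exp (- 2))"
    unfolding I(2,3,4) E_def[symmetric] by (simp add: field_simps power2_eq_square)
  show ?thesis
  proof (cases "\<bar>w\<bar> \<le> 9/10")
    case True
    \<comment> \<open>The minimum of \<open>3 w^2 - w - 1\<close> is -13/12, attained at
      \<open>w = 1/6\<close>.\<close>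
    have "12 * (3 * w\<^sup>2 - w - 1) + 13 = (6 * w - 1)\<^sup>2" by (simp add: power2_eq_square algebra_simps)
    hence "0 \<le> 12 * (3 * w\<^sup>2 - w - 1) + 13" by (simp only: zero_le_power2)
    moreover have "0 \<le> 12 * q + 13 \<Longrightarrow> - (13/12) \<le> q" for q :: real by (simp add: field_simps)
    ultimately have "- (13/12) \<le> 3 * w\<^sup>2 - w - 1" by blast
    hence "2 * E * (- (13/12)) \<le> 2 * E * (3 * w\<^sup>2 - w - 1)"
      using E exp_ge_zero[of "- 2 :: real"] by (intro mult_left_mono) linarith+
    moreover have "100 * (38/100 * exp (- 2)) \<le> 100 * (E - exp (- 2))" using I(7)[OF True] by (simp add: E_def)
    ultimately show ?thesis using E exp_minus_2_ge unfolding eq by linarith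
  next
    case False
    have "81/100 \<le> w\<^sup>2" using False square_lower by simp
    moreover have "w \<ge> 0 \<Longrightarrow> 3 * w\<^sup>2 - w - 1 \<ge> 1/2"
    proof -
      assume "w \<ge> 0"
      hence "9/10 * w \<le> w * w" using False by (intro mult_right_mono) auto
      moreover have "9/10 < w" using False \<open>w \<ge> 0\<close> by simp
      ultimately show ?thesis unfolding power2_eq_square by linarith
    qed
    ultimately have "3 * w\<^sup>2 - w - 1 \<ge> 1/2" by (cases "w \<ge> 0") linarith+
    hence "2 * E * (1/2) \<le> 2 * E * (3 * w\<^sup>2 - w - 1)"
      using E exp_ge_zero[of "- 2 :: real"] by (intro mult_left_mono) linarith+
    moreover have "2 * E * (1/2) \<le> q \<Longrightarrow> exp (- 2) \<le> q + 100 * (E - exp (- 2))" for q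
      using E by (simp add: algebra_simps)
    ultimately show ?thesis unfolding eq by blast
  qed
qed

lemma abs_add_cubed_le: "\<bar>u + v\<bar> ^ 3 \<le> 4 * (\<bar>u\<bar> ^ 3 + \<bar>v\<bar> ^ 3)" for u v :: real
proof -
  have "\<bar>u + v\<bar> ^ 3 \<le> (\<bar>u\<bar> + \<bar>v\<bar>) ^ 3" by (intro power_mono) auto
  also have "\<dots> \<le> 4 * (\<bar>u\<bar> ^ 3 + \<bar>v\<bar> ^ 3)"
  proof -
    define a b where "a = \<bar>u\<bar>" "b = \<bar>v\<bar>"
    have "4 * (a ^ 3 + b ^ 3) - (a + b) ^ 3 = 3 * (a + b) * (a - b)\<^sup>2"
      by (simp add: algebra_simps power2_eq_square power3_eq_cube)
    also have "\<dots> \<ge> 0" by (auto simp: a_b_def)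
    finally show ?thesis by (simp add: a_b_def)
  qed
  finally show ?thesis .
qed

section \<open>One step of a centred random walk applied to the bump\<close>

locale centered_law = prob_space T for T :: "real measure" +
  fixes \<mu> s m3 :: real
  assumes sets_T [measurable_cong]: "sets T = sets borel"
    and int2: "integrable T (\<lambda>y. (y - \<mu>)\<^sup>2)" and int3: "integrable T (\<lambda>y. \<bar>y - \<mu>\<bar> ^ 3)"
    and int1: "integrable T (\<lambda>y. y - \<mu>)" and mean: "(\<integral>y. y - \<mu> \<partial>T) = 0"
    and var: "(\<integral>y. (y - \<mu>)\<^sup>2 \<partial>T) = s\<^sup>2" and s_pos: "s > 0"
    and third: "(\<integral>y. \<bar>y - \<mu>\<bar> ^ 3 \<partial>T) = m3"
begin

lemma m3_nonneg: "m3 \<ge> 0"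
  unfolding third[symmetric] by (rule integral_nonneg_AE) auto

lemma integrable_bump:
  assumes "b > 0"
  shows "integrable T (\<lambda>y. bump b c (f + h * (y - \<mu>)))"
proof (rule integrable_const_bound[where B=1])
  have "\<bar>bump b c y\<bar> \<le> 1" for y
  proof -
    have "0 < exp (- b * (y - c)\<^sup>2)" "exp (- b * (y - c)\<^sup>2) \<le> 1" "0 < exp (- b * c\<^sup>2)" "exp (- b * c\<^sup>2) \<le> 1"
      using assms by auto
    thus ?thesis unfolding bump_def by linarith
  qed
  thus "AE y in T. norm (bump b c (f + h * (y - \<mu>))) \<le> 1" by simp
qed measurable

text \<open>Taylor expansion at \<open>y\<close> with increment \<open>a + h (z - \<mu>)\<close>.
  Every term linear in \<open>z - \<mu>\<close> has mean zero, including the cross term of the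
  square, and \<open>abs_add_cubed_le\<close> separates the cubic remainder at the price of a factor
  4.\<close>

lemma expected_bump_ge:
  assumes C: "\<And>y d. bump b c (y + d) \<ge> bump b c y + bump1 b c y * d + bump2 b c y * d\<^sup>2 / 2 - C * \<bar>d\<bar> ^ 3"
    and "C > 0" "b > 0" "h \<ge> 0"
  shows "(\<integral>z. bump b c (y + a + h * (z - \<mu>)) \<partial>T) \<ge>
    bump b c y + bump1 b c y * a + bump2 b c y * (a\<^sup>2 + h\<^sup>2 * s\<^sup>2) / 2 - 4 * C * (\<bar>a\<bar> ^ 3 + h ^ 3 * m3)"
proof -
  let ?r = "\<lambda>z. (bump b c y + bump1 b c y * a + bump2 b c y * a\<^sup>2 / 2 - 4 * C * \<bar>a\<bar> ^ 3)
    + (bump1 b c y * h + bump2 b c y * a * h) * (z - \<mu>) + bump2 b c y * h\<^sup>2 / 2 * (z - \<mu>)\<^sup>2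
    - 4 * C * h ^ 3 * \<bar>z - \<mu>\<bar> ^ 3"
  have "(\<integral>z. ?r z \<partial>T) \<le> (\<integral>z. bump b c (y + a + h * (z - \<mu>)) \<partial>T)"
  proof (rule integral_mono)
    show "integrable T ?r" using int1 int2 int3 by simp
    show "integrable T (\<lambda>z. bump b c (y + a + h * (z - \<mu>)))" by (rule integrable_bump) fact
    fix z
    have "C * \<bar>a + h * (z - \<mu>)\<bar> ^ 3 \<le> C * (4 * (\<bar>a\<bar> ^ 3 + \<bar>h * (z - \<mu>)\<bar> ^ 3))"
      using \<open>C > 0\<close> by (intro mult_left_mono abs_add_cubed_le) auto
    also have "\<bar>h * (z - \<mu>)\<bar> ^ 3 = h ^ 3 * \<bar>z - \<mu>\<bar> ^ 3"
      using \<open>h \<ge> 0\<close> by (simp add: abs_mult power_mult_distrib)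
    finally have le: "C * \<bar>a + h * (z - \<mu>)\<bar> ^ 3 \<le> C * (4 * (\<bar>a\<bar> ^ 3 + h ^ 3 * \<bar>z - \<mu>\<bar> ^ 3))" .
    have expand: "B + B1 * a + B2 * a\<^sup>2 / 2 - 4 * C * A + (B1 * h + B2 * a * h) * x + B2 * h\<^sup>2 / 2 * x\<^sup>2 - 4 * C * h ^ 3 * X
      = B + B1 * (a + h * x) + B2 * (a + h * x)\<^sup>2 / 2 - C * (4 * (A + h ^ 3 * X))" for B B1 B2 A x X
      by (simp add: field_simps power2_eq_square)
    have "?r z \<le> bump b c y + bump1 b c y * (a + h * (z - \<mu>)) + bump2 b c y * (a + h * (z - \<mu>))\<^sup>2 / 2
       - C * \<bar>a + h * (z - \<mu>)\<bar> ^ 3"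
      unfolding expand using le by linarith
    also have "\<dots> \<le> bump b c (y + (a + h * (z - \<mu>)))" by (rule C)
    finally show "?r z \<le> bump b c (y + a + h * (z - \<mu>))" by (simp add: add.assoc)
  qed
  also have "(\<integral>z. ?r z \<partial>T) = bump b c y + bump1 b c y * a + bump2 b c y * (a\<^sup>2 + h\<^sup>2 * s\<^sup>2) / 2
     - 4 * C * (\<bar>a\<bar> ^ 3 + h ^ 3 * m3)"
    using int1 int2 int3 by (simp add: mean var third prob_space) (simp add: algebra_simps)
  finally show ?thesis by simp
qed

end

context centered_law
begin

text \<open>The exponent 100 only has to be large: it absorbs the concave part of the bump, see
  \<open>bump_generator\<close>.\<close>

lemma critical_step:
  defines "b \<equiv> 2 / s\<^sup>2"
  obtains t0 where "t0 \<ge> 1" "\<And>t x. t \<ge> t0 \<Longrightarrow> bump b s (x / sqrt (t + 1)) > 0 \<Longrightarrow>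
    (\<integral>z. bump b s ((x + (z - \<mu>)) / sqrt t) \<partial>T)
      \<ge> (t / (t + 1)) ^ 100 * bump b s (x / sqrt (t + 1)) + exp (- 2) / (2 * t)"
proof -
  have b: "b > 0" using s_pos by (simp add: b_def)
  obtain C where C: "C > 0"
    "\<And>y d. bump b s (y + d) \<ge> bump b s y + bump1 b s y * d + bump2 b s y * d\<^sup>2 / 2 - C * \<bar>d\<bar> ^ 3"
    using bump_taylor[OF b] by blast
  \<comment> \<open>\<open>D\<close> collects the constants of all errors, each a multiple of
    \<open>u = t^(-3/2)\<close>: 1 and 2 from \<open>A1\<close> and \<open>A2\<close>, the terms
    with \<open>C\<close> from \<open>A3\<close>, and \<open>10000 = 100^2\<close> from
    \<open>bern\<close>.\<close>
  define D where "D = 3 + 4 * C * s ^ 3 + 4 * C * m3 + 10000"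
  have D: "D > 0" using C(1) s_pos m3_nonneg by (simp add: D_def add_pos_nonneg)
  \<comment> \<open>From \<open>t0\<close> on, the errors \<open>D u\<close> use up at most half of
    the surplus \<open>exp (- 2) / t\<close>; the other half appears in the conclusion.\<close>
  define t0 where "t0 = max 1 ((2 * D * exp 2)\<^sup>2)"
  have main: "(\<integral>z. bump b s ((x + (z - \<mu>)) / sqrt t) \<partial>T)
      \<ge> (t / (t + 1)) ^ 100 * bump b s (x / sqrt (t + 1)) + exp (- 2) / (2 * t)"
    if t: "t \<ge> t0" and pos: "bump b s (x / sqrt (t + 1)) > 0" for t x
  proof -
    have t1: "t \<ge> 1" and t2: "2 * D * exp 2 \<le> sqrt t"
      using t D by (auto simp: t0_def intro!: real_le_rsqrt)
    define y where "y = x / sqrt (t + 1)"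
    have y: "0 < y" "y < 2 * s" using pos bump_pos_iff[OF b s_pos] by (auto simp: y_def)
    define h where "h = 1 / sqrt t"
    have h: "h > 0" "h\<^sup>2 = 1 / t" "h ^ 3 = h / t" "h \<le> 1"
      using t1 by (auto simp: h_def power_divide power3_eq_cube)
    \<comment> \<open>The change of scale \<open>sqrt (t + 1) = sqrt t (1 + \<delta>)\<close> acts
      on \<open>y\<close> as a drift \<open>y \<delta>\<close>, of leading order
      \<open>y / (2 t)\<close>.\<close>
    define \<delta> where "\<delta> = sqrt (1 + 1 / t) - 1"
    have \<delta>0: "\<delta> \<ge> 0" using t1 by (simp add: \<delta>_def)
    have "(1 + \<delta>)\<^sup>2 = 1 + 1 / t" using t1 by (simp add: \<delta>_def)
    hence \<delta>eq: "\<delta> = 1 / (2 * t) - \<delta>\<^sup>2 / 2" by (simp add: power2_eq_square field_simps)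
    hence \<delta>1: "\<delta> \<le> 1 / (2 * t)" using zero_le_power2[of \<delta>] by linarith
    have \<delta>2: "\<delta>\<^sup>2 \<le> 1 / (4 * t\<^sup>2)"
      using power_mono[OF \<delta>1 \<delta>0, of 2] by (simp add: power_divide power_mult_distrib)
    define u where "u = h / t"
    have u: "1 / t\<^sup>2 \<le> u" "0 \<le> u"
    proof -
      have "1 / t \<le> 1 / sqrt t" using t1 by (intro divide_left_mono real_le_lsqrt self_le_power) auto
      hence "1 / t / t \<le> h / t" unfolding h_def using t1 by (intro divide_right_mono) auto
      thus "1 / t\<^sup>2 \<le> u" by (simp add: u_def power2_eq_square)
      show "0 \<le> u" using h t1 by (simp add: u_def)
    qed
    define w where "w = (y - s) / s"
    note I = bump_interior[OF s_pos y, folded b_def w_def]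
    define E where "E = exp (- 2 * w\<^sup>2)"
    have E: "0 \<le> E" "E \<le> 1" by (auto simp: E_def)
    have H1: "y * bump1 b s y \<le> 8" "y * bump1 b s y \<ge> - 8"
    proof -
      have "y * bump1 b s y = - (4 * ((1 + w) * w * E))" unfolding I(3) E_def by (simp add: algebra_simps)
      hence "\<bar>y * bump1 b s y\<bar> = 4 * (\<bar>1 + w\<bar> * \<bar>w\<bar> * E)"
        using E(1) by (simp only: abs_minus_cancel abs_mult abs_numeral abs_of_nonneg)
      also have "\<dots> \<le> 4 * (2 * 1 * 1)" using I(1) E by (intro mult_left_mono mult_mono) auto
      finally show "y * bump1 b s y \<le> 8" "y * bump1 b s y \<ge> - 8" by auto
    qed
    have H2: "s\<^sup>2 * bump2 b s y \<ge> - 4"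
    proof -
      have "- 4 * E \<le> (16 * w\<^sup>2 - 4) * E" using E by (intro mult_right_mono) auto
      moreover have "- 4 \<le> - 4 * E" using E by simp
      ultimately show ?thesis unfolding I(2) E_def[symmetric] by linarith
    qed
    have H2y: "bump2 b s y * y\<^sup>2 \<ge> - 16"
    proof (cases "bump2 b s y \<ge> 0")
      case False
      have "y\<^sup>2 \<le> (2 * s)\<^sup>2" using y by (intro power_mono) auto
      hence "bump2 b s y * (2 * s)\<^sup>2 \<le> bump2 b s y * y\<^sup>2" using False by (intro mult_left_mono_neg) auto
      moreover have "bump2 b s y * (2 * s)\<^sup>2 = 4 * (s\<^sup>2 * bump2 b s y)" by (simp add: power_mult_distrib)
      ultimately show ?thesis using H2 by linarith
    next
      case True
      hence "0 \<le> bump2 b s y * y\<^sup>2" by simp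
      thus ?thesis by linarith
    qed
    have arg: "(x + (z - \<mu>)) / sqrt t = y + y * \<delta> + h * (z - \<mu>)" for z
    proof -
      have "sqrt (t + 1) = sqrt t * (1 + \<delta>)"
        using t1 by (simp add: \<delta>_def real_sqrt_mult[symmetric] algebra_simps)
      moreover have "x = y * sqrt (t + 1)" using t1 by (simp add: y_def)
      ultimately have "x = y * (sqrt t * (1 + \<delta>))" by simp
      hence "x / sqrt t = y * (1 + \<delta>)" using t1 by simp
      moreover have "(x + (z - \<mu>)) / sqrt t = x / sqrt t + h * (z - \<mu>)"
        by (subst add_divide_distrib) (simp add: h_def)
      ultimately show ?thesis by (simp add: distrib_left)
    qed
    have yd: "0 \<le> y * \<delta>" "y * \<delta> \<le> s / t"
    proof -
      show "0 \<le> y * \<delta>" using y \<delta>0 by simp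
      have "y * \<delta> \<le> (2 * s) * (1 / (2 * t))" using y \<delta>0 \<delta>1 by (intro mult_mono) auto
      thus "y * \<delta> \<le> s / t" by simp
    qed
    have yd3: "\<bar>y * \<delta>\<bar> ^ 3 \<le> s ^ 3 * u"
    proof -
      have "\<bar>y * \<delta>\<bar> ^ 3 \<le> (s / t) ^ 3" using yd by (intro power_mono) auto
      also have "\<dots> = s ^ 3 * (1 / t ^ 3)" by (simp add: power_divide)
      also have "\<dots> \<le> s ^ 3 * (1 / t\<^sup>2)"
        using s_pos t1 by (intro mult_left_mono divide_left_mono power_increasing) auto
      also have "\<dots> \<le> s ^ 3 * u" using u s_pos by (intro mult_left_mono) auto
      finally show ?thesis .
    qed
    have A1: "bump1 b s y * (y * \<delta>) \<ge> (y * bump1 b s y) / (2 * t) - u"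
    proof -
      have "y * bump1 b s y * \<delta> = (y * bump1 b s y) * (1 / (2 * t) - \<delta>\<^sup>2 / 2)" using \<delta>eq by simp
      also have "\<dots> = (y * bump1 b s y) / (2 * t) - (y * bump1 b s y) * (\<delta>\<^sup>2 / 2)" by (simp add: right_diff_distrib)
      finally have "y * bump1 b s y * \<delta> = (y * bump1 b s y) / (2 * t) - (y * bump1 b s y) * (\<delta>\<^sup>2 / 2)" .
      moreover have "(y * bump1 b s y) * (\<delta>\<^sup>2 / 2) \<le> 8 * (\<delta>\<^sup>2 / 2)" using H1 by (intro mult_right_mono) auto
      moreover have "8 * (\<delta>\<^sup>2 / 2) \<le> 1 / t\<^sup>2" using \<delta>2 by simp
      moreover have "bump1 b s y * (y * \<delta>) = y * bump1 b s y * \<delta>" by simp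
      ultimately show ?thesis using u by linarith
    qed
    have A2: "bump2 b s y * ((y * \<delta>)\<^sup>2 + h\<^sup>2 * s\<^sup>2) / 2 \<ge> (s\<^sup>2 * bump2 b s y) / (2 * t) - 2 * u"
    proof -
      have "bump2 b s y * ((y * \<delta>)\<^sup>2 + h\<^sup>2 * s\<^sup>2) / 2 = (bump2 b s y * y\<^sup>2) * (\<delta>\<^sup>2 / 2) + (s\<^sup>2 * bump2 b s y) / (2 * t)"
        unfolding h(2) by (simp add: field_simps power_mult_distrib)
      moreover have "(- 16) * (\<delta>\<^sup>2 / 2) \<le> (bump2 b s y * y\<^sup>2) * (\<delta>\<^sup>2 / 2)" using H2y by (intro mult_right_mono) auto
      moreover have "- (2 * (1 / t\<^sup>2)) \<le> (- 16) * (\<delta>\<^sup>2 / 2)" using \<delta>2 by simp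
      ultimately show ?thesis using u by linarith
    qed
    have A3: "4 * C * (\<bar>y * \<delta>\<bar> ^ 3 + h ^ 3 * m3) \<le> (4 * C * s ^ 3 + 4 * C * m3) * u"
    proof -
      have "4 * C * (\<bar>y * \<delta>\<bar> ^ 3 + h ^ 3 * m3) \<le> 4 * C * (s ^ 3 * u + u * m3)"
        using yd3 C(1) h(3) by (intro mult_left_mono) (auto simp: u_def)
      thus ?thesis by (simp add: algebra_simps)
    qed
    have "(\<integral>z. bump b s ((x + (z - \<mu>)) / sqrt t) \<partial>T) \<ge>
      bump b s y + bump1 b s y * (y * \<delta>) + bump2 b s y * ((y * \<delta>)\<^sup>2 + h\<^sup>2 * s\<^sup>2) / 2
        - 4 * C * (\<bar>y * \<delta>\<bar> ^ 3 + h ^ 3 * m3)"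
      unfolding arg by (rule expected_bump_ge[OF C(2,1) b]) (use h in auto)
    note L0 = this
    have L: "(\<integral>z. bump b s ((x + (z - \<mu>)) / sqrt t) \<partial>T) \<ge>
      bump b s y + (y * bump1 b s y) / (2 * t) + (s\<^sup>2 * bump2 b s y) / (2 * t) - (D - 10000) * u"
    proof -
      have "(D - 10000) * u = 3 * u + (4 * C * s ^ 3 + 4 * C * m3) * u" by (simp add: D_def algebra_simps)
      with A1 A2 A3 L0 show ?thesis by linarith
    qed
    have gen: "(y * bump1 b s y) / (2 * t) + (s\<^sup>2 * bump2 b s y) / (2 * t) \<ge> exp (- 2) / t - 100 * bump b s y / t"
    proof -
      have "exp (- 2) - 100 * bump b s y \<le> (y * bump1 b s y + s\<^sup>2 * bump2 b s y) / 2"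
        using bump_generator[OF s_pos y] unfolding b_def by linarith
      hence "(exp (- 2) - 100 * bump b s y) / t \<le> ((y * bump1 b s y + s\<^sup>2 * bump2 b s y) / 2) / t"
        using t1 by (intro divide_right_mono) auto
      thus ?thesis by (simp add: add_divide_distrib diff_divide_distrib)
    qed
    have H01: "0 \<le> bump b s y" "bump b s y \<le> 1" using pos bump_le_1[OF b] by (auto simp: y_def)
    \<comment> \<open>Bernoulli's inequality expands the decay of the prefactor as
      \<open>1 - 100 / t\<close> up to second order; this is the source of the term
      \<open>100 bump\<close> in \<open>bump_generator\<close>.\<close>
    have bern: "(t / (t + 1)) ^ 100 * bump b s y \<le> bump b s y - 100 * bump b s y / t + 10000 * u"
    proof -
      define v where "v = 100 / t"
      have v: "v \<ge> 0" using t1 by (simp add: v_def)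
      have "1 + real 100 * (1 / t) \<le> (1 + 1 / t) ^ 100"
        by (rule Bernoulli_inequality) (rule order_trans[of _ 0], use t1 in simp_all)
      hence "1 + v \<le> (1 + 1 / t) ^ 100" by (simp add: v_def)
      hence "inverse ((1 + 1 / t) ^ 100) \<le> inverse (1 + v)"
        using v by (intro le_imp_inverse_le) (auto simp: add_pos_nonneg)
      also have "inverse ((1 + 1 / t) ^ 100) = (t / (t + 1)) ^ 100"
        using t1 by (simp add: power_inverse[symmetric] field_simps)
      also have "inverse (1 + v) \<le> 1 - v + v\<^sup>2"
      proof -
        have "1 \<le> (1 - v + v\<^sup>2) * (1 + v)" using v by (simp add: algebra_simps power2_eq_square)
        thus ?thesis using v by (simp add: inverse_eq_divide divide_le_eq)
      qed
      finally have "(t / (t + 1)) ^ 100 * bump b s y \<le> (1 - v + v\<^sup>2) * bump b s y"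
        using H01 by (intro mult_right_mono) auto
      also have "\<dots> = bump b s y - 100 * bump b s y / t + v\<^sup>2 * bump b s y"
        by (simp add: v_def algebra_simps)
      also have "v\<^sup>2 * bump b s y \<le> v\<^sup>2 * 1" using H01 by (intro mult_left_mono) auto
      also have "v\<^sup>2 * 1 = 10000 * (1 / t\<^sup>2)" by (simp add: v_def power_divide)
      also have "\<dots> \<le> 10000 * u" using u by simp
      finally show ?thesis by simp
    qed
    have "D * u \<le> exp (- 2) / (2 * t)"
    proof -
      have "2 * D * exp 2 * h \<le> sqrt t * h" using t2 h by (intro mult_right_mono) auto
      also have "sqrt t * h = 1" using t1 by (simp add: h_def)
      finally have "D * h \<le> exp (- 2) / 2" by (simp add: exp_minus field_simps)
      hence "D * h / t \<le> exp (- 2) / 2 / t" using t1 by (intro divide_right_mono) auto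
      thus ?thesis by (simp add: u_def)
    qed
    moreover have "exp (- 2 :: real) / t = exp (- 2) / (2 * t) + exp (- 2) / (2 * t)" by simp
    moreover have "(D - 10000) * u = D * u - 10000 * u" by (simp add: left_diff_distrib)
    ultimately show ?thesis using L gen bern unfolding y_def[symmetric] by linarith
  qed
  show ?thesis by (rule that[of t0]) (auto simp: t0_def intro: main)
qed

text \<open>On a wide spatial scale \<open>R = 1 / h\<close>, one step changes the bump only by
  \<open>O(h^2)\<close>. In the middle, where the bump is bounded below, the factor \<Lambda> pays
  for the concavity; near the zeros, where the bump may be arbitrarily small, its convexity
  contributes a gain of order \<open>h^2\<close>.\<close>

lemma supercritical_step:
  defines "b \<equiv> 2 / s\<^sup>2"
  assumes \<Lambda>: "\<Lambda> > 1"
  obtains R \<kappa> where "R > 0" "\<kappa> > 0" "\<And>x. bump b s (x / R) > 0 \<Longrightarrow>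
    \<Lambda> * (\<integral>z. bump b s ((x + (z - \<mu>)) / R) \<partial>T) \<ge> bump b s (x / R) + \<kappa>"
proof -
  have b: "b > 0" using s_pos by (simp add: b_def)
  obtain C where C: "C > 0"
    "\<And>y d. bump b s (y + d) \<ge> bump b s y + bump1 b s y * d + bump2 b s y * d\<^sup>2 / 2 - C * \<bar>d\<bar> ^ 3"
    using bump_taylor[OF b] by blast
  define k where "k = exp (- 2 :: real)"
  have k: "k > 0" by (simp add: k_def)
  \<comment> \<open>The second bound keeps the cubic remainder below half of the convexity gain
    \<open>4 k h^2\<close> near the zeros, see \<open>h1\<close>; the third keeps the loss in the
    middle below a tenth of \<open>(\<Lambda> - 1) k\<close>, see \<open>h2\<close>.\<close>
  define h where "h = min 1 (min (2 * k / (4 * C * m3 + 1)) ((\<Lambda> - 1) * k / (10 * \<Lambda> * (2 + 4 * C * m3))))"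
  have Cm: "4 * C * m3 \<ge> 0" using C(1) m3_nonneg by simp
  have h: "h > 0" "h \<le> 1" "h \<le> 2 * k / (4 * C * m3 + 1)" "h \<le> (\<Lambda> - 1) * k / (10 * \<Lambda> * (2 + 4 * C * m3))"
    using k Cm \<Lambda> by (auto simp: h_def intro!: divide_pos_pos mult_pos_pos)
  have h1: "4 * C * m3 * h \<le> 2 * k"
  proof -
    have "h * (4 * C * m3 + 1) \<le> 2 * k" using h(3) Cm by (simp add: pos_le_divide_eq)
    thus ?thesis using h by (simp add: algebra_simps)
  qed
  have h2: "\<Lambda> * (2 + 4 * C * m3) * h \<le> (\<Lambda> - 1) * k / 10"
  proof -
    have "h * (10 * \<Lambda> * (2 + 4 * C * m3)) \<le> (\<Lambda> - 1) * k"
      using h(4) Cm \<Lambda> by (subst (asm) pos_le_divide_eq) auto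
    moreover have "\<Lambda> * (2 + 4 * C * m3) * h = h * (10 * \<Lambda> * (2 + 4 * C * m3)) / 10" by simp
    ultimately show ?thesis by linarith
  qed
  \<comment> \<open>The smaller of the two surpluses, near the zeros and in the middle.\<close>
  define \<kappa> where "\<kappa> = min (\<Lambda> * (2 * k * h\<^sup>2)) ((\<Lambda> - 1) * k / 10)"
  have \<kappa>: "\<kappa> > 0" using k h \<Lambda> by (auto simp: \<kappa>_def)
  have "\<Lambda> * (\<integral>z. bump b s ((x + (z - \<mu>)) / (1 / h)) \<partial>T) \<ge> bump b s (x / (1 / h)) + \<kappa>"
    if pos: "bump b s (x / (1 / h)) > 0" for x
  proof -
    define y where "y = x * h"
    have y: "0 < y" "y < 2 * s" using pos bump_pos_iff[OF b s_pos] by (auto simp: y_def)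
    define w where "w = (y - s) / s"
    note I = bump_interior[OF s_pos y, folded b_def w_def]
    define E where "E = exp (- 2 * w\<^sup>2)"
    have E: "0 \<le> E" "E \<le> 1" "k \<le> E" using I by (auto simp: E_def k_def)
    have arg: "(x + (z - \<mu>)) / (1 / h) = y + 0 + h * (z - \<mu>)" for z
      by (simp add: y_def algebra_simps)
    have L0: "(\<integral>z. bump b s ((x + (z - \<mu>)) / (1 / h)) \<partial>T) \<ge>
      bump b s y + bump1 b s y * 0 + bump2 b s y * (0\<^sup>2 + h\<^sup>2 * s\<^sup>2) / 2 - 4 * C * (\<bar>0\<bar> ^ 3 + h ^ 3 * m3)"
      unfolding arg by (rule expected_bump_ge[OF C(2,1) b]) (use h in auto)
    have L1: "bump b s y + bump1 b s y * 0 + bump2 b s y * (0\<^sup>2 + h\<^sup>2 * s\<^sup>2) / 2 - 4 * C * (\<bar>0\<bar> ^ 3 + h ^ 3 * m3)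
       = bump b s y + h\<^sup>2 * ((s\<^sup>2 * bump2 b s y) / 2 - 4 * C * m3 * h)"
    proof -
      have "A + B * 0 + A2 * (0\<^sup>2 + h\<^sup>2 * s\<^sup>2) / 2 - 4 * C * (\<bar>0\<bar> ^ 3 + h ^ 3 * m3)
        = A + h\<^sup>2 * ((s\<^sup>2 * A2) / 2 - 4 * C * m3 * h)" for A B A2 :: real
        by (simp add: power2_eq_square power3_eq_cube right_diff_distrib)
      thus ?thesis .
    qed
    have L2: "(s\<^sup>2 * bump2 b s y) / 2 = (8 * w\<^sup>2 - 2) * E" by (simp add: I(2) E_def left_diff_distrib)
    have L: "(\<integral>z. bump b s ((x + (z - \<mu>)) / (1 / h)) \<partial>T)
      \<ge> bump b s y + h\<^sup>2 * ((8 * w\<^sup>2 - 2) * E - 4 * C * m3 * h)"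
      using L0 by (simp only: L1 L2)
    have H0: "bump b s y > 0" using pos by (simp add: y_def)
    have hyp: "bump b s y + \<kappa> \<le> \<Lambda> * (bump b s y + h\<^sup>2 * ((8 * w\<^sup>2 - 2) * E - 4 * C * m3 * h))"
    proof (cases "\<bar>w\<bar> \<le> 9/10")
      case True
      have H: "bump b s y \<ge> 38/100 * k" using I(7)[OF True] I(4) by (simp add: k_def)
      have "- 2 * 1 \<le> - 2 * E" using E by simp
      also have "\<dots> \<le> (8 * w\<^sup>2 - 2) * E" using E by (intro mult_right_mono) auto
      finally have q: "- 2 \<le> (8 * w\<^sup>2 - 2) * E" by simp
      have "4 * C * m3 * h \<le> 4 * C * m3 * 1" using Cm h by (intro mult_left_mono) auto
      hence "- (2 + 4 * C * m3) \<le> (8 * w\<^sup>2 - 2) * E - 4 * C * m3 * h" using q by linarith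
      hence "h\<^sup>2 * - (2 + 4 * C * m3) \<le> h\<^sup>2 * ((8 * w\<^sup>2 - 2) * E - 4 * C * m3 * h)"
        by (intro mult_left_mono) auto
      moreover have "h\<^sup>2 * (2 + 4 * C * m3) \<le> h * (2 + 4 * C * m3)"
        using h Cm by (intro mult_right_mono) (auto simp: power2_eq_square)
      ultimately have "- (h * (2 + 4 * C * m3)) \<le> h\<^sup>2 * ((8 * w\<^sup>2 - 2) * E - 4 * C * m3 * h)" by linarith
      hence "\<Lambda> * (- (h * (2 + 4 * C * m3))) \<le> \<Lambda> * (h\<^sup>2 * ((8 * w\<^sup>2 - 2) * E - 4 * C * m3 * h))"
        using \<Lambda> by (intro mult_left_mono) auto
      moreover have "\<Lambda> * (- (h * (2 + 4 * C * m3))) = - (\<Lambda> * (2 + 4 * C * m3) * h)" by (simp only: mult_minus_right mult_ac)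
      moreover have "38/100 * ((\<Lambda> - 1) * k) \<le> (\<Lambda> - 1) * bump b s y"
        using mult_left_mono[OF H, of "\<Lambda> - 1"] \<Lambda> by (simp only: mult_ac)
      moreover have "\<kappa> \<le> (\<Lambda> - 1) * k / 10" by (simp add: \<kappa>_def)
      moreover have "0 \<le> (\<Lambda> - 1) * k" using \<Lambda> k by simp
      ultimately have "\<kappa> \<le> (\<Lambda> - 1) * bump b s y + \<Lambda> * (h\<^sup>2 * ((8 * w\<^sup>2 - 2) * E - 4 * C * m3 * h))"
        using h2 by linarith
      moreover have "\<Lambda> * (bump b s y + Z) = bump b s y + ((\<Lambda> - 1) * bump b s y + \<Lambda> * Z)" for Z
        by (simp add: algebra_simps)
      ultimately show ?thesis by simp
    next
      case False
      have "81/100 \<le> w\<^sup>2" using False square_lower by simp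
      hence "4 * k \<le> (8 * w\<^sup>2 - 2) * E" using E k by (intro mult_mono) auto
      hence "2 * k \<le> (8 * w\<^sup>2 - 2) * E - 4 * C * m3 * h" using h1 by linarith
      hence "\<Lambda> * (h\<^sup>2 * (2 * k)) \<le> \<Lambda> * (h\<^sup>2 * ((8 * w\<^sup>2 - 2) * E - 4 * C * m3 * h))"
        using \<Lambda> by (intro mult_left_mono) auto
      moreover have "\<kappa> \<le> \<Lambda> * (h\<^sup>2 * (2 * k))" unfolding \<kappa>_def by (simp add: mult_ac)
      moreover have "bump b s y \<le> \<Lambda> * bump b s y" using \<Lambda> H0 by simp
      ultimately show ?thesis by (simp add: distrib_left)
    qed
    also have "\<dots> \<le> \<Lambda> * (\<integral>z. bump b s ((x + (z - \<mu>)) / (1 / h)) \<partial>T)"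
      using L \<Lambda> by (intro mult_left_mono) auto
    finally show ?thesis by (simp add: y_def)
  qed
  thus ?thesis using that[of "1 / h" \<kappa>] h(1) \<kappa> by auto
qed

end

section \<open>Exponential tilting of the displacements\<close>

context nongeom_law
begin

text \<open>For \<theta> > 1 this is \<open>exp (\<phi> \<theta>)\<close>, the growth factor of the
  recursion after tilting by \<theta> and centring by \<open>\<mu> \<theta>\<close>. Criticality
  means the value 1.\<close>

definition Lam :: "real \<Rightarrow> real" where "Lam \<theta> = lap.G 0 \<theta> * exp (\<theta> * \<mu> \<theta>)"

lemma space_lam [simp]: "space lam = UNIV"
  by (simp add: lam_def)

definition tilt :: "real \<Rightarrow> real measure" where
  "tilt \<theta> = density lam (\<lambda>y. ennreal (exp (- (\<theta> * y)) / lap.G 0 \<theta>))"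

lemma sets_tilt [measurable_cong, simp]: "sets (tilt \<theta>) = sets borel"
  by (simp add: tilt_def)

context
  fixes \<theta> :: real
  assumes \<theta>: "\<theta> > 1"
begin

lemma G0_pos: "lap.G 0 \<theta> > 0" by (rule G_pos[OF \<theta>])

lemma integrable_tilt_iff:
  assumes [measurable]: "g \<in> borel_measurable borel"
  shows "integrable (tilt \<theta>) g \<longleftrightarrow> integrable lam (\<lambda>y. exp (- (\<theta> * y)) / lap.G 0 \<theta> * (g y :: real))"
  unfolding tilt_def using G0_pos by (intro integrable_real_density) auto

lemma integral_tilt:
  assumes [measurable]: "g \<in> borel_measurable borel"
  shows "(\<integral>y. g y \<partial>tilt \<theta>) = (\<integral>y. exp (- (\<theta> * y)) / lap.G 0 \<theta> * (g y :: real) \<partial>lam)"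
  unfolding tilt_def using G0_pos by (intro integral_real_density) auto

lemma integrable_tilt_power: "integrable (tilt \<theta>) (\<lambda>y. y ^ n)"
proof -
  have "integrable lam (\<lambda>y. (y ^ n * exp (- (\<theta> * y))) / lap.G 0 \<theta>)"
    by (intro integrable_divide lap.integrable_G \<theta>)
  thus ?thesis by (subst integrable_tilt_iff) (simp_all add: mult.commute)
qed

lemma integral_tilt_power: "(\<integral>y. y ^ n \<partial>tilt \<theta>) = lap.G n \<theta> / lap.G 0 \<theta>"
  by (subst integral_tilt) (simp_all add: lap.G_def mult.commute)

lemma prob_space_tilt: "prob_space (tilt \<theta>)"
proof
  have "emeasure (tilt \<theta>) (space (tilt \<theta>)) = (\<integral>\<^sup>+y. ennreal (exp (- (\<theta> * y)) / lap.G 0 \<theta>) \<partial>lam)"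
    unfolding tilt_def by (subst emeasure_density) (auto intro!: nn_integral_cong)
  also have "\<dots> = ennreal (\<integral>y. exp (- (\<theta> * y)) / lap.G 0 \<theta> \<partial>lam)"
    using lap.integrable_G[OF \<theta>, of 0] G0_pos by (intro nn_integral_eq_integral) auto
  also have "(\<integral>y. exp (- (\<theta> * y)) / lap.G 0 \<theta> \<partial>lam) = 1" using G0_pos by (simp add: lap.G_def)
  finally show "emeasure (tilt \<theta>) (space (tilt \<theta>)) = 1" by simp
qed

lemma AE_tilt: "Measurable.pred borel P \<Longrightarrow> (AE y in lam. P y) \<longleftrightarrow> (AE y in tilt \<theta>. P y)"
  unfolding tilt_def using G0_pos by (subst AE_density) auto

text \<open>Tilting keeps the null sets, so zero variance would make the displacements constant,
  which \<open>not_AE_const\<close> excludes. All moments are finite because \<theta> lies above the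
  abscissa 1.\<close>

lemma tilt_centered:
  obtains s m3 where "centered_law (tilt \<theta>) (\<mu> \<theta>) s m3"
proof -
  interpret T: prob_space "tilt \<theta>" by (rule prob_space_tilt)
  let ?\<mu> = "\<mu> \<theta>"
  note i = integrable_tilt_power
  have i1: "integrable (tilt \<theta>) (\<lambda>y. y)" using i[of 1] by simp
  have int2: "integrable (tilt \<theta>) (\<lambda>y. (y - ?\<mu>)\<^sup>2)"
    unfolding power2_diff using i[of 2] i1 by simp
  have int3: "integrable (tilt \<theta>) (\<lambda>y. \<bar>y - ?\<mu>\<bar> ^ 3)"
  proof (rule Bochner_Integration.integrable_bound)
    show "integrable (tilt \<theta>) (\<lambda>y. 4 * (y ^ 3 + ?\<mu> ^ 3))" using i[of 3] by simp
    have "AE y in tilt \<theta>. 0 \<le> y" using lam_nonneg AE_tilt[of "\<lambda>y. 0 \<le> y"] by simp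
    thus "AE y in tilt \<theta>. norm (\<bar>y - ?\<mu>\<bar> ^ 3) \<le> norm (4 * (y ^ 3 + ?\<mu> ^ 3))"
    proof eventually_elim
      case (elim y)
      show ?case using abs_add_cubed_le[of y "- ?\<mu>"] elim mu_pos[OF \<theta>] by simp
    qed
  qed measurable
  have m0: "(\<integral>y. y - ?\<mu> \<partial>tilt \<theta>) = 0"
    using i1 integral_tilt_power[of 1] by (simp add: T.prob_space \<mu>_def)
  define V where "V = (\<integral>y. (y - ?\<mu>)\<^sup>2 \<partial>tilt \<theta>)"
  have "V \<ge> 0" by (simp add: V_def integral_nonneg_AE)
  moreover have "V \<noteq> 0"
  proof
    assume "V = 0"
    hence "AE y in tilt \<theta>. (y - ?\<mu>)\<^sup>2 = 0"
      unfolding V_def by (subst (asm) integral_nonneg_eq_0_iff_AE[OF int2]) auto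
    hence "AE y in tilt \<theta>. y = ?\<mu>" by eventually_elim simp
    thus False using AE_tilt[of "\<lambda>y. y = ?\<mu>"] not_AE_const[of ?\<mu>] by simp
  qed
  ultimately have V: "V > 0" by simp
  have "centered_law (tilt \<theta>) ?\<mu> (sqrt V) (\<integral>y. \<bar>y - ?\<mu>\<bar> ^ 3 \<partial>tilt \<theta>)"
    using int2 int3 i1 m0 V by unfold_locales (auto simp: V_def)
  thus ?thesis by (rule that)
qed

text \<open>One step of the branching recursion for functions of the form \<open>\<epsilon> e\<^sup>-\<^sup>\<theta>\<^sup>x g(x)\<close>:
  the exponential factor turns the intensity of the children into the tilted law.\<close>

lemma tilted_step:
  fixes g g' :: "real \<Rightarrow> real"
  assumes [measurable]: "g \<in> borel_measurable borel" and g: "\<And>x. 0 \<le> g x" "\<And>x. g x \<le> \<gamma>" and \<epsilon>: "\<epsilon> > 0"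
    and x: "x \<ge> 0" and h: "g' x + \<epsilon> * exp (2 * \<theta> * \<mu> \<theta>) * \<gamma>\<^sup>2 \<le> Lam \<theta> * (\<integral>y. g (x + (y - \<mu> \<theta>)) \<partial>tilt \<theta>)"
    and g'0: "g' x \<ge> 0"
  defines "v \<equiv> (\<lambda>z. \<epsilon> * exp (- (\<theta> * z)) * g z)"
  shows "\<exists>r\<ge>0. (\<forall>p\<in>space \<nu>. \<forall>J. (\<Sum>c<J. if measure p {c} > 0 then v (x - ln (measure p {c}) - \<mu> \<theta>) else 0) \<le> r) \<and>
       ennreal (\<epsilon> * exp (- (\<theta> * x)) * g' x + r\<^sup>2)
         \<le> (\<integral>\<^sup>+p. (\<Sum>c. ennreal (if measure p {c} > 0 then v (x - ln (measure p {c}) - \<mu> \<theta>) else 0)) \<partial>\<nu>)"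
proof -
  interpret T: prob_space "tilt \<theta>" by (rule prob_space_tilt)
  let ?\<mu> = "\<mu> \<theta>"
  have \<gamma>: "\<gamma> \<ge> 0" using g[of 0] by linarith
  \<comment> \<open>A child of mass \<open>p\<close> contributes at most
    \<open>r p^\<theta>\<close>, and the sum of \<open>p^\<theta>\<close> is at most 1; hence
    \<open>r\<close> bounds the whole sum over the children.\<close>
  define r where "r = \<epsilon> * exp (- (\<theta> * x)) * exp (\<theta> * ?\<mu>) * \<gamma>"
  have r0: "r \<ge> 0" using \<epsilon> \<gamma> by (simp add: r_def)
  have trm: "v (x - ln (measure p {c}) - ?\<mu>) \<le> r * measure p {c} powr \<theta>" if "measure p {c} > 0" for p c
  proof -
    have "exp (- (\<theta> * (x - ln (measure p {c}) - ?\<mu>))) = exp (- (\<theta> * x)) * exp (\<theta> * ?\<mu>) * measure p {c} powr \<theta>"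
      using that by (simp add: powr_def algebra_simps flip: exp_add)
    hence "v (x - ln (measure p {c}) - ?\<mu>)
      = \<epsilon> * exp (- (\<theta> * x)) * exp (\<theta> * ?\<mu>) * measure p {c} powr \<theta> * g (x - ln (measure p {c}) - ?\<mu>)"
      by (simp add: v_def)
    also have "\<dots> \<le> \<epsilon> * exp (- (\<theta> * x)) * exp (\<theta> * ?\<mu>) * measure p {c} powr \<theta> * \<gamma>"
      using g \<epsilon> by (intro mult_left_mono) auto
    finally show ?thesis by (simp add: r_def mult_ac)
  qed
  have sum_le: "(\<Sum>c<J. if measure p {c} > 0 then v (x - ln (measure p {c}) - ?\<mu>) else 0) \<le> r"
    if p: "p \<in> space \<nu>" for p J
  proof -
    have "(\<Sum>c<J. if measure p {c} > 0 then v (x - ln (measure p {c}) - ?\<mu>) else 0) \<le> (\<Sum>c<J. r * measure p {c} powr \<theta>)"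
      using trm r0 by (intro sum_mono) auto
    also have "\<dots> = r * (\<Sum>c<J. measure p {c} powr \<theta>)" by (simp add: sum_distrib_left)
    also have "\<dots> \<le> r * 1" using sum_mass_powr_le[OF p, of \<theta> J] \<theta> r0 by (intro mult_left_mono) auto
    finally show ?thesis by simp
  qed
  have "(\<integral>\<^sup>+p. (\<Sum>c. ennreal (if measure p {c} > 0 then v (x - ln (measure p {c}) - ?\<mu>) else 0)) \<partial>\<nu>)
     = (\<integral>\<^sup>+y. ennreal (v (x + y - ?\<mu>)) \<partial>lam)"
    by (subst nn_integral_lam) (auto simp: v_def intro!: nn_integral_cong suminf_cong)
  also have "\<dots> = (\<integral>\<^sup>+y. ennreal (exp (- (\<theta> * y)) / lap.G 0 \<theta>) * ennreal (\<epsilon> * exp (- (\<theta> * x)) * Lam \<theta> * g (x + (y - ?\<mu>))) \<partial>lam)"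
  proof (intro nn_integral_cong)
    fix y
    have "v (x + y - ?\<mu>) = (exp (- (\<theta> * y)) / lap.G 0 \<theta>) * (\<epsilon> * exp (- (\<theta> * x)) * Lam \<theta> * g (x + (y - ?\<mu>)))"
      using G0_pos by (simp add: v_def Lam_def algebra_simps flip: exp_add)
    thus "ennreal (v (x + y - ?\<mu>)) = ennreal (exp (- (\<theta> * y)) / lap.G 0 \<theta>) * ennreal (\<epsilon> * exp (- (\<theta> * x)) * Lam \<theta> * g (x + (y - ?\<mu>)))"
      using G0_pos \<epsilon> g by (simp add: ennreal_mult[symmetric] Lam_def)
  qed
  also have "\<dots> = (\<integral>\<^sup>+y. ennreal (\<epsilon> * exp (- (\<theta> * x)) * Lam \<theta> * g (x + (y - ?\<mu>))) \<partial>tilt \<theta>)"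
    unfolding tilt_def by (subst nn_integral_density) auto
  also have "\<dots> = ennreal (\<integral>y. \<epsilon> * exp (- (\<theta> * x)) * Lam \<theta> * g (x + (y - ?\<mu>)) \<partial>tilt \<theta>)"
  proof (rule nn_integral_eq_integral)
    have "integrable (tilt \<theta>) (\<lambda>y. g (x + (y - ?\<mu>)))"
      by (rule T.integrable_const_bound[where B=\<gamma>]) (use g in auto)
    thus "integrable (tilt \<theta>) (\<lambda>y. \<epsilon> * exp (- (\<theta> * x)) * Lam \<theta> * g (x + (y - ?\<mu>)))" by simp
    show "AE y in tilt \<theta>. 0 \<le> \<epsilon> * exp (- (\<theta> * x)) * Lam \<theta> * g (x + (y - ?\<mu>))"
      using \<epsilon> g G0_pos by (auto simp: Lam_def)
  qed
  finally have eq: "(\<integral>\<^sup>+p. (\<Sum>c. ennreal (if measure p {c} > 0 then v (x - ln (measure p {c}) - ?\<mu>) else 0)) \<partial>\<nu>)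
     = ennreal (\<epsilon> * exp (- (\<theta> * x)) * (Lam \<theta> * (\<integral>y. g (x + (y - ?\<mu>)) \<partial>tilt \<theta>)))" by (simp add: mult.assoc)
  \<comment> \<open>The square carries \<open>exp (- 2 \<theta> x)\<close>. As
    \<open>x >= 0\<close>, one of the two factors is bounded by 1, and the other matches the
    exponential prefactor of the profile.\<close>
  have "r\<^sup>2 \<le> \<epsilon> * exp (- (\<theta> * x)) * (\<epsilon> * exp (2 * \<theta> * ?\<mu>) * \<gamma>\<^sup>2)"
  proof -
    have "r\<^sup>2 = \<epsilon> * exp (- (\<theta> * x)) * (\<epsilon> * exp (2 * \<theta> * ?\<mu>) * \<gamma>\<^sup>2) * exp (- (\<theta> * x))"
      by (simp add: r_def power2_eq_square mult_ac flip: exp_add)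
    also have "\<dots> \<le> \<epsilon> * exp (- (\<theta> * x)) * (\<epsilon> * exp (2 * \<theta> * ?\<mu>) * \<gamma>\<^sup>2) * 1"
      using \<epsilon> \<theta> x by (intro mult_left_mono) auto
    finally show ?thesis by simp
  qed
  hence "\<epsilon> * exp (- (\<theta> * x)) * g' x + r\<^sup>2
     \<le> \<epsilon> * exp (- (\<theta> * x)) * (g' x + \<epsilon> * exp (2 * \<theta> * ?\<mu>) * \<gamma>\<^sup>2)"
    by (simp add: distrib_left)
  also have "\<dots> \<le> \<epsilon> * exp (- (\<theta> * x)) * (Lam \<theta> * (\<integral>y. g (x + (y - ?\<mu>)) \<partial>tilt \<theta>))"
    using h \<epsilon> by (intro mult_left_mono) auto
  finally show ?thesis unfolding eq by (intro exI[of _ r] conjI ballI allI r0 sum_le ennreal_leI)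
qed

end

end

section \<open>Lower bounds for the largest box\<close>

lemma bx_take_ge:
  assumes "\<And>i j. measure (e i) {j} \<le> 1"
  shows "bx e i \<le> bx e (take k i)"
proof -
  have b1: "bx f j \<le> 1" if "\<And>i c. measure (f i) {c} \<le> 1" for f j
    unfolding bx_def using that by (intro prod_le_1) auto
  have "bx e i = bx e (take k i) * bx (\<lambda>j. e (take k i @ j)) (drop k i)"
    by (subst bx_append[symmetric]) simp
  also have "\<dots> \<le> bx e (take k i) * 1" using assms by (intro mult_left_mono b1) auto
  finally show ?thesis by simp
qed

text \<open>The union bound as an integral over a counting measure, the form in which
  \<open>many_to_one_powr\<close> applies.\<close>

lemma (in prob_space) emeasure_UN_le_nn_integral:
  fixes X :: "'i :: countable \<Rightarrow> 'a set"
  assumes X: "\<And>i. i \<in> I \<Longrightarrow> X i \<in> sets M"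
  shows "emeasure M (\<Union>i\<in>I. X i) \<le> (\<integral>\<^sup>+i. emeasure M (X i) \<partial>count_space I)"
proof -
  interpret c: sigma_finite_measure "count_space I"
    by (rule sigma_finite_measure_count_space_countable) simp
  interpret P: pair_sigma_finite "count_space I" M ..
  have un: "(\<Union>i\<in>I. X i) \<in> sets M" using X by (intro sets.countable_UN'') auto
  have m: "(\<lambda>z. indicator (X (fst z)) (snd z) :: ennreal) \<in> borel_measurable (count_space I \<Otimes>\<^sub>M M)"
  proof (rule measurable_compose_countable'[where f="\<lambda>i z. indicator (X i) (snd z)" and g=fst and I=I])
    show "(\<lambda>z. indicator (X i) (snd z) :: ennreal) \<in> borel_measurable (count_space I \<Otimes>\<^sub>M M)" if "i \<in> I" for i
      using X[OF that] by measurable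
  qed auto
  have "emeasure M (\<Union>i\<in>I. X i) = (\<integral>\<^sup>+x. indicator (\<Union>i\<in>I. X i) x \<partial>M)" using un by simp
  also have "\<dots> \<le> (\<integral>\<^sup>+x. \<integral>\<^sup>+i. indicator (X i) x \<partial>count_space I \<partial>M)"
  proof (rule nn_integral_mono)
    fix x
    show "indicator (\<Union>i\<in>I. X i) x \<le> (\<integral>\<^sup>+i. indicator (X i) x \<partial>count_space I)"
    proof (cases "x \<in> (\<Union>i\<in>I. X i)")
      case True
      then obtain i where i: "i \<in> I" "x \<in> X i" by blast
      have "1 = (\<integral>\<^sup>+j. indicator {i} j \<partial>count_space I)" using i by (simp add: one_ereal_def)
      also have "\<dots> \<le> (\<integral>\<^sup>+j. indicator (X j) x \<partial>count_space I)"
        using i by (intro nn_integral_mono) (auto simp: indicator_def)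
      finally show ?thesis using True by simp
    qed simp
  qed
  also have "\<dots> = (\<integral>\<^sup>+i. \<integral>\<^sup>+x. indicator (X i) x \<partial>M \<partial>count_space I)"
    using P.Fubini[OF m] by simp
  also have "\<dots> = (\<integral>\<^sup>+i. emeasure M (X i) \<partial>count_space I)"
    using X by (intro nn_integral_cong) simp
  finally show ?thesis .
qed

section \<open>Repeated trials and small boxes\<close>

context mass_law
begin

lemma space_PE_mass: "e \<in> space PE \<Longrightarrow> measure (e i) {j} \<le> 1"
  by (intro mass_le_1) (auto simp: space_PE)

text \<open>The displacements telescope along the line of descent; of all the constraints only the
  last one is kept.\<close>

lemma good_imp_box:
  "good B \<mu> m x e \<Longrightarrow> \<exists>i. length i = m \<and> bx e i > 0 \<and> B 0 (x - ln (bx e i) - real m * \<mu>)"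
proof (induction m arbitrary: x e)
  case (Suc m)
  then obtain c where c: "measure (e []) {c} > 0" "good B \<mu> m (x - ln (measure (e []) {c}) - \<mu>) (subenv e c)" by auto
  from Suc.IH[OF c(2)] obtain i where i: "length i = m" "bx (subenv e c) i > 0"
    "B 0 (x - ln (measure (e []) {c}) - \<mu> - ln (bx (subenv e c) i) - real m * \<mu>)" by blast
  have "ln (bx e (c # i)) = ln (measure (e []) {c}) + ln (bx (subenv e c) i)"
    using c i by (simp add: bx_Cons ln_mult)
  thus ?case using c i by (intro exI[of _ "c # i"]) (auto simp: bx_Cons algebra_simps)
qed auto

text \<open>When the constraint is the same at every level, a line of descent may be cut short. This
  makes the events decreasing in \<open>m\<close> in \<open>supercritical_prob\<close>.\<close>

lemma good_Suc_imp:
  assumes "\<And>m x. B m x \<longleftrightarrow> B 0 x"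
  shows "good B \<mu> (Suc m) x e \<Longrightarrow> good B \<mu> m x e"
proof (induction m arbitrary: x e)
  case 0
  thus ?case using assms[of "Suc 0" x] by simp
next
  case (Suc m)
  from Suc.prems obtain c where c: "measure (e []) {c} > 0" and
    g: "good B \<mu> (Suc m) (x - ln (measure (e []) {c}) - \<mu>) (subenv e c)" and B: "B (Suc (Suc m)) x" by auto
  from Suc.IH[OF g] c show ?case using B assms[of "Suc m"] assms[of "Suc (Suc m)"] by auto
qed

lemma inherit_pow_box:
  "e \<in> (inherit ^^ m) A \<Longrightarrow> \<exists>i. length i = m \<and> bx e i > 0 \<and> (\<lambda>j. e (i @ j)) \<in> A"
proof (induction m arbitrary: e)
  case (Suc m)
  hence "e \<in> inherit ((inherit ^^ m) A)" by simp
  then obtain c where c: "measure (e []) {c} > 0" "subenv e c \<in> (inherit ^^ m) A"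
    by (subst (asm) inherit_def) blast
  from Suc.IH[OF c(2)] obtain i where "length i = m" "bx (subenv e c) i > 0" "(\<lambda>j. subenv e c (i @ j)) \<in> A" by blast
  thus ?case using c by (intro exI[of _ "c # i"]) (auto simp: bx_Cons subenv_def)
qed auto

lemma sets_inherit_pow [measurable]: "A \<in> sets PE \<Longrightarrow> (inherit ^^ m) A \<in> sets PE"
  by (induction m) auto

text \<open>The odds \<open>q / (1 - q)\<close> of failure shrink by the factor \<open>1 + p\<close> in each generation.\<close>

lemma logistic_step:
  fixes p q q' :: real
  assumes "0 \<le> p" "0 \<le> q" "q < 1" "q' \<le> (1 - p) * q + p * q\<^sup>2"
  shows "(1 + p) * q' * (1 - q) \<le> q * (1 - q')" "q' < 1"
proof -
  have a: "(1 - q) * (1 + p * q) \<le> 1 - q'" using assms(4) by (simp add: algebra_simps power2_eq_square)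
  have "0 < (1 - q) * (1 + p * q)" using assms by (intro mult_pos_pos) (auto simp: add_pos_nonneg)
  thus "q' < 1" using a by linarith
  have "q' \<le> q * (1 - p * (1 - q))" using assms(4) by (simp add: algebra_simps power2_eq_square)
  hence "((1 + p) * (1 - q)) * q' \<le> ((1 + p) * (1 - q)) * (q * (1 - p * (1 - q)))"
    using assms by (intro mult_left_mono) auto
  also have "\<dots> = q * ((1 - q) * (1 + p * q)) - q * (1 - q) * (p * p * (1 - q))"
    by (simp add: algebra_simps)
  also have "\<dots> \<le> q * ((1 - q) * (1 + p * q))" using assms by simp
  also have "\<dots> \<le> q * (1 - q')" using a assms by (intro mult_left_mono) auto
  finally show "(1 + p) * q' * (1 - q) \<le> q * (1 - q')" by (simp add: mult_ac)
qed

lemma split_prob_01: "0 \<le> split_prob" "split_prob \<le> 1"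
  by (auto simp: split_prob_def)

text \<open>The odds bound is carried through the induction as the product inequality
  \<open>(1 + split_prob)^m q u <= 1 - q\<close>, which avoids dividing by \<open>1 - q\<close>. It
  starts from \<open>q u <= u <= measure PE A\<close>.\<close>

lemma fail_inherit_pow_le:
  assumes A: "A \<in> sets PE" and u: "0 < u" "u \<le> measure PE A"
  shows "1 - measure PE ((inherit ^^ m) A) \<le> 1 / ((1 + split_prob) ^ m * u)"
proof -
  define q where "q m = 1 - measure PE ((inherit ^^ m) A)" for m
  note p = split_prob_01
  have "0 \<le> q m \<and> q m < 1 \<and> (1 + split_prob) ^ m * q m * u \<le> 1 - q m"
  proof (induction m)
    case 0
    have "u \<le> 1" using u PE.prob_le_1[of A] by linarith
    have "q 0 * u \<le> 1 * u" using u by (intro mult_right_mono) (auto simp: q_def)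
    hence "q 0 * u \<le> measure PE A" using u by linarith
    thus ?case using u by (simp add: q_def)
  next
    case (Suc m)
    have q0: "0 \<le> q (Suc m)" by (simp add: q_def)
    have le: "q (Suc m) \<le> (1 - split_prob) * q m + split_prob * (q m)\<^sup>2"
      unfolding q_def using fail_inherit_le[OF sets_inherit_pow[OF A, of m]] by simp
    note L = logistic_step[OF p(1) _ _ le]
    have "((1 + split_prob) ^ Suc m * q (Suc m) * u) * (1 - q m)
       = (1 + split_prob) ^ m * u * ((1 + split_prob) * q (Suc m) * (1 - q m))" by simp
    also have "\<dots> \<le> (1 + split_prob) ^ m * u * (q m * (1 - q (Suc m)))"
      using L(1) Suc p u by (intro mult_left_mono) auto
    also have "\<dots> = ((1 + split_prob) ^ m * q m * u) * (1 - q (Suc m))" by simp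
    also have "\<dots> \<le> (1 - q m) * (1 - q (Suc m))"
      using Suc L(2) by (intro mult_right_mono) auto
    finally have "(1 + split_prob) ^ Suc m * q (Suc m) * u \<le> 1 - q (Suc m)"
      using Suc by (simp add: mult.commute[of "1 - q m"] mult_le_cancel_right del: power_Suc)
    thus ?case using q0 L(2) Suc by blast
  qed
  hence "0 \<le> q m" "(1 + split_prob) ^ m * q m * u \<le> 1 - q m" by auto
  hence "q m * ((1 + split_prob) ^ m * u) \<le> 1" by (simp add: mult_ac)
  thus ?thesis using u p unfolding q_def by (simp add: pos_le_divide_eq add_pos_nonneg)
qed

text \<open>Markov's inequality with the negative exponent \<open>- \<delta>\<close>, summed over
  the generation.\<close>

lemma prob_small_box_le:
  assumes \<delta>: "\<delta> > 0" and z: "z > 0"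
  shows "emeasure PE {e \<in> space PE. \<exists>i. length i = m \<and> 0 < bx e i \<and> bx e i < z} \<le> ennreal (z powr \<delta>) * L_fun \<nu> (- \<delta>) ^ m"
proof -
  define S where "S i = {e \<in> space PE. 0 < bx e i \<and> bx e i < z}" for i
  have S: "S i \<in> sets PE" for i unfolding S_def by measurable
  have "emeasure PE {e \<in> space PE. \<exists>i. length i = m \<and> 0 < bx e i \<and> bx e i < z} = emeasure PE (\<Union>i\<in>{i. length i = m}. S i)"
    by (intro arg_cong[where f="emeasure PE"]) (auto simp: S_def)
  also have "\<dots> \<le> (\<integral>\<^sup>+i. emeasure PE (S i) \<partial>count_space {i. length i = m})"
    using S by (intro PE.emeasure_UN_le_nn_integral) auto
  also have "\<dots> \<le> (\<integral>\<^sup>+i. ennreal (z powr \<delta>) * (\<integral>\<^sup>+e. ennreal (bx e i powr (- \<delta>)) \<partial>PE) \<partial>count_space {i. length i = m})"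
  proof (rule nn_integral_mono)
    fix i
    have "emeasure PE (S i) = (\<integral>\<^sup>+e. indicator (S i) e \<partial>PE)" using S by simp
    also have "\<dots> \<le> (\<integral>\<^sup>+e. ennreal (z powr \<delta>) * ennreal (bx e i powr (- \<delta>)) \<partial>PE)"
    proof (rule nn_integral_mono)
      fix e
      show "indicator (S i) e \<le> ennreal (z powr \<delta>) * ennreal (bx e i powr (- \<delta>))"
      proof (cases "e \<in> S i")
        case True
        hence b: "0 < bx e i" "bx e i < z" by (auto simp: S_def)
        have "bx e i powr \<delta> \<le> z powr \<delta>" using b \<delta> by (intro powr_mono2) auto
        hence "1 \<le> z powr \<delta> * bx e i powr (- \<delta>)"
          using b by (simp add: powr_minus field_simps)
        thus ?thesis using True by (simp add: ennreal_mult[symmetric] ennreal_leI flip: ennreal_1)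
      qed simp
    qed
    also have "\<dots> = ennreal (z powr \<delta>) * (\<integral>\<^sup>+e. ennreal (bx e i powr (- \<delta>)) \<partial>PE)"
      by (rule nn_integral_cmult) measurable
    finally show "emeasure PE (S i) \<le> ennreal (z powr \<delta>) * (\<integral>\<^sup>+e. ennreal (bx e i powr (- \<delta>)) \<partial>PE)" .
  qed
  also have "\<dots> = ennreal (z powr \<delta>) * L_fun \<nu> (- \<delta>) ^ m"
    by (subst nn_integral_cmult) (simp_all add: many_to_one_powr)
  finally show ?thesis .
qed

end

section \<open>Large boxes in the critical and supercritical cases\<close>

context nongeom_law
begin

text \<open>Otherwise almost every \<open>p\<close> has a single atom, of mass 1, and all
  displacements vanish, contradicting \<open>not_AE_const\<close>.\<close>

lemma split_prob_pos: "split_prob > 0"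
proof (rule ccontr)
  assume "\<not> split_prob > 0"
  hence z: "split_prob = 0" using split_prob_01 by linarith
  define S where "S = {p \<in> space \<nu>. \<exists>c d. c \<noteq> d \<and> measure p {c} > 0 \<and> measure p {d} > 0}"
  have S: "S \<in> sets \<nu>" unfolding S_def by measurable
  have "AE p in \<nu>. p \<notin> S"
    using z S by (intro AE_not_in) (auto simp: null_sets_def nu.emeasure_eq_measure S_def[symmetric] split_prob_def)
  hence "AE p in \<nu>. \<forall>j. measure p {j} > 0 \<longrightarrow> - ln (measure p {j}) = 0"
    using AE_space
  proof eventually_elim
    case (elim p)
    show ?case
    proof (intro allI impI)
      fix j assume j: "measure p {j} > 0"
      have "measure p {c} = 0" if "c \<noteq> j" for c
        using elim j that by (auto simp: S_def zero_less_measure_iff)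
      hence "(\<Sum>c. measure p {c}) = (\<Sum>c\<in>{j}. measure p {c})" by (intro suminf_finite) auto
      hence "measure p {j} = 1" using mass_sums[OF elim(2)] by (simp add: sums_iff)
      thus "- ln (measure p {j}) = 0" by simp
    qed
  qed
  hence "AE y in lam. y = 0" by (subst AE_lam) auto
  thus False using not_AE_const by blast
qed

lemma box_of_slack:
  assumes "bx e i > 0" "x - ln (bx e i) - y \<le> a"
  shows "exp (- y + x - a) \<le> bx e i"
proof -
  have "- y + x - a \<le> ln (bx e i)" using assms(2) by linarith
  hence "exp (- y + x - a) \<le> exp (ln (bx e i))" by simp
  thus ?thesis using assms(1) by simp
qed

text \<open>The exponent is 101 = 100 + 1: the prefactor of the profile gives
  \<open>t^(-100)\<close>, and the small value of the bump near its left zero costs at most one more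
  power of \<open>t\<close>.\<close>

lemma critical_prob:
  assumes \<theta>: "\<theta> > 1" and L1: "Lam \<theta> \<ge> 1"
  obtains a c where "a \<ge> 0" "c > 0" "\<And>m. c / (real m + 1) ^ 101
    \<le> measure PE {e \<in> space PE. \<exists>i. length i = m \<and> bx e i \<ge> exp (- (real m * \<mu> \<theta>) - a)}"
proof -
  obtain s m3 where "centered_law (tilt \<theta>) (\<mu> \<theta>) s m3" by (rule tilt_centered[OF \<theta>])
  then interpret T: centered_law "tilt \<theta>" "\<mu> \<theta>" s m3 .
  note s = T.s_pos
  define b where "b = 2 / s\<^sup>2"
  have b: "b > 0" using s by (simp add: b_def)
  obtain t1 where t1: "t1 \<ge> 1" "\<And>t x. t \<ge> t1 \<Longrightarrow> bump b s (x / sqrt (t + 1)) > 0 \<Longrightarrow>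
    (\<integral>z. bump b s ((x + (z - \<mu> \<theta>)) / sqrt t) \<partial>tilt \<theta>)
      \<ge> (t / (t + 1)) ^ 100 * bump b s (x / sqrt (t + 1)) + exp (- 2) / (2 * t)"
    using T.critical_step unfolding b_def by blast
  \<comment> \<open>The bound \<open>1 / s^2\<close> puts \<open>1 / sqrt t\<close> to the left of
    the centre \<open>s\<close>, as \<open>bump_lower\<close> requires.\<close>
  define t0 where "t0 = max t1 (1 / s\<^sup>2)"
  have t0: "t0 \<ge> 1" "t0 \<ge> t1" "t0 \<ge> 1 / s\<^sup>2" using t1 by (auto simp: t0_def)
  define g where "g m x = (1 / (real m + t0)) ^ 100 * max 0 (bump b s (x / sqrt (real m + t0)))" for m x
  \<comment> \<open>With this amplitude the quadratic error is \<open>exp (- 2) / 2\<close> times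
    \<open>t^(-200)\<close>, which the surplus of \<open>critical_step\<close> covers; see
    \<open>e2\<close>.\<close>
  define \<epsilon> where "\<epsilon> = exp (- 2) / 2 * exp (- (2 * \<theta> * \<mu> \<theta>))"
  define v where "v m x = \<epsilon> * exp (- (\<theta> * x)) * g m x" for m x
  define a where "a = 2 * s * sqrt t0"
  \<comment> \<open>Only the end point is constrained: \<open>a\<close> is the right zero of the
    profile at \<open>m = 0\<close>, and \<open>x <= a\<close> there means that the box is not too
    small.\<close>
  define B where "B m x \<longleftrightarrow> (m = 0 \<longrightarrow> x \<le> a)" for m :: nat and x :: real
  have \<epsilon>: "0 < \<epsilon>" "\<epsilon> \<le> 1"
  proof -
    show "0 < \<epsilon>" by (simp add: \<epsilon>_def)
    have "\<epsilon> \<le> 1 / 2 * 1" unfolding \<epsilon>_def using \<theta> mu_pos[OF \<theta>] by (intro mult_mono) auto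
    thus "\<epsilon> \<le> 1" by simp
  qed
  have tm: "real m + t0 \<ge> 1" "real m + t0 \<ge> t1" for m using t0 by auto
  have g0: "g m x \<ge> 0" for m x using tm[of m] by (simp add: g_def)
  have gle: "g m x \<le> (1 / (real m + t0)) ^ 100" for m x
  proof -
    have "g m x \<le> (1 / (real m + t0)) ^ 100 * 1"
      unfolding g_def using tm[of m] bump_le_1[OF b] by (intro mult_left_mono) auto
    thus ?thesis by simp
  qed
  have g1: "g m x \<le> 1" for m x
    using gle[of m x] tm[of m] power_le_one[of "1 / (real m + t0)" 100] by simp
  have gpos: "0 < x \<and> x < 2 * s * sqrt (real m + t0)" if "v m x > 0" for m x
  proof -
    have "max 0 (bump b s (x / sqrt (real m + t0))) \<noteq> 0"
      using that by (auto simp: v_def g_def)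
    hence "bump b s (x / sqrt (real m + t0)) > 0" by (auto simp: max_def split: if_splits)
    thus ?thesis using bump_pos_iff[OF b s] tm[of m] by (auto simp: field_simps)
  qed
  have gm [measurable]: "g m \<in> borel_measurable borel" for m unfolding g_def by measurable
  have main: "v m x \<le> measure PE {e \<in> space PE. good B (\<mu> \<theta>) m x e}" for m x
  proof (rule subsolution_le_prob_good)
    show "Measurable.pred borel (B m)" for m unfolding B_def by measurable
    show "v m \<in> borel_measurable borel" for m unfolding v_def by measurable
    show "0 \<le> v m x" for m x using g0 \<epsilon> by (simp add: v_def)
    show "v m x \<le> 1" for m x
    proof (cases "v m x > 0")
      case True
      hence x: "0 < x" using gpos by blast
      have "v m x \<le> 1 * 1 * 1"
        unfolding v_def using g0 g1 \<epsilon> x \<theta> by (intro mult_mono) auto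
      thus ?thesis by simp
    qed simp
    show "B m x" if "0 < v m x" for m x using gpos[OF that] by (auto simp: B_def a_def)
  next
    fix m x assume pos: "0 < v (Suc m) x"
    define t where "t = real m + t0"
    have t: "t \<ge> 1" "t \<ge> t1" using tm[of m] by (auto simp: t_def)
    have x0: "x > 0" using gpos[OF pos] by blast
    have St: "real (Suc m) + t0 = t + 1" by (simp add: t_def)
    have bp: "bump b s (x / sqrt (t + 1)) > 0"
    proof -
      have "v (Suc m) x = \<epsilon> * exp (- (\<theta> * x)) * ((1 / (t + 1)) ^ 100 * max 0 (bump b s (x / sqrt (t + 1))))"
        by (simp only: v_def g_def St)
      hence "max 0 (bump b s (x / sqrt (t + 1))) \<noteq> 0" using pos by auto
      thus ?thesis by (auto simp: max_def split: if_splits)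
    qed
    have int: "integrable (tilt \<theta>) (\<lambda>y. bump b s ((x + (y - \<mu> \<theta>)) / sqrt t))"
    proof -
      have "(x + (y - \<mu> \<theta>)) / sqrt t = x / sqrt t + 1 / sqrt t * (y - \<mu> \<theta>)" for y
        by (subst add_divide_distrib) simp
      thus ?thesis using T.integrable_bump[OF b, of s "x / sqrt t" "1 / sqrt t"] by simp
    qed
    define I where "I = (\<integral>y. g m (x + (y - \<mu> \<theta>)) \<partial>tilt \<theta>)"
    \<comment> \<open>Passing to the positive part can only increase the expectation, while at
      \<open>x\<close> itself the bump is positive by \<open>bp\<close> and agrees with its positive
      part.\<close>
    have I1: "(1 / t) ^ 100 * (\<integral>y. bump b s ((x + (y - \<mu> \<theta>)) / sqrt t) \<partial>tilt \<theta>) \<le> I"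
    proof -
      have "(1 / t) ^ 100 * (\<integral>y. bump b s ((x + (y - \<mu> \<theta>)) / sqrt t) \<partial>tilt \<theta>)
         = (\<integral>y. (1 / t) ^ 100 * bump b s ((x + (y - \<mu> \<theta>)) / sqrt t) \<partial>tilt \<theta>)" by simp
      also have "\<dots> \<le> I"
        unfolding I_def
      proof (rule integral_mono)
        show "integrable (tilt \<theta>) (\<lambda>y. (1 / t) ^ 100 * bump b s ((x + (y - \<mu> \<theta>)) / sqrt t))" using int by simp
        show "integrable (tilt \<theta>) (\<lambda>y. g m (x + (y - \<mu> \<theta>)))"
          by (rule T.integrable_const_bound[where B=1]) (use g0 g1 in auto)
        show "(1 / t) ^ 100 * bump b s ((x + (y - \<mu> \<theta>)) / sqrt t) \<le> g m (x + (y - \<mu> \<theta>))" for y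
          unfolding g_def t_def[symmetric] using t by (intro mult_left_mono) auto
      qed
      finally show ?thesis .
    qed
    have "(1 / t) ^ 100 * ((t / (t + 1)) ^ 100 * bump b s (x / sqrt (t + 1)) + exp (- 2) / (2 * t))
        \<le> (1 / t) ^ 100 * (\<integral>y. bump b s ((x + (y - \<mu> \<theta>)) / sqrt t) \<partial>tilt \<theta>)"
      using t1(2)[OF t(2) bp] t by (intro mult_left_mono) auto
    also note I1
    also have "I \<le> Lam \<theta> * I"
    proof -
      have "I \<ge> 0" unfolding I_def by (rule integral_nonneg_AE) (simp add: g0)
      thus ?thesis using L1 mult_right_mono[OF L1, of I] by simp
    qed
    finally have I2: "(1 / t) ^ 100 * ((t / (t + 1)) ^ 100 * bump b s (x / sqrt (t + 1))) + (1 / t) ^ 100 * (exp (- 2) / (2 * t)) \<le> Lam \<theta> * I"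
      by (simp only: distrib_left)
    \<comment> \<open>The factor in \<open>critical_step\<close> exactly converts the prefactor at
      time \<open>t\<close> into the one at time \<open>t + 1\<close>.\<close>
    have e1: "(1 / t) ^ 100 * ((t / (t + 1)) ^ 100 * bump b s (x / sqrt (t + 1))) = g (Suc m) x"
    proof -
      have "(1 / t) ^ 100 * (t / (t + 1)) ^ 100 = (1 / (t + 1)) ^ 100"
        using t by (simp flip: power_mult_distrib)
      thus ?thesis using bp unfolding g_def St by (simp add: mult.assoc[symmetric])
    qed
    have e2: "\<epsilon> * exp (2 * \<theta> * \<mu> \<theta>) * ((1 / t) ^ 100)\<^sup>2 \<le> (1 / t) ^ 100 * (exp (- 2) / (2 * t))"
    proof -
      have "\<epsilon> * exp (2 * \<theta> * \<mu> \<theta>) = exp (- 2) / 2" by (simp add: \<epsilon>_def mult.assoc flip: exp_add)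
      hence "\<epsilon> * exp (2 * \<theta> * \<mu> \<theta>) * ((1 / t) ^ 100)\<^sup>2 = exp (- 2) / 2 * (1 / t) ^ 200"
        by (simp flip: power_mult)
      also have "\<dots> \<le> exp (- 2) / 2 * (1 / t) ^ 101"
        using t by (intro mult_left_mono power_decreasing) auto
      also have "\<dots> = (1 / t) ^ 100 * (exp (- 2) / (2 * t))"
      proof -
        have "(1 / t) ^ 101 = (1 / t) ^ 100 * (1 / t)" using power_add[of "1 / t" 100 1] by simp
        thus ?thesis by simp
      qed
      finally show ?thesis .
    qed
    have "\<exists>r\<ge>0. (\<forall>p\<in>space \<nu>. \<forall>J. (\<Sum>c<J. if measure p {c} > 0 then
          \<epsilon> * exp (- (\<theta> * (x - ln (measure p {c}) - \<mu> \<theta>))) * g m (x - ln (measure p {c}) - \<mu> \<theta>) else 0) \<le> r) \<and>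
       ennreal (\<epsilon> * exp (- (\<theta> * x)) * g (Suc m) x + r\<^sup>2)
         \<le> (\<integral>\<^sup>+p. (\<Sum>c. ennreal (if measure p {c} > 0 then
          \<epsilon> * exp (- (\<theta> * (x - ln (measure p {c}) - \<mu> \<theta>))) * g m (x - ln (measure p {c}) - \<mu> \<theta>) else 0)) \<partial>\<nu>)"
    proof (rule tilted_step[OF \<theta>])
      show "g m x \<le> (1 / t) ^ 100" for x using gle[of m x] by (simp add: t_def)
      show "g (Suc m) x + \<epsilon> * exp (2 * \<theta> * \<mu> \<theta>) * ((1 / t) ^ 100)\<^sup>2 \<le> Lam \<theta> * (\<integral>y. g m (x + (y - \<mu> \<theta>)) \<partial>tilt \<theta>)"
        using I2 e1 e2 unfolding I_def by linarith
    qed (use x0 g0 \<epsilon> in auto)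
    thus "\<exists>r\<ge>0. (\<forall>p\<in>space \<nu>. \<forall>J. (\<Sum>c<J. if measure p {c} > 0 then v m (x - ln (measure p {c}) - \<mu> \<theta>) else 0) \<le> r) \<and>
       ennreal (v (Suc m) x + r\<^sup>2) \<le> (\<integral>\<^sup>+p. (\<Sum>c. ennreal (if measure p {c} > 0 then v m (x - ln (measure p {c}) - \<mu> \<theta>) else 0)) \<partial>\<nu>)"
      unfolding v_def .
  qed
  define c1 where "c1 = \<epsilon> * exp (- \<theta>) * (exp (- b * s\<^sup>2) * (b * s))"
  define c where "c = c1 / t0 ^ 101"
  have c1: "c1 > 0" using \<epsilon> b s by (simp add: c1_def)
  \<comment> \<open>At the fixed starting point 1 the rescaled variable is
    \<open>1 / sqrt t\<close>, where the bump is only linear; \<open>1 / sqrt t\<close> is weakened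
    to \<open>1 / t\<close> to obtain an integer power.\<close>
  have lower: "c / (real m + 1) ^ 101 \<le> v m 1" for m
  proof -
    define t where "t = real m + t0"
    have t: "t \<ge> 1" "t \<ge> 1 / s\<^sup>2" using t0 by (auto simp: t_def)
    have ts: "1 / sqrt t \<le> s"
    proof -
      have "1 / s = sqrt (1 / s\<^sup>2)" using s by (simp add: real_sqrt_divide)
      also have "\<dots> \<le> sqrt t" using t by (simp only: real_sqrt_le_iff)
      finally show ?thesis using t s by (simp add: field_simps)
    qed
    have "1 / t \<le> 1 / sqrt t" using t by (intro divide_left_mono real_le_lsqrt self_le_power) auto
    hence "exp (- b * s\<^sup>2) * (b * s * (1 / t)) \<le> exp (- b * s\<^sup>2) * (b * s * (1 / sqrt t))"
      using b s by (intro mult_left_mono) auto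
    also have "\<dots> \<le> bump b s (1 / sqrt t)" by (rule bump_lower[OF b _ ts]) (use t in auto)
    also have "\<dots> \<le> max 0 (bump b s (1 / sqrt t))" by simp
    finally have "\<epsilon> * exp (- \<theta>) * ((1 / t) ^ 100 * (exp (- b * s\<^sup>2) * (b * s * (1 / t)))) \<le> v m 1"
      unfolding v_def g_def t_def[symmetric] mult_1_right using \<epsilon> t by (intro mult_left_mono) auto
    moreover have "\<epsilon> * exp (- \<theta>) * ((1 / t) ^ 100 * (exp (- b * s\<^sup>2) * (b * s * (1 / t)))) = c1 * (1 / t) ^ 101"
    proof -
      have "(1 / t) ^ 101 = (1 / t) ^ 100 * (1 / t)" using power_add[of "1 / t" 100 1] by simp
      thus ?thesis by (simp add: c1_def)
    qed
    moreover have "c / (real m + 1) ^ 101 \<le> c1 * (1 / t) ^ 101"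
    proof -
      have "t \<le> t0 * (real m + 1)" using mult_right_mono[OF t0(1), of "real m"] by (simp add: t_def algebra_simps)
      hence "t ^ 101 \<le> (t0 * (real m + 1)) ^ 101" using t by (intro power_mono) auto
      hence "c1 / (t0 * (real m + 1)) ^ 101 \<le> c1 / t ^ 101" using c1 t t0 by (intro divide_left_mono) auto
      thus ?thesis by (simp add: c_def power_mult_distrib power_divide)
    qed
    ultimately show ?thesis by linarith
  qed
  show ?thesis
  proof (rule that)
    show "a \<ge> 0" using s t0 by (simp add: a_def)
    show "c > 0" using c1 t0 by (simp add: c_def)
    fix m
    have "v m 1 \<le> measure PE {e \<in> space PE. good B (\<mu> \<theta>) m 1 e}" by (rule main)
    also have "\<dots> \<le> measure PE {e \<in> space PE. \<exists>i. length i = m \<and> bx e i \<ge> exp (- (real m * \<mu> \<theta>) - a)}"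
    proof (rule PE.finite_measure_mono)
      show "{e \<in> space PE. \<exists>i. length i = m \<and> bx e i \<ge> exp (- (real m * \<mu> \<theta>) - a)} \<in> PE.events" by measurable
      show "{e \<in> space PE. good B (\<mu> \<theta>) m 1 e} \<subseteq> {e \<in> space PE. \<exists>i. length i = m \<and> bx e i \<ge> exp (- (real m * \<mu> \<theta>) - a)}"
      proof clarify
        fix e assume "good B (\<mu> \<theta>) m 1 e"
        from good_imp_box[OF this] obtain i where i: "length i = m" "bx e i > 0" "1 - ln (bx e i) - real m * \<mu> \<theta> \<le> a"
          by (auto simp: B_def)
        have "exp (- (real m * \<mu> \<theta>) - a) \<le> exp (- (real m * \<mu> \<theta>) + 1 - a)" by simp
        also have "\<dots> \<le> bx e i" by (rule box_of_slack[OF i(2,3)])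
        finally show "\<exists>i. length i = m \<and> bx e i \<ge> exp (- (real m * \<mu> \<theta>) - a)" using i by blast
      qed
    qed
    finally show "c / (real m + 1) ^ 101
      \<le> measure PE {e \<in> space PE. \<exists>i. length i = m \<and> bx e i \<ge> exp (- (real m * \<mu> \<theta>) - a)}"
      using lower[of m] by linarith
  qed
qed

text \<open>The subsolution is stationary, so the bound \<open>v 0 x0\<close> is the same for all
  \<open>m\<close> and survives the limit along the decreasing events \<open>E m\<close>. The
  starting point \<open>x0 = s R\<close> is the centre of the bump.\<close>

lemma supercritical_prob:
  assumes \<theta>: "\<theta> > 1" and L1: "Lam \<theta> > 1"
  obtains a where "0 < measure PE {e \<in> space PE. \<forall>m. \<exists>i. length i = m \<and> bx e i \<ge> exp (- (real m * \<mu> \<theta>) - a)}"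
proof -
  obtain s m3 where "centered_law (tilt \<theta>) (\<mu> \<theta>) s m3" by (rule tilt_centered[OF \<theta>])
  then interpret T: centered_law "tilt \<theta>" "\<mu> \<theta>" s m3 .
  note s = T.s_pos
  define b where "b = 2 / s\<^sup>2"
  have b: "b > 0" using s by (simp add: b_def)
  obtain R \<kappa> where R: "R > 0" "\<kappa> > 0" "\<And>x. bump b s (x / R) > 0 \<Longrightarrow>
    Lam \<theta> * (\<integral>z. bump b s ((x + (z - \<mu> \<theta>)) / R) \<partial>tilt \<theta>) \<ge> bump b s (x / R) + \<kappa>"
    using T.supercritical_step[OF L1] unfolding b_def by blast
  define g where "g x = max 0 (bump b s (x / R))" for x
  \<comment> \<open>This makes the quadratic error at most \<kappa>, with the bound 1 on the
    profile; see \<open>e2\<close>. The minimum with 1 keeps \<open>v\<close> at most 1.\<close>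
  define \<epsilon> where "\<epsilon> = min 1 \<kappa> * exp (- (2 * \<theta> * \<mu> \<theta>))"
  define v where "v m x = \<epsilon> * exp (- (\<theta> * x)) * g x" for m :: nat and x
  define a where "a = 2 * s * R"
  define B where "B m x \<longleftrightarrow> x \<le> a" for m :: nat and x :: real
  have \<epsilon>: "0 < \<epsilon>" "\<epsilon> \<le> 1"
  proof -
    show "0 < \<epsilon>" using R by (simp add: \<epsilon>_def)
    have "\<epsilon> \<le> 1 * 1" unfolding \<epsilon>_def using R \<theta> mu_pos[OF \<theta>] by (intro mult_mono) auto
    thus "\<epsilon> \<le> 1" by simp
  qed
  have g0: "g x \<ge> 0" "g x \<le> 1" for x using bump_le_1[OF b] by (auto simp: g_def)
  have bpos: "bump b s (x / R) > 0" if "v m x > 0" for m x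
  proof -
    have "max 0 (bump b s (x / R)) \<noteq> 0" using that by (auto simp: v_def g_def)
    thus ?thesis by (auto simp: max_def split: if_splits)
  qed
  have gpos: "0 < x \<and> x < a" if "v m x > 0" for m x
    using bpos[OF that] bump_pos_iff[OF b s] R by (auto simp: field_simps a_def)
  have gm [measurable]: "g \<in> borel_measurable borel" unfolding g_def by measurable
  have Bm [measurable]: "Measurable.pred borel (B m)" for m unfolding B_def by measurable
  have main: "v m x \<le> measure PE {e \<in> space PE. good B (\<mu> \<theta>) m x e}" for m x
  proof (rule subsolution_le_prob_good)
    show "v m \<in> borel_measurable borel" for m unfolding v_def by measurable
    show "0 \<le> v m x" for m x using g0 \<epsilon> by (simp add: v_def)
    show "v m x \<le> 1" for m x
    proof (cases "v m x > 0")
      case True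
      hence x: "0 < x" using gpos by blast
      have "v m x \<le> 1 * 1 * 1"
        unfolding v_def using g0 \<epsilon> x \<theta> by (intro mult_mono) auto
      thus ?thesis by simp
    qed simp
    show "B m x" if "0 < v m x" for m x using gpos[OF that] by (auto simp: B_def)
  next
    fix m x assume pos: "0 < v (Suc m) x"
    have x0: "x > 0" using gpos[OF pos] by blast
    have bp: "bump b s (x / R) > 0" by (rule bpos[OF pos])
    have int: "integrable (tilt \<theta>) (\<lambda>y. bump b s ((x + (y - \<mu> \<theta>)) / R))"
    proof -
      have "(x + (y - \<mu> \<theta>)) / R = x / R + 1 / R * (y - \<mu> \<theta>)" for y
        by (subst add_divide_distrib) simp
      thus ?thesis using T.integrable_bump[OF b, of s "x / R" "1 / R"] by simp
    qed
    define I where "I = (\<integral>y. g (x + (y - \<mu> \<theta>)) \<partial>tilt \<theta>)"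
    have "(\<integral>y. bump b s ((x + (y - \<mu> \<theta>)) / R) \<partial>tilt \<theta>) \<le> I"
      unfolding I_def
    proof (rule integral_mono[OF int])
      show "integrable (tilt \<theta>) (\<lambda>y. g (x + (y - \<mu> \<theta>)))"
        by (rule T.integrable_const_bound[where B=1]) (use g0 in auto)
    qed (simp add: g_def)
    hence "Lam \<theta> * (\<integral>y. bump b s ((x + (y - \<mu> \<theta>)) / R) \<partial>tilt \<theta>) \<le> Lam \<theta> * I"
      using L1 by (intro mult_left_mono) auto
    hence I2: "g x + \<kappa> \<le> Lam \<theta> * I" using R(3)[OF bp] bp by (simp add: g_def)
    have e2: "\<epsilon> * exp (2 * \<theta> * \<mu> \<theta>) * 1\<^sup>2 \<le> \<kappa>" by (simp add: \<epsilon>_def mult.assoc flip: exp_add)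
    have "\<exists>r\<ge>0. (\<forall>p\<in>space \<nu>. \<forall>J. (\<Sum>c<J. if measure p {c} > 0 then
          \<epsilon> * exp (- (\<theta> * (x - ln (measure p {c}) - \<mu> \<theta>))) * g (x - ln (measure p {c}) - \<mu> \<theta>) else 0) \<le> r) \<and>
       ennreal (\<epsilon> * exp (- (\<theta> * x)) * g x + r\<^sup>2)
         \<le> (\<integral>\<^sup>+p. (\<Sum>c. ennreal (if measure p {c} > 0 then
          \<epsilon> * exp (- (\<theta> * (x - ln (measure p {c}) - \<mu> \<theta>))) * g (x - ln (measure p {c}) - \<mu> \<theta>) else 0)) \<partial>\<nu>)"
    proof (rule tilted_step[OF \<theta>])
      show "g x + \<epsilon> * exp (2 * \<theta> * \<mu> \<theta>) * 1\<^sup>2 \<le> Lam \<theta> * (\<integral>y. g (x + (y - \<mu> \<theta>)) \<partial>tilt \<theta>)"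
        using I2 e2 unfolding I_def by linarith
    qed (use x0 g0 \<epsilon> in auto)
    thus "\<exists>r\<ge>0. (\<forall>p\<in>space \<nu>. \<forall>J. (\<Sum>c<J. if measure p {c} > 0 then v m (x - ln (measure p {c}) - \<mu> \<theta>) else 0) \<le> r) \<and>
       ennreal (v (Suc m) x + r\<^sup>2) \<le> (\<integral>\<^sup>+p. (\<Sum>c. ennreal (if measure p {c} > 0 then v m (x - ln (measure p {c}) - \<mu> \<theta>) else 0)) \<partial>\<nu>)"
      unfolding v_def .
  qed (rule Bm)
  define x0 where "x0 = s * R"
  have vx0: "v 0 x0 > 0"
  proof -
    have "bump b s (x0 / R) > 0" using bump_pos_iff[OF b s, of "x0 / R"] R s by (simp add: x0_def)
    thus ?thesis using \<epsilon> by (simp add: v_def g_def)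
  qed
  define E where "E m = {e \<in> space PE. good B (\<mu> \<theta>) m x0 e}" for m
  have E: "E m \<in> sets PE" for m
    unfolding E_def using measurable_good[where f="\<lambda>_. x0" and N=PE and g="\<lambda>e. e" and B=B and m=m and \<mu>="\<mu> \<theta>", OF Bm] by simp
  have "decseq E"
    unfolding E_def by (intro decseq_SucI) (auto intro: good_Suc_imp[of B] simp: B_def simp del: good.simps)
  from PE.finite_Lim_measure_decseq[OF _ this] E
  have "(\<lambda>m. measure PE (E m)) \<longlonglongrightarrow> measure PE (\<Inter>m. E m)" by blast
  moreover have "v 0 x0 \<le> measure PE (E m)" for m using main[of m x0] by (simp add: E_def v_def)
  ultimately have "v 0 x0 \<le> measure PE (\<Inter>m. E m)" by (intro LIMSEQ_le_const) auto
  also have "\<dots> \<le> measure PE {e \<in> space PE. \<forall>m. \<exists>i. length i = m \<and> bx e i \<ge> exp (- (real m * \<mu> \<theta>) - a)}"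
  proof (rule PE.finite_measure_mono)
    show "{e \<in> space PE. \<forall>m. \<exists>i. length i = m \<and> bx e i \<ge> exp (- (real m * \<mu> \<theta>) - a)} \<in> PE.events" by measurable
    show "(\<Inter>m. E m) \<subseteq> {e \<in> space PE. \<forall>m. \<exists>i. length i = m \<and> bx e i \<ge> exp (- (real m * \<mu> \<theta>) - a)}"
    proof
      fix e assume e: "e \<in> (\<Inter>m. E m)"
      have "\<exists>i. length i = m \<and> bx e i \<ge> exp (- (real m * \<mu> \<theta>) - a)" for m
      proof -
        have "good B (\<mu> \<theta>) m x0 e" using e by (auto simp: E_def)
        from good_imp_box[OF this] obtain i where i: "length i = m" "bx e i > 0" "x0 - ln (bx e i) - real m * \<mu> \<theta> \<le> a"
          by (auto simp: B_def)
        have "exp (- (real m * \<mu> \<theta>) - a) \<le> exp (- (real m * \<mu> \<theta>) + x0 - a)" using s R by (simp add: x0_def)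
        also have "\<dots> \<le> bx e i" by (rule box_of_slack[OF i(2,3)])
        finally show ?thesis using i by blast
      qed
      thus "e \<in> {e \<in> space PE. \<forall>m. \<exists>i. length i = m \<and> bx e i \<ge> exp (- (real m * \<mu> \<theta>) - a)}"
        using e by (auto simp: E_def)
    qed
  qed
  finally show ?thesis using vx0 that[of a] by linarith
qed

text \<open>The invariance behind the zero-one law. The additive constant is quantified inside the
  event, so the mass of the child can be absorbed by enlarging it.\<close>

lemma inherit_exp_lower_subset:
  assumes "d \<ge> 0"
  shows "inherit {e \<in> space PE. \<exists>n::nat. \<forall>m. \<exists>i. length i = m \<and> bx e i \<ge> exp (- (real m * d) - n)}
    \<subseteq> {e \<in> space PE. \<exists>n::nat. \<forall>m. \<exists>i. length i = m \<and> bx e i \<ge> exp (- (real m * d) - n)}" (is "inherit ?A \<subseteq> ?A")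
proof
  fix e assume "e \<in> inherit ?A"
  then obtain c where e: "e \<in> space PE" and c: "measure (e []) {c} > 0" and s: "subenv e c \<in> ?A"
    by (subst (asm) inherit_def) blast
  then obtain n :: nat where n: "\<And>m. \<exists>i. length i = m \<and> bx (subenv e c) i \<ge> exp (- (real m * d) - n)" by blast
  obtain n' :: nat where n': "real n - ln (measure (e []) {c}) \<le> n'" using real_arch_simple by blast
  have "\<exists>i. length i = m \<and> bx e i \<ge> exp (- (real m * d) - n')" for m
  proof (cases m)
    case 0
    show ?thesis using 0 by (intro exI[of _ "[]"]) simp
  next
    case (Suc k)
    obtain i where i: "length i = k" "bx (subenv e c) i \<ge> exp (- (real k * d) - n)" using n by blast
    have "exp (- (real m * d) - n') \<le> exp (ln (measure (e []) {c}) + (- (real k * d) - n))"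
      using n' assms Suc by (simp add: algebra_simps)
    also have "\<dots> = measure (e []) {c} * exp (- (real k * d) - n)" using c by (simp only: exp_add exp_ln)
    also have "\<dots> \<le> measure (e []) {c} * bx (subenv e c) i" using i c by (intro mult_left_mono) auto
    finally show ?thesis using i Suc by (intro exI[of _ "c # i"]) (simp add: bx_Cons)
  qed
  thus "e \<in> ?A" using e by blast
qed

text \<open>The failure probability satisfies \<open>q <= (1 - p) q + p q^2\<close> by invariance
  and \<open>fail_inherit_le\<close>, that is, \<open>p q (1 - q) <= 0\<close> with
  \<open>p > 0\<close>. As \<open>q < 1\<close> by \<open>supercritical_prob\<close>, it follows
  that \<open>q = 0\<close>.\<close>

theorem AE_exp_lower:
  assumes \<theta>: "\<theta> > 1" and L1: "Lam \<theta> > 1"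
  shows "AE e in PE. \<exists>n::nat. \<forall>m. \<exists>i. length i = m \<and> bx e i \<ge> exp (- (real m * \<mu> \<theta>) - n)"
proof -
  define A where "A = {e \<in> space PE. \<exists>n::nat. \<forall>m. \<exists>i. length i = m \<and> bx e i \<ge> exp (- (real m * \<mu> \<theta>) - n)}"
  have A: "A \<in> sets PE" unfolding A_def by measurable
  obtain a where a: "0 < measure PE {e \<in> space PE. \<forall>m. \<exists>i. length i = m \<and> bx e i \<ge> exp (- (real m * \<mu> \<theta>) - a)}"
    by (rule supercritical_prob[OF assms])
  also have "\<dots> \<le> measure PE A"
  proof (rule PE.finite_measure_mono[OF _ A])
    show "{e \<in> space PE. \<forall>m. \<exists>i. length i = m \<and> bx e i \<ge> exp (- (real m * \<mu> \<theta>) - a)} \<subseteq> A"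
    proof
      fix e assume e: "e \<in> {e \<in> space PE. \<forall>m. \<exists>i. length i = m \<and> bx e i \<ge> exp (- (real m * \<mu> \<theta>) - a)}"
      obtain n :: nat where n: "a \<le> n" using real_arch_simple by blast
      have "\<exists>i. length i = m \<and> bx e i \<ge> exp (- (real m * \<mu> \<theta>) - n)" for m
      proof -
        obtain i where i: "length i = m" "bx e i \<ge> exp (- (real m * \<mu> \<theta>) - a)" using e by blast
        have "exp (- (real m * \<mu> \<theta>) - n) \<le> exp (- (real m * \<mu> \<theta>) - a)" using n by simp
        hence "exp (- (real m * \<mu> \<theta>) - n) \<le> bx e i" by (rule order_trans[OF _ i(2)])
        thus ?thesis using i(1) by (intro exI[of _ i] conjI)
      qed
      thus "e \<in> A" using e unfolding A_def by blast
    qed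
  qed
  finally have pos: "measure PE A > 0" .
  define q where "q = 1 - measure PE A"
  have q: "0 \<le> q" "q < 1" using pos by (auto simp: q_def)
  have "measure PE (inherit A) \<le> measure PE A"
    using inherit_exp_lower_subset[of "\<mu> \<theta>"] mu_pos[OF \<theta>] A unfolding A_def
    by (intro PE.finite_measure_mono) auto
  hence "q \<le> 1 - measure PE (inherit A)" by (simp add: q_def)
  also have "\<dots> \<le> (1 - split_prob) * q + split_prob * q\<^sup>2"
    unfolding q_def by (rule fail_inherit_le[OF A])
  finally have "split_prob * (1 - q) * q \<le> 0" by (simp add: algebra_simps power2_eq_square)
  moreover have "split_prob * (1 - q) > 0" using split_prob_pos q by simp
  ultimately have "\<not> 0 < q" using mult_pos_pos[of "split_prob * (1 - q)" q] by linarith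
  hence "measure PE A = 1" using PE.prob_le_1[of A] by (simp add: q_def)
  hence "AE e in PE. e \<in> A" using PE.prob_eq_1[OF A] by simp
  thus ?thesis by eventually_elim (auto simp: A_def)
qed

text \<open>About \<open>\<kappa> ln k\<close> initial generations raise the polynomially small
  success probability of \<open>critical_prob\<close> to nearly 1. They cost a factor
  \<open>k^(-K)\<close> in size, unless one of the boxes they produce is unusually small, an event
  of summable probability by \<open>prob_small_box_le\<close>.\<close>

lemma critical_fail_prob:
  assumes \<theta>: "\<theta> > 1" and L1: "Lam \<theta> \<ge> 1" and \<delta>: "\<delta> > 0" and fin: "L_fun \<nu> (- \<delta>) < \<infinity>"
  obtains K C :: real where "K > 0" "C > 0"
    "\<And>k. k \<ge> 1 \<Longrightarrow> measure PE {e \<in> space PE. \<not> (\<exists>i. length i = k \<and> bx e i \<ge> exp (- (real k * \<mu> \<theta>)) * real k powr (- K) / C)}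
       \<le> C * real k powr (- 2)"
proof -
  obtain a c where a: "a \<ge> 0" and c: "c > 0" and ac: "\<And>m. c / (real m + 1) ^ 101
    \<le> measure PE {e \<in> space PE. \<exists>i. length i = m \<and> bx e i \<ge> exp (- (real m * \<mu> \<theta>) - a)}"
    by (rule critical_prob[OF \<theta> L1]) (rule that)
  define l where "l = max 1 (enn2real (L_fun \<nu> (- \<delta>)))"
  have l: "l \<ge> 1" "L_fun \<nu> (- \<delta>) \<le> ennreal l"
  proof -
    show "l \<ge> 1" by (simp add: l_def)
    have "L_fun \<nu> (- \<delta>) = ennreal (enn2real (L_fun \<nu> (- \<delta>)))" using fin by simp
    also have "\<dots> \<le> ennreal l" by (intro ennreal_leI) (simp add: l_def)
    finally show "L_fun \<nu> (- \<delta>) \<le> ennreal l" .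
  qed
  define p where "p = 1 + split_prob"
  have p: "p > 1" using split_prob_pos by (simp add: p_def)
  \<comment> \<open>103 = 101 + 2: \<open>p^(m k) >= k^103\<close> compensates the power 101 of
    \<open>critical_prob\<close> and leaves the summable \<open>k^(-2)\<close>.\<close>
  define \<kappa> where "\<kappa> = 103 / ln p"
  have \<kappa>: "\<kappa> > 0" using p by (simp add: \<kappa>_def)
  define m where "m k = nat \<lceil>\<kappa> * ln (real k)\<rceil>" for k :: nat
  \<comment> \<open>Chosen so that \<open>z = k^(-K)\<close> satisfies
    \<open>z^\<delta> l^(m k) <= l k^(-2)\<close>.\<close>
  define K where "K = (\<kappa> * ln l + 2) / \<delta>"
  have K: "K > 0" using \<kappa> l \<delta> by (simp add: K_def add_nonneg_pos)
  define C where "C = 2 ^ 101 / c + l + exp a"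
  have C: "C > 0" using c l by (simp add: C_def add_pos_pos)
  have mk: "\<kappa> * ln (real k) \<le> m k" "real (m k) \<le> \<kappa> * ln (real k) + 1" if "k \<ge> 1" for k
  proof -
    have "0 \<le> \<kappa> * ln (real k)" using \<kappa> that by simp
    thus "\<kappa> * ln (real k) \<le> m k" "real (m k) \<le> \<kappa> * ln (real k) + 1" unfolding m_def by linarith+
  qed
  have "measure PE {e \<in> space PE. \<not> (\<exists>i. length i = k \<and> bx e i \<ge> exp (- (real k * \<mu> \<theta>)) * real k powr (- K) / C)}
       \<le> C * real k powr (- 2)" if k: "k \<ge> 1" for k
  proof -
    define A where "A = {e \<in> space PE. \<exists>i. length i = k \<and> bx e i \<ge> exp (- (real k * \<mu> \<theta>) - a)}"
    have A [measurable]: "A \<in> sets PE" unfolding A_def by measurable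
    define z where "z = real k powr (- K)"
    have z: "z > 0" using k by (simp add: z_def)
    define S where "S = {e \<in> space PE. \<exists>i. length i = m k \<and> 0 < bx e i \<and> bx e i < z}"
    have S [measurable]: "S \<in> sets PE" unfolding S_def by measurable
    define F where "F = {e \<in> space PE. \<not> (\<exists>i. length i = k \<and> bx e i \<ge> exp (- (real k * \<mu> \<theta>)) * real k powr (- K) / C)}"
    have F: "F \<in> sets PE" unfolding F_def by measurable
    have sub: "F \<subseteq> (space PE - (inherit ^^ m k) A) \<union> S"
    proof
      fix e assume e: "e \<in> F"
      hence es: "e \<in> space PE" by (simp add: F_def)
      show "e \<in> (space PE - (inherit ^^ m k) A) \<union> S"
      proof (rule ccontr)
        assume "e \<notin> (space PE - (inherit ^^ m k) A) \<union> S"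
        hence eA: "e \<in> (inherit ^^ m k) A" and eS: "e \<notin> S" using es by auto
        from inherit_pow_box[OF eA] obtain i where i: "length i = m k" "bx e i > 0" "(\<lambda>j. e (i @ j)) \<in> A" by blast
        then obtain j where j: "length j = k" "bx (\<lambda>j. e (i @ j)) j \<ge> exp (- (real k * \<mu> \<theta>) - a)" by (auto simp: A_def)
        have zi: "z \<le> bx e i" using eS es i by (force simp: S_def)
        have "exp (- (real k * \<mu> \<theta>)) * real k powr (- K) / C \<le> exp (- (real k * \<mu> \<theta>)) * z / exp a"
          unfolding z_def using C c l by (intro divide_left_mono) (auto simp: C_def)
        also have "\<dots> = z * exp (- (real k * \<mu> \<theta>) - a)" by (simp add: exp_diff)
        also have "\<dots> \<le> bx e i * bx (\<lambda>j. e (i @ j)) j" using zi j z by (intro mult_mono) auto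
        also have "\<dots> = bx e (i @ j)" by (simp add: bx_append)
        \<comment> \<open>The box found lies in generation \<open>m k + k\<close>; its ancestor in
          generation \<open>k\<close> is at least as large.\<close>
        also have "\<dots> \<le> bx e (take k (i @ j))" by (rule bx_take_ge) (rule space_PE_mass[OF es])
        finally have "exp (- (real k * \<mu> \<theta>)) * real k powr (- K) / C \<le> bx e (take k (i @ j))" .
        moreover have "length (take k (i @ j)) = k" using j by simp
        ultimately show False using e unfolding F_def by blast
      qed
    qed
    have "measure PE F \<le> measure PE ((space PE - (inherit ^^ m k) A) \<union> S)"
      using sub by (intro PE.finite_measure_mono) measurable
    also have "\<dots> \<le> measure PE (space PE - (inherit ^^ m k) A) + measure PE S"
      by (intro measure_Un_le) measurable
    also have "measure PE (space PE - (inherit ^^ m k) A) = 1 - measure PE ((inherit ^^ m k) A)"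
      by (rule PE.prob_compl) measurable
    also have "\<dots> \<le> 1 / (p ^ m k * (c / (real k + 1) ^ 101))"
      unfolding p_def using c ac[of k] by (intro fail_inherit_pow_le) (auto simp: A_def)
    also have "\<dots> \<le> 2 ^ 101 / c * real k powr (- 2)"
    proof -
      have "real k powr 103 = exp (\<kappa> * ln (real k) * ln p)" using p k by (simp add: powr_def \<kappa>_def)
      also have "\<dots> \<le> exp (real (m k) * ln p)" using mk[OF k] p by (simp add: mult_right_mono)
      also have "\<dots> = p ^ m k" using p by (simp add: exp_of_nat_mult)
      finally have pm: "real k powr 103 \<le> p ^ m k" .
      have "(real k + 1) ^ 101 \<le> (2 * real k) ^ 101" using k by (intro power_mono) auto
      also have "\<dots> = 2 ^ 101 * real k powr 101" using k by (subst powr_numeral) (auto simp only: power_mult_distrib of_nat_0_less_iff)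
      finally have "(real k + 1) ^ 101 \<le> 2 ^ 101 * real k powr 101" .
      hence "(real k + 1) ^ 101 / (p ^ m k * c) \<le> (2 ^ 101 * real k powr 101) / (real k powr 103 * c)"
        using pm c p k by (intro frac_le mult_right_mono mult_pos_pos) auto
      also have "\<dots> = 2 ^ 101 / c * (real k powr 101 / real k powr 103)" by simp
      also have "real k powr 101 / real k powr 103 = real k powr (- 2)" by (subst powr_diff[symmetric]) simp
      finally show ?thesis by simp
    qed
    also have "measure PE S \<le> l * real k powr (- 2)"
    proof -
      have "emeasure PE S \<le> ennreal (z powr \<delta>) * L_fun \<nu> (- \<delta>) ^ m k"
        unfolding S_def by (rule prob_small_box_le[OF \<delta> z])
      also have "\<dots> \<le> ennreal (z powr \<delta>) * ennreal l ^ m k" using l by (intro mult_left_mono power_mono) auto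
      also have "\<dots> = ennreal (z powr \<delta> * l ^ m k)" using l by (simp add: ennreal_mult ennreal_power)
      finally have "measure PE S \<le> z powr \<delta> * l ^ m k" using l by (simp add: PE.emeasure_eq_measure)
      also have "l ^ m k = exp (real (m k) * ln l)" using l by (simp add: exp_of_nat_mult)
      also have "\<dots> \<le> exp ((\<kappa> * ln (real k) + 1) * ln l)" using mk[OF k] l by (simp add: mult_right_mono)
      also have "\<dots> = l * real k powr (\<kappa> * ln l)" using l k by (simp add: powr_def distrib_left exp_add mult_ac)
      also have "z powr \<delta> = real k powr (- (\<kappa> * ln l + 2))" using \<delta> by (simp add: z_def powr_powr K_def)
      finally have "measure PE S \<le> real k powr (- (\<kappa> * ln l + 2)) * (l * real k powr (\<kappa> * ln l))"
        by (simp add: mult_left_mono)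
      also have "\<dots> = l * real k powr (- 2)" by (simp add: mult.left_commute flip: powr_add)
      finally show ?thesis .
    qed
    finally have "measure PE F \<le> (2 ^ 101 / c + l) * real k powr (- 2)" by (simp add: distrib_right)
    also have "\<dots> \<le> C * real k powr (- 2)" by (intro mult_right_mono) (auto simp: C_def)
    finally show ?thesis by (simp add: F_def)
  qed
  thus ?thesis using that K C by blast
qed

theorem AE_critical_lower:
  assumes "\<theta> > 1" "Lam \<theta> \<ge> 1" "\<delta> > 0" "L_fun \<nu> (- \<delta>) < \<infinity>"
  obtains K C :: real where "K > 0" "C > 0"
    "AE e in PE. \<forall>\<^sub>F k in sequentially. \<exists>i. length i = k \<and> bx e i \<ge> exp (- (real k * \<mu> \<theta>)) * real k powr (- K) / C"
proof -
  obtain K C :: real where K: "K > 0" and C: "C > 0" and KC: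
    "\<And>k. k \<ge> 1 \<Longrightarrow> measure PE {e \<in> space PE. \<not> (\<exists>i. length i = k \<and> bx e i \<ge> exp (- (real k * \<mu> \<theta>)) * real k powr (- K) / C)}
       \<le> C * real k powr (- 2)"
    by (rule critical_fail_prob[OF assms]) (rule that)
  define F where "F k = {e \<in> space PE. \<not> (\<exists>i. length i = k \<and> bx e i \<ge> exp (- (real k * \<mu> \<theta>)) * real k powr (- K) / C)}" for k
  have "AE e in PE. \<forall>\<^sub>F k in sequentially. e \<in> space PE - F k"
  proof (rule borel_cantelli_AE1)
    show "F k \<in> PE.events" for k unfolding F_def by measurable
    show "emeasure PE (F k) < \<infinity>" for k using PE.emeasure_finite[of "F k"] by (simp add: less_top[symmetric])
    show "summable (\<lambda>k. measure PE (F k))"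
    proof (rule summable_comparison_test_ev)
      show "\<forall>\<^sub>F k in sequentially. norm (measure PE (F k)) \<le> C * real k powr (- 2)"
        using eventually_ge_at_top[of 1] by eventually_elim (use KC in \<open>simp add: F_def\<close>)
      show "summable (\<lambda>k. C * real k powr (- 2))"
        by (intro summable_mult) (simp add: summable_real_powr_iff)
    qed
  qed
  hence "AE e in PE. \<forall>\<^sub>F k in sequentially. \<exists>i. length i = k \<and> bx e i \<ge> exp (- (real k * \<mu> \<theta>)) * real k powr (- K) / C"
    by eventually_elim (auto elim!: eventually_mono simp: F_def)
  thus ?thesis using that K C by blast
qed

end

section \<open>Throwing the balls\<close>

lemma two_times_choose_two: "2 * (k choose 2) = k * (k - 1)"
  by (induction k) (auto simp: numeral_2_eq_2 algebra_simps)

section \<open>The law of the environment and the conditional law of the balls\<close>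

context nested_occupancy
begin

sublocale mass_law \<nu>
  by unfold_locales (rule law_\<nu>)

definition env :: "'w \<Rightarrow> nat list \<Rightarrow> nat measure" where
  "env \<omega> = (\<lambda>i. \<rho> i \<omega>)"

definition in_box :: "nat \<Rightarrow> nat list \<Rightarrow> 'w set" where
  "in_box m i = {\<omega> \<in> space M. stake (length i) (\<xi> m \<omega>) = i}"

definition num_balls :: "nat \<Rightarrow> nat list \<Rightarrow> 'w \<Rightarrow> nat" where
  "num_balls n i \<omega> = balls_in_box \<xi> \<omega> n i"

lemma measurable_rho [measurable]: "\<rho> i \<in> M \<rightarrow>\<^sub>M mass_space"
  using indep_\<rho> by (simp add: indep_vars_def)

lemma measurable_rho' [measurable]: "(\<lambda>\<omega>. \<rho> i \<omega>) \<in> M \<rightarrow>\<^sub>M \<nu>"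
  using measurable_rho measurable_cong_sets[OF refl sets_nu, of M] by blast

lemma measurable_environment [measurable]: "env \<in> M \<rightarrow>\<^sub>M PE"
  by (rule measurable_PE_I) (simp add: env_def)

text \<open>Almost sure statements and expectations under the product law \<open>PE\<close> are
  transferred to the given probability space through this identity.\<close>

lemma distr_environment: "distr M PE env = PE"
proof -
  have *: "distr M (PiM UNIV (\<lambda>_. mass_space)) (\<lambda>x. \<lambda>i\<in>UNIV. \<rho> i x) = PiM UNIV (\<lambda>i. distr M mass_space (\<rho> i))"
    using indep_\<rho> by (subst (asm) indep_vars_iff_distr_eq_PiM) auto
  have eq: "distr M (PiM UNIV (\<lambda>_. mass_space)) env = PE"
  proof -
    have "(\<lambda>x. \<lambda>i\<in>UNIV. \<rho> i x) = env" by (intro ext) (simp add: env_def)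
    with * show ?thesis by (simp add: distr_\<rho> PE_def)
  qed
  have "sets PE = sets (PiM UNIV (\<lambda>_. mass_space))"
    unfolding PE_def by (rule sets_PiM_cong) (simp_all add: sets_nu)
  hence "distr M PE env = distr M (PiM UNIV (\<lambda>_. mass_space)) env" by (intro distr_cong) auto
  thus ?thesis using eq by simp
qed

lemma AE_environment:
  assumes "AE e in PE. P e"
  shows "AE \<omega> in M. P (env \<omega>)"
proof (rule AE_distrD[OF measurable_environment])
  show "AE e in distr M PE env. P e" unfolding distr_environment by (rule assms)
qed

lemma nn_integral_environment:
  "f \<in> borel_measurable PE \<Longrightarrow> (\<integral>\<^sup>+\<omega>. f (env \<omega>) \<partial>M) = (\<integral>\<^sup>+e. f e \<partial>PE)"
  by (subst distr_environment[symmetric], subst nn_integral_distr) auto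

abbreviation "EG \<equiv> env_sigma M \<rho>"

lemma sets_PE_mass: "sets (PiM UNIV (\<lambda>_. mass_space)) = sets PE"
  unfolding PE_def by (rule sets_PiM_cong) (simp_all add: sets_nu)

lemma space_PE_mass': "space (PiM UNIV (\<lambda>_. mass_space)) = space PE"
  by (rule sets_eq_imp_space_eq[OF sets_PE_mass])

lemma subalg_EG: "subalgebra M EG"
proof -
  have "sets EG \<subseteq> sets M"
    unfolding env_sigma_def
  proof (subst sets_vimage_algebra2)
    show "(\<lambda>\<omega> i. \<rho> i \<omega>) \<in> space M \<rightarrow> space (PiM UNIV (\<lambda>_. mass_space))"
      using measurable_space[OF measurable_environment] by (auto simp: space_PE_mass' env_def[abs_def])
    show "{(\<lambda>\<omega> i. \<rho> i \<omega>) -` A \<inter> space M |A. A \<in> sets (PiM UNIV (\<lambda>_. mass_space))} \<subseteq> sets M"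
      using measurable_sets[OF measurable_environment] by (auto simp: sets_PE_mass env_def[abs_def])
  qed
  thus ?thesis by (simp add: subalgebra_def env_sigma_def)
qed

lemma measurable_env_EG: "env \<in> EG \<rightarrow>\<^sub>M PE"
proof -
  have "(\<lambda>\<omega> i. \<rho> i \<omega>) \<in> EG \<rightarrow>\<^sub>M PiM UNIV (\<lambda>_. mass_space)"
    unfolding env_sigma_def
    using measurable_space[OF measurable_environment]
    by (intro measurable_vimage_algebra1) (auto simp: space_PE_mass' env_def[abs_def])
  thus ?thesis using measurable_cong_sets[OF refl sets_PE_mass] by (auto simp: env_def[abs_def])
qed

sublocale EG: finite_measure_subalgebra M EG
  by unfold_locales (rule subalg_EG)

lemma measurable_in_box [measurable]: "in_box m i \<in> sets M"
proof -
  have "Measurable.pred M (\<lambda>\<omega>. stake (length i) (\<xi> m \<omega>) = i)"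
    using measurable_ball[of m] by measurable
  thus ?thesis by (simp add: in_box_def pred_def)
qed

text \<open>Induction over the generations: each application of \<open>transition\<close>
  contributes one mass, and the root contains every ball.\<close>

lemma cond_prob_in_box: "AE \<omega> in M. cond_prob_given M EG (in_box m i) \<omega> = bx (env \<omega>) i"
proof (induction i rule: rev_induct)
  case Nil
  have "AE \<omega> in M. cond_prob_given M EG (in_box m []) \<omega> = indicator (in_box m []) \<omega>"
  proof (rule EG.real_cond_exp_F_meas)
    have "in_box m [] = space EG" by (simp add: in_box_def env_sigma_def)
    thus "indicator (in_box m []) \<in> borel_measurable EG" by simp
    show "integrable M (indicat_real (in_box m []))"
      by (intro integrable_real_indicator) (auto simp: less_top[symmetric])
  qed
  thus ?case using AE_space by eventually_elim (simp add: in_box_def)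
next
  case (snoc j i)
  have "AE \<omega> in M. cond_prob_given M EG (in_box m (i @ [j])) \<omega>
    = measure (\<rho> i \<omega>) {j} * cond_prob_given M EG (in_box m i) \<omega>"
    using transition[where m=m and i=i and j=j] by (simp add: in_box_def)
  thus ?case using snoc by eventually_elim (simp add: bx_snoc env_def mult.commute)
qed

lemma cond_prob_balls:
  assumes "finite J" "J \<noteq> {}"
  shows "AE \<omega> in M. cond_prob_given M EG (\<Inter>m\<in>J. in_box m i) \<omega> = bx (env \<omega>) i ^ card J"
proof -
  have "in_box m i \<in> sets (vimage_algebra (space M) (\<xi> m) (stream_space (count_space UNIV)))" for m
  proof -
    have "{s \<in> space (stream_space (count_space UNIV)). stake (length i) s = i} \<in> sets (stream_space (count_space UNIV))"
      by measurable
    hence "\<xi> m -` {s \<in> space (stream_space (count_space UNIV)). stake (length i) s = i} \<inter> space M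
      \<in> sets (vimage_algebra (space M) (\<xi> m) (stream_space (count_space UNIV)))"
      by (rule in_vimage_algebra)
    also have "\<xi> m -` {s \<in> space (stream_space (count_space UNIV)). stake (length i) s = i} \<inter> space M = in_box m i"
      using measurable_space[OF measurable_ball] by (auto simp: in_box_def)
    finally show ?thesis .
  qed
  hence "AE \<omega> in M. cond_prob_given M EG (\<Inter>m\<in>J. in_box m i) \<omega> = (\<Prod>m\<in>J. cond_prob_given M EG (in_box m i) \<omega>)"
    using cond_indep_balls assms unfolding cond_indep_sets_def by auto
  moreover have "AE \<omega> in M. \<forall>m\<in>J. cond_prob_given M EG (in_box m i) \<omega> = bx (env \<omega>) i"
    using assms cond_prob_in_box by (intro AE_finite_allI) auto
  ultimately show ?thesis by eventually_elim simp
qed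

lemma integrable_bounded_env:
  fixes b :: real
  assumes [measurable]: "g \<in> borel_measurable PE" and "\<And>e. \<bar>g e\<bar> \<le> b"
    and [measurable]: "A \<in> sets M"
  shows "integrable M (\<lambda>\<omega>. g (env \<omega>) * indicator A \<omega>)" "integrable M (\<lambda>\<omega>. g (env \<omega>))"
proof -
  have m: "(\<lambda>\<omega>. g (env \<omega>)) \<in> borel_measurable M"
    by (rule measurable_compose[OF measurable_environment]) fact
  show "integrable M (\<lambda>\<omega>. g (env \<omega>))" by (rule integrable_const_bound[where B=b]) (use assms m in auto)
  thus "integrable M (\<lambda>\<omega>. g (env \<omega>) * indicator A \<omega>)" by (intro integrable_real_mult_indicator assms)
qed

lemma bx_le_1: "e \<in> space PE \<Longrightarrow> bx e i \<le> 1"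
  unfolding bx_def by (intro prod_le_1) (simp add: space_PE_mass)

text \<open>\<open>g (env \<omega>)\<close> is measurable with respect to the environment, so the
  indicators may be replaced by their conditional expectation, which is known from
  \<open>cond_prob_balls\<close>.\<close>

lemma integral_env_balls:
  assumes g [measurable]: "g \<in> borel_measurable PE" and gb: "\<And>e. \<bar>g e\<bar> \<le> b" and J: "finite J"
  shows "(\<integral>\<omega>. g (env \<omega>) * (\<Prod>m\<in>J. indicator (in_box m i) \<omega>) \<partial>M) = (\<integral>\<omega>. g (env \<omega>) * bx (env \<omega>) i ^ card J \<partial>M)"
proof (cases "J = {}")
  case False
  let ?A = "\<Inter>m\<in>J. in_box m i"
  have A [measurable]: "?A \<in> sets M" using J False by (intro sets.finite_INT) auto
  have ind: "(\<Prod>m\<in>J. indicator (in_box m i) \<omega>) = (indicator ?A \<omega> :: real)" for \<omega>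
    using J by (auto simp: indicator_def)
  have mg: "(\<lambda>\<omega>. g (env \<omega>)) \<in> borel_measurable EG"
    by (rule measurable_compose[OF measurable_env_EG g])
  have mg': "(\<lambda>\<omega>. g (env \<omega>)) \<in> borel_measurable M" "(\<lambda>\<omega>. bx (env \<omega>) i) \<in> borel_measurable M"
    by (rule measurable_compose[OF measurable_environment], measurable)+
  have "(\<integral>\<omega>. g (env \<omega>) * (\<Prod>m\<in>J. indicator (in_box m i) \<omega>) \<partial>M) = (\<integral>\<omega>. g (env \<omega>) * indicator ?A \<omega> \<partial>M)"
    by (simp only: ind)
  also have "\<dots> = (\<integral>\<omega>. g (env \<omega>) * cond_prob_given M EG ?A \<omega> \<partial>M)"
    by (rule EG.real_cond_exp_intg(2)[symmetric]) (use integrable_bounded_env(1)[OF g gb A] mg in auto)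
  also have "\<dots> = (\<integral>\<omega>. g (env \<omega>) * bx (env \<omega>) i ^ card J \<partial>M)"
  proof (rule integral_cong_AE)
    show "AE \<omega> in M. g (env \<omega>) * cond_prob_given M EG ?A \<omega> = g (env \<omega>) * bx (env \<omega>) i ^ card J"
      using cond_prob_balls[OF J False, of i] by eventually_elim simp
  qed (use mg' in measurable)
  finally show ?thesis .
qed simp

section \<open>Factorial moments of the ball counts\<close>

text \<open>The binomial coefficient counts the \<open>r\<close>-element sets of balls that all lie
  in the box, so its expectation given the environment is explicit by conditional
  independence.\<close>

lemma count_choose:
  assumes \<omega>: "\<omega> \<in> space M"
  shows "real (num_balls n i \<omega> choose r) = (\<Sum>J | J \<subseteq> {..<n} \<and> card J = r. \<Prod>m\<in>J. indicator (in_box m i) \<omega>)"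
proof -
  let ?S = "{m. m < n \<and> stake (length i) (\<xi> m \<omega>) = i}"
  have fin: "finite {J. J \<subseteq> {..<n} \<and> card J = r}" by (rule finite_subset[of _ "Pow {..<n}"]) auto
  have "(\<Sum>J | J \<subseteq> {..<n} \<and> card J = r. \<Prod>m\<in>J. indicator (in_box m i) \<omega>)
     = (\<Sum>J | J \<subseteq> {..<n} \<and> card J = r. if J \<subseteq> ?S then 1 else (0::real))"
  proof (rule sum.cong[OF refl])
    fix J assume "J \<in> {J. J \<subseteq> {..<n} \<and> card J = r}"
    hence J: "J \<subseteq> {..<n}" "finite J" by (auto intro: finite_subset)
    have "(\<Prod>m\<in>J. indicator (in_box m i) \<omega>) = (if \<forall>m\<in>J. \<omega> \<in> in_box m i then 1 else (0::real))"
      using J by (auto simp: indicator_def)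
    also have "(\<forall>m\<in>J. \<omega> \<in> in_box m i) \<longleftrightarrow> J \<subseteq> ?S" using J \<omega> by (auto simp: in_box_def)
    finally show "(\<Prod>m\<in>J. indicator (in_box m i) \<omega>) = (if J \<subseteq> ?S then 1 else (0::real))" .
  qed
  also have "\<dots> = real (card {J \<in> {J. J \<subseteq> {..<n} \<and> card J = r}. J \<subseteq> ?S})"
    using fin by (simp add: sum.If_cases Int_def)
  also have "{J \<in> {J. J \<subseteq> {..<n} \<and> card J = r}. J \<subseteq> ?S} = {J. J \<subseteq> ?S \<and> card J = r}" by auto
  also have "card \<dots> = card ?S choose r" by (rule n_subsets) simp
  finally show ?thesis by (simp add: num_balls_def balls_in_box_def)
qed

lemma borel_measurable_count [measurable]: "(\<lambda>\<omega>. real (num_balls n i \<omega> choose r)) \<in> borel_measurable M"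
  by (subst measurable_cong[OF count_choose]) measurable

lemma borel_measurable_count1 [measurable]: "(\<lambda>\<omega>. real (num_balls n i \<omega>)) \<in> borel_measurable M"
  using borel_measurable_count[of n i 1] by simp

lemma integral_env_choose:
  assumes g [measurable]: "g \<in> borel_measurable PE" and gb: "\<And>e. \<bar>g e\<bar> \<le> b"
  shows "(\<integral>\<omega>. g (env \<omega>) * real (num_balls n i \<omega> choose r) \<partial>M) = real (n choose r) * (\<integral>\<omega>. g (env \<omega>) * bx (env \<omega>) i ^ r \<partial>M)"
    "integrable M (\<lambda>\<omega>. g (env \<omega>) * real (num_balls n i \<omega> choose r))"
proof -
  let ?Js = "{J. J \<subseteq> {..<n} \<and> card J = r}"
  have fin: "finite J" if "J \<in> ?Js" for J using that by (auto intro: finite_subset)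
  have int: "integrable M (\<lambda>\<omega>. g (env \<omega>) * (\<Prod>m\<in>J. indicator (in_box m i) \<omega>))" if "J \<in> ?Js" for J
  proof (cases "J = {}")
    case True
    thus ?thesis using integrable_bounded_env(2)[OF g gb, of "{}"] by simp
  next
    case False
    let ?A = "\<Inter>m\<in>J. in_box m i"
    have A: "?A \<in> sets M" using fin[OF that] False by (intro sets.finite_INT) auto
    have ind: "(\<Prod>m\<in>J. indicator (in_box m i) \<omega>) = (indicator ?A \<omega> :: real)" for \<omega>
      using fin[OF that] by (auto simp: indicator_def)
    show ?thesis unfolding ind by (rule integrable_bounded_env(1)[OF g gb A])
  qed
  have eq: "g (env \<omega>) * real (num_balls n i \<omega> choose r) = (\<Sum>J\<in>?Js. g (env \<omega>) * (\<Prod>m\<in>J. indicator (in_box m i) \<omega>))"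
    if "\<omega> \<in> space M" for \<omega>
    unfolding count_choose[OF that] by (rule sum_distrib_left)
  have "(\<integral>\<omega>. g (env \<omega>) * real (num_balls n i \<omega> choose r) \<partial>M)
     = (\<integral>\<omega>. (\<Sum>J\<in>?Js. g (env \<omega>) * (\<Prod>m\<in>J. indicator (in_box m i) \<omega>)) \<partial>M)"
    by (rule Bochner_Integration.integral_cong[OF refl eq])
  also have "\<dots> = (\<Sum>J\<in>?Js. \<integral>\<omega>. g (env \<omega>) * (\<Prod>m\<in>J. indicator (in_box m i) \<omega>) \<partial>M)"
    by (rule Bochner_Integration.integral_sum) (rule int)
  also have "\<dots> = (\<Sum>J\<in>?Js. \<integral>\<omega>. g (env \<omega>) * bx (env \<omega>) i ^ r \<partial>M)"
    using integral_env_balls[OF g gb fin] by (intro sum.cong refl) auto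
  also have "\<dots> = real (n choose r) * (\<integral>\<omega>. g (env \<omega>) * bx (env \<omega>) i ^ r \<partial>M)"
    using n_subsets[of "{..<n}" r] by simp
  finally show "(\<integral>\<omega>. g (env \<omega>) * real (num_balls n i \<omega> choose r) \<partial>M) = real (n choose r) * (\<integral>\<omega>. g (env \<omega>) * bx (env \<omega>) i ^ r \<partial>M)" .
  show "integrable M (\<lambda>\<omega>. g (env \<omega>) * real (num_balls n i \<omega> choose r))"
    by (subst Bochner_Integration.integrable_cong[OF refl eq]) (auto intro!: Bochner_Integration.integrable_sum int)
qed

text \<open>\<open>n choose r <= n^r\<close> against \<open>c choose r >= (c / r)^r\<close>.\<close>

lemma binomial_ratio_le:
  assumes "1 \<le> r" "r \<le> c"
  shows "real (n choose r) \<le> real r ^ r * (real n / real c) ^ r * real (c choose r)"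
proof -
  have "real (n choose r) * 1 \<le> real (n choose r) * fact r" by (intro mult_left_mono) auto
  also have "\<dots> = real ((n choose r) * fact r)" by simp
  also have "\<dots> \<le> real (n ^ r)" by (simp only: of_nat_le_iff binomial_fact_pow)
  finally have a: "real (n choose r) \<le> real n ^ r" by simp
  have b: "(real c / real r) ^ r \<le> real (c choose r)" using binomial_ge_n_over_k_pow_k[OF assms(2), where 'a=real] by simp
  have "real n ^ r = real r ^ r * (real n / real c) ^ r * (real c / real r) ^ r"
    using assms by (simp flip: power_mult_distrib)
  also have "\<dots> \<le> real r ^ r * (real n / real c) ^ r * real (c choose r)"
    using b by (intro mult_left_mono) auto
  finally show ?thesis by (rule order_trans[OF a])
qed

text \<open>Boxes larger than \<open>y / n\<close> are handled by Markov's inequality for their size, smaller ones by the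
  \<open>r\<close>-th factorial moment of the number of balls; \<open>u\<^sup>r \<le> u\<^sup>\<theta>\<close> for \<open>u \<le> 1\<close> merges the two bounds.\<close>

lemma emeasure_count_ge:
  assumes \<theta>: "0 < \<theta>" "\<theta> \<le> real r" and r: "1 \<le> r" and y: "real r \<le> y" and n: "1 \<le> n"
  shows "emeasure M {\<omega> \<in> space M. y \<le> real (num_balls n i \<omega>)}
    \<le> ennreal ((1 + real r ^ r) * (real n / y) powr \<theta>) * (\<integral>\<^sup>+e. ennreal (bx e i powr \<theta>) \<partial>PE)"
proof -
  have y0: "y > 0" using y r by simp
  \<comment> \<open>The count is an integer, so it reaches \<open>y\<close> exactly when it reaches
    \<open>c\<close>, and the binomial coefficient can be evaluated at \<open>c\<close>.\<close>
  define c where "c = nat \<lceil>y\<rceil>"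
  have c: "r \<le> c" "y \<le> real c" "\<And>k. y \<le> real k \<Longrightarrow> c \<le> k"
    using y y0 unfolding c_def by linarith+
  define x where "x = y / real n"
  have x0: "x > 0" using y0 n by (simp add: x_def)
  define g where "g e = indicat_real {e \<in> space PE. bx e i \<le> x} e" for e
  have gs: "{e \<in> space PE. bx e i \<le> x} \<in> sets PE" by measurable
  have g [measurable]: "g \<in> borel_measurable PE" unfolding g_def using gs by measurable
  have gb: "\<bar>g e\<bar> \<le> 1" for e by (simp add: g_def)
  let ?C = "real (c choose r)"
  have C: "?C > 0" using c by simp
  have envs: "env \<omega> \<in> space PE" if "\<omega> \<in> space M" for \<omega> using measurable_space[OF measurable_environment that] .
  define D where "D = real r ^ r"
  have D: "D \<ge> 0" by (simp add: D_def)
  have Cn: "0 \<le> real (n choose r)" by simp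
  have bxm: "(\<lambda>\<omega>. bx (env \<omega>) i) \<in> borel_measurable M"
    by (rule measurable_compose[OF measurable_environment]) measurable
  define S1 where "S1 = {\<omega> \<in> space M. bx (env \<omega>) i > x}"
  define S2 where "S2 = {\<omega> \<in> space M. bx (env \<omega>) i \<le> x \<and> y \<le> real (num_balls n i \<omega>)}"
  have S [measurable]: "S1 \<in> sets M" "S2 \<in> sets M" unfolding S1_def S2_def using bxm by measurable
  have gint: "integrable M (\<lambda>\<omega>. g (env \<omega>) * bx (env \<omega>) i ^ r)"
  proof (rule integrable_const_bound[where B=1])
    show "AE \<omega> in M. norm (g (env \<omega>) * bx (env \<omega>) i ^ r) \<le> 1"
    proof (rule AE_I2)
      fix \<omega> assume "\<omega> \<in> space M"
      hence "bx (env \<omega>) i ^ r \<le> 1" using bx_le_1[OF envs] by (intro power_le_one) auto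
      thus "norm (g (env \<omega>) * bx (env \<omega>) i ^ r) \<le> 1" by (simp add: g_def indicator_def)
    qed
    show "(\<lambda>\<omega>. g (env \<omega>) * bx (env \<omega>) i ^ r) \<in> borel_measurable M"
      using bxm measurable_compose[OF measurable_environment g] by measurable
  qed
  have "measure M S2 * ?C = (\<integral>\<omega>. ?C * indicator S2 \<omega> \<partial>M)" by simp
  also have "\<dots> \<le> (\<integral>\<omega>. g (env \<omega>) * real (num_balls n i \<omega> choose r) \<partial>M)"
  proof (rule integral_mono)
    show "integrable M (\<lambda>\<omega>. ?C * indicat_real S2 \<omega>)" by (intro integrable_mult_right) (simp add: less_top[symmetric])
    show "integrable M (\<lambda>\<omega>. g (env \<omega>) * real (num_balls n i \<omega> choose r))" by (rule integral_env_choose(2)[OF g gb])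
    fix \<omega> assume \<omega>: "\<omega> \<in> space M"
    show "?C * indicat_real S2 \<omega> \<le> g (env \<omega>) * real (num_balls n i \<omega> choose r)"
    proof (cases "\<omega> \<in> S2")
      case True
      have "c \<le> num_balls n i \<omega>" using True c(3) by (auto simp: S2_def)
      hence "c choose r \<le> num_balls n i \<omega> choose r" by (rule binomial_right_mono)
      thus ?thesis using True envs[OF \<omega>] by (simp add: S2_def g_def)
    qed (simp add: g_def)
  qed
  also have "\<dots> = real (n choose r) * (\<integral>\<omega>. g (env \<omega>) * bx (env \<omega>) i ^ r \<partial>M)" by (rule integral_env_choose(1)[OF g gb])
  also have "\<dots> \<le> (D * (real n / real c) ^ r * ?C) * (\<integral>\<omega>. g (env \<omega>) * bx (env \<omega>) i ^ r \<partial>M)"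
    unfolding D_def by (intro mult_right_mono binomial_ratio_le r c integral_nonneg_AE) (simp add: g_def)
  finally have "measure M S2 * ?C \<le> (D * (real n / real c) ^ r * (\<integral>\<omega>. g (env \<omega>) * bx (env \<omega>) i ^ r \<partial>M)) * ?C"
    by (simp add: mult_ac)
  hence "measure M S2 \<le> D * (real n / real c) ^ r * (\<integral>\<omega>. g (env \<omega>) * bx (env \<omega>) i ^ r \<partial>M)"
    using C by (rule mult_right_le_imp_le)
  also have "\<dots> \<le> D * (real n / y) ^ r * (\<integral>\<omega>. g (env \<omega>) * bx (env \<omega>) i ^ r \<partial>M)"
    using D y0 c by (intro mult_right_mono mult_left_mono power_mono divide_left_mono integral_nonneg_AE) (auto simp: g_def)
  also have "\<dots> = (\<integral>\<omega>. D * ((real n / y) ^ r * (g (env \<omega>) * bx (env \<omega>) i ^ r)) \<partial>M)" by simp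
  finally have m2: "emeasure M S2 \<le> ennreal (\<integral>\<omega>. D * ((real n / y) ^ r * (g (env \<omega>) * bx (env \<omega>) i ^ r)) \<partial>M)"
    by (simp add: emeasure_eq_measure ennreal_leI)
  also have "\<dots> = (\<integral>\<^sup>+\<omega>. ennreal (D * ((real n / y) ^ r * (g (env \<omega>) * bx (env \<omega>) i ^ r))) \<partial>M)"
    using gint D y0 by (intro nn_integral_eq_integral[symmetric] integrable_mult_right) (auto simp: g_def)
  finally have m2: "emeasure M S2 \<le> (\<integral>\<^sup>+\<omega>. ennreal (D * ((real n / y) ^ r * (g (env \<omega>) * bx (env \<omega>) i ^ r))) \<partial>M)" .
  have m1: "emeasure M S1 = (\<integral>\<^sup>+\<omega>. indicator S1 \<omega> \<partial>M)" using S by simp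
  have "{\<omega> \<in> space M. y \<le> real (num_balls n i \<omega>)} \<subseteq> S1 \<union> S2" by (auto simp: S1_def S2_def)
  hence "emeasure M {\<omega> \<in> space M. y \<le> real (num_balls n i \<omega>)} \<le> emeasure M (S1 \<union> S2)" by (intro emeasure_mono) auto
  also have "\<dots> \<le> emeasure M S1 + emeasure M S2" by (intro emeasure_subadditive S)
  also have "\<dots> \<le> (\<integral>\<^sup>+\<omega>. indicator S1 \<omega> \<partial>M) + (\<integral>\<^sup>+\<omega>. ennreal (D * ((real n / y) ^ r * (g (env \<omega>) * bx (env \<omega>) i ^ r))) \<partial>M)"
    using m1 m2 by (intro add_mono) auto
  also have "\<dots> = (\<integral>\<^sup>+\<omega>. indicator S1 \<omega> + ennreal (D * ((real n / y) ^ r * (g (env \<omega>) * bx (env \<omega>) i ^ r))) \<partial>M)"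
    using bxm measurable_compose[OF measurable_environment g] by (intro nn_integral_add[symmetric]) auto
  also have "\<dots> \<le> (\<integral>\<^sup>+\<omega>. ennreal ((1 + D) * (real n / y) powr \<theta>) * ennreal (bx (env \<omega>) i powr \<theta>) \<partial>M)"
  proof (rule nn_integral_mono)
    fix \<omega> assume \<omega>: "\<omega> \<in> space M"
    let ?p = "bx (env \<omega>) i"
    let ?u = "real n / y * ?p"
    have nx: "real n / y = 1 / x" by (simp add: x_def)
    have up: "?u powr \<theta> = (real n / y) powr \<theta> * ?p powr \<theta>" using y0 by (subst powr_mult) auto
    have "indicator S1 \<omega> \<le> ennreal (?u powr \<theta>)"
    proof (cases "\<omega> \<in> S1")
      case True
      hence "1 \<le> ?u" using x0 unfolding nx by (simp add: S1_def)
      hence "1 \<le> ?u powr \<theta>" using \<theta> by (intro ge_one_powr_ge_zero) auto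
      thus ?thesis using True by (simp flip: ennreal_1)
    qed simp
    moreover have "(real n / y) ^ r * (g (env \<omega>) * ?p ^ r) \<le> ?u powr \<theta>"
    proof (cases "?p \<le> x \<and> ?p > 0")
      case True
      hence u: "0 < ?u" "?u \<le> 1" using x0 unfolding nx by auto
      have "(real n / y) ^ r * (g (env \<omega>) * ?p ^ r) \<le> (real n / y) ^ r * (1 * ?p ^ r)"
        using y0 by (intro mult_left_mono mult_right_mono) (auto simp: g_def)
      also have "\<dots> = ?u ^ r" by (simp only: mult_1_left power_mult_distrib)
      also have "?u ^ r = ?u powr real r" using u by (simp add: powr_realpow)
      also have "\<dots> \<le> ?u powr \<theta>" using u \<theta> by (intro powr_mono') auto
      finally show ?thesis .
    next
      case False
      have "?p = 0 \<or> ?p > x" using False bx_nonneg[of "env \<omega>" i] by linarith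
      thus ?thesis using r by (auto simp: g_def power_0_left)
    qed
    hence "D * ((real n / y) ^ r * (g (env \<omega>) * ?p ^ r)) \<le> D * ?u powr \<theta>" using D by (intro mult_left_mono) auto
    ultimately have "indicator S1 \<omega> + ennreal (D * ((real n / y) ^ r * (g (env \<omega>) * ?p ^ r)))
      \<le> ennreal (?u powr \<theta>) + ennreal (D * ?u powr \<theta>)" by (intro add_mono ennreal_leI) auto
    also have "\<dots> = ennreal ((1 + D) * ?u powr \<theta>)" using D by (simp add: distrib_right flip: ennreal_plus)
    also have "\<dots> = ennreal ((1 + D) * (real n / y) powr \<theta>) * ennreal (?p powr \<theta>)"
      unfolding up using D by (simp add: ennreal_mult[symmetric] mult.assoc)
    finally show "indicator S1 \<omega> + ennreal (D * ((real n / y) ^ r * (g (env \<omega>) * ?p ^ r)))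
      \<le> ennreal ((1 + D) * (real n / y) powr \<theta>) * ennreal (?p powr \<theta>)" .
  qed
  also have "\<dots> = ennreal ((1 + D) * (real n / y) powr \<theta>) * (\<integral>\<^sup>+\<omega>. ennreal (bx (env \<omega>) i powr \<theta>) \<partial>M)"
    using bxm by (intro nn_integral_cmult) auto
  also have "(\<integral>\<^sup>+\<omega>. ennreal (bx (env \<omega>) i powr \<theta>) \<partial>M) = (\<integral>\<^sup>+e. ennreal (bx e i powr \<theta>) \<partial>PE)"
    by (rule nn_integral_environment) measurable
  finally show ?thesis by (simp add: D_def)
qed

lemma emeasure_ex_count_ge:
  assumes \<theta>: "0 < \<theta>" "\<theta> \<le> real r" and r: "1 \<le> r" and y: "real r \<le> y" and n: "1 \<le> n"
  shows "emeasure M {\<omega> \<in> space M. \<exists>i. length i = k \<and> y \<le> real (num_balls n i \<omega>)}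
    \<le> ennreal ((1 + real r ^ r) * (real n / y) powr \<theta>) * L_fun \<nu> \<theta> ^ k"
proof -
  have "emeasure M {\<omega> \<in> space M. \<exists>i. length i = k \<and> y \<le> real (num_balls n i \<omega>)}
     = emeasure M (\<Union>i\<in>{i. length i = k}. {\<omega> \<in> space M. y \<le> real (num_balls n i \<omega>)})"
    by (intro arg_cong[where f="emeasure M"]) auto
  also have "\<dots> \<le> (\<integral>\<^sup>+i. emeasure M {\<omega> \<in> space M. y \<le> real (num_balls n i \<omega>)} \<partial>count_space {i. length i = k})"
    by (intro emeasure_UN_le_nn_integral) measurable
  also have "\<dots> \<le> (\<integral>\<^sup>+i. ennreal ((1 + real r ^ r) * (real n / y) powr \<theta>) * (\<integral>\<^sup>+e. ennreal (bx e i powr \<theta>) \<partial>PE) \<partial>count_space {i. length i = k})"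
    by (intro nn_integral_mono emeasure_count_ge assms)
  also have "\<dots> = ennreal ((1 + real r ^ r) * (real n / y) powr \<theta>) * L_fun \<nu> \<theta> ^ k"
    by (subst nn_integral_cmult) (simp_all add: many_to_one_powr)
  finally show ?thesis .
qed

text \<open>Chebyshev's inequality given the environment: \<open>4 (N / (n p) - 1)^2\<close> is at
  least 1 wherever \<open>N < n x / 2\<close> and \<open>p >= x\<close>. Its mean is computed from
  factorial moments weighted by powers of \<open>1 / p\<close>, which are bounded because
  \<open>p >= x\<close> on \<open>Q\<close>.\<close>

lemma measure_count_small:
  assumes Q: "Q \<in> sets PE" and Qx: "\<And>e. e \<in> Q \<Longrightarrow> x \<le> bx e i" and x: "x > 0" and n: "1 \<le> n"
  shows "measure M {\<omega> \<in> space M. env \<omega> \<in> Q \<and> real (num_balls n i \<omega>) < real n * x / 2}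
    \<le> 4 / (real n * x) * measure M {\<omega> \<in> space M. env \<omega> \<in> Q}"
proof -
  define g0 where "g0 e = indicat_real Q e" for e
  define g1 where "g1 e = indicat_real Q e / bx e i" for e
  define g2 where "g2 e = indicat_real Q e / (bx e i)\<^sup>2" for e
  have g [measurable]: "g0 \<in> borel_measurable PE" "g1 \<in> borel_measurable PE" "g2 \<in> borel_measurable PE"
    unfolding g0_def g1_def g2_def using Q by measurable
  have b: "\<bar>g0 e\<bar> \<le> 1" "\<bar>g1 e\<bar> \<le> 1 / x" "\<bar>g2 e\<bar> \<le> 1 / x\<^sup>2" for e
    using Qx[of e] x by (auto simp: g0_def g1_def g2_def indicator_def intro!: divide_left_mono power_mono mult_pos_pos)
  let ?P = "measure M {\<omega> \<in> space M. env \<omega> \<in> Q}"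
  have Qs: "{\<omega> \<in> space M. env \<omega> \<in> Q} \<in> sets M"
    using measurable_sets[OF measurable_environment Q] by (simp add: vimage_def Int_def conj_commute)
  have P: "(\<integral>\<omega>. g0 (env \<omega>) \<partial>M) = ?P"
  proof -
    have "(\<integral>\<omega>. g0 (env \<omega>) \<partial>M) = (\<integral>\<omega>. indicat_real {\<omega> \<in> space M. env \<omega> \<in> Q} \<omega> \<partial>M)"
      by (intro Bochner_Integration.integral_cong refl) (simp add: g0_def indicator_def)
    thus ?thesis using Qs by simp
  qed
  let ?N = "\<lambda>\<omega>. real (num_balls n i \<omega>)"
  have I1: "(\<integral>\<omega>. g2 (env \<omega>) * ?N \<omega> \<partial>M) = real n * (\<integral>\<omega>. g1 (env \<omega>) \<partial>M)" "integrable M (\<lambda>\<omega>. g2 (env \<omega>) * ?N \<omega>)"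
  proof -
    have "g2 e * bx e i = g1 e" for e using Qx[of e] x by (auto simp: g1_def g2_def indicator_def power2_eq_square)
    thus "(\<integral>\<omega>. g2 (env \<omega>) * ?N \<omega> \<partial>M) = real n * (\<integral>\<omega>. g1 (env \<omega>) \<partial>M)" "integrable M (\<lambda>\<omega>. g2 (env \<omega>) * ?N \<omega>)"
      using integral_env_choose[OF g(3) b(3), of n i 1] by simp_all
  qed
  have I2: "(\<integral>\<omega>. g2 (env \<omega>) * real (num_balls n i \<omega> choose 2) \<partial>M) = real (n choose 2) * ?P"
     "integrable M (\<lambda>\<omega>. g2 (env \<omega>) * real (num_balls n i \<omega> choose 2))"
  proof -
    have "g2 e * (bx e i)\<^sup>2 = g0 e" for e using Qx[of e] x by (auto simp: g0_def g2_def indicator_def)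
    thus "(\<integral>\<omega>. g2 (env \<omega>) * real (num_balls n i \<omega> choose 2) \<partial>M) = real (n choose 2) * ?P"
       "integrable M (\<lambda>\<omega>. g2 (env \<omega>) * real (num_balls n i \<omega> choose 2))"
      using integral_env_choose[OF g(3) b(3), of n i 2] P by simp_all
  qed
  have I3: "(\<integral>\<omega>. g1 (env \<omega>) * ?N \<omega> \<partial>M) = real n * ?P" "integrable M (\<lambda>\<omega>. g1 (env \<omega>) * ?N \<omega>)"
  proof -
    have "g1 e * bx e i = g0 e" for e using Qx[of e] x by (auto simp: g0_def g1_def indicator_def)
    thus "(\<integral>\<omega>. g1 (env \<omega>) * ?N \<omega> \<partial>M) = real n * ?P" "integrable M (\<lambda>\<omega>. g1 (env \<omega>) * ?N \<omega>)"
      using integral_env_choose[OF g(2) b(2), of n i 1] P by simp_all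
  qed
  have I4: "integrable M (\<lambda>\<omega>. g0 (env \<omega>))" "integrable M (\<lambda>\<omega>. g1 (env \<omega>))"
    using integrable_bounded_env(2)[OF g(1) b(1), of "{}"] integrable_bounded_env(2)[OF g(2) b(2), of "{}"] by auto
  have G1: "(\<integral>\<omega>. g1 (env \<omega>) \<partial>M) \<le> ?P / x"
  proof -
    have "(\<integral>\<omega>. g1 (env \<omega>) \<partial>M) \<le> (\<integral>\<omega>. g0 (env \<omega>) / x \<partial>M)"
      using I4 Qx x by (intro integral_mono)
        (auto simp: g0_def g1_def indicator_def intro!: divide_left_mono mult_pos_pos less_le_trans[OF x Qx])
    thus ?thesis using P by simp
  qed
  define S where "S = {\<omega> \<in> space M. env \<omega> \<in> Q \<and> real (num_balls n i \<omega>) < real n * x / 2}"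
  have S: "S \<in> sets M"
  proof -
    have "S = {\<omega> \<in> space M. env \<omega> \<in> Q} \<inter> {\<omega> \<in> space M. real (num_balls n i \<omega>) < real n * x / 2}" by (auto simp: S_def)
    thus ?thesis using Qs by simp
  qed
  \<comment> \<open>The square on \<open>Q\<close>, expanded with
    \<open>N^2 = N + 2 (N choose 2)\<close>.\<close>
  let ?F = "\<lambda>\<omega>. 4 / (real n)\<^sup>2 * (g2 (env \<omega>) * ?N \<omega>) + 8 / (real n)\<^sup>2 * (g2 (env \<omega>) * real (num_balls n i \<omega> choose 2))
     - 8 / real n * (g1 (env \<omega>) * ?N \<omega>) + 4 * g0 (env \<omega>)"
  have "measure M S = (\<integral>\<omega>. indicator S \<omega> \<partial>M)" using S by simp
  also have "\<dots> \<le> (\<integral>\<omega>. ?F \<omega> \<partial>M)"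
  proof (rule integral_mono)
    show "integrable M (indicat_real S)" using S by (simp add: less_top[symmetric])
    show "integrable M ?F" using I1 I2 I3 I4 by simp
    fix \<omega> assume \<omega>: "\<omega> \<in> space M"
    show "indicator S \<omega> \<le> ?F \<omega>"
    proof (cases "env \<omega> \<in> Q")
      case False
      thus ?thesis by (simp add: g0_def g1_def g2_def S_def)
    next
      case True
      let ?p = "bx (env \<omega>) i"
      have p: "?p \<ge> x" "?p > 0" using Qx[OF True] x by auto
      have ch: "real (num_balls n i \<omega> choose 2) = ?N \<omega> * (?N \<omega> - 1) / 2" 
      proof -
        have "2 * (num_balls n i \<omega> choose 2) = num_balls n i \<omega> * (num_balls n i \<omega> - 1)" by (rule two_times_choose_two)
        hence "2 * real (num_balls n i \<omega> choose 2) = real (num_balls n i \<omega> * (num_balls n i \<omega> - 1))" by (metis of_nat_mult of_nat_numeral)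
        thus ?thesis by (cases "num_balls n i \<omega>") (auto simp: algebra_simps)
      qed
      have F: "?F \<omega> = 4 * (?N \<omega> / (real n * ?p) - 1)\<^sup>2"
        using p n True unfolding ch g0_def g1_def g2_def by (simp add: power2_eq_square field_simps)
      show ?thesis
      proof (cases "\<omega> \<in> S")
        case True
        have "?N \<omega> < real n * x / 2" using True by (simp add: S_def)
        also have "\<dots> \<le> real n * ?p / 2" using p by (simp add: mult_left_mono)
        finally have "?N \<omega> / (real n * ?p) < 1 / 2" using p n by (simp add: field_simps)
        hence "1 / 2 \<le> 1 - ?N \<omega> / (real n * ?p)" by simp
        hence "(1 / 2)\<^sup>2 \<le> (1 - ?N \<omega> / (real n * ?p))\<^sup>2" by (intro power_mono) auto
        hence "1 \<le> 4 * (?N \<omega> / (real n * ?p) - 1)\<^sup>2" by (simp add: power2_commute power_divide)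
        thus ?thesis unfolding F using True by simp
      next
        case False
        thus ?thesis unfolding F by simp
      qed
    qed
  qed
  also have "\<dots> = 4 / (real n)\<^sup>2 * (real n * (\<integral>\<omega>. g1 (env \<omega>) \<partial>M)) + 8 / (real n)\<^sup>2 * (real (n choose 2) * ?P)
     - 8 / real n * (real n * ?P) + 4 * ?P"
    using I1 I2 I3 I4 P by simp
  \<comment> \<open>The main terms cancel, 4 - 8 + 4 = 0, and only the variance term
    remains.\<close>
  also have "\<dots> \<le> 4 / (real n)\<^sup>2 * (real n * (?P / x)) + 4 * ?P - 8 * ?P + 4 * ?P"
  proof -
    have ch: "8 / (real n)\<^sup>2 * (real (n choose 2) * ?P) \<le> 4 * ?P"
    proof -
      have "2 * (n choose 2) = n * (n - 1)" by (rule two_times_choose_two)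
      hence "2 * (n choose 2) \<le> n * n" by simp
      hence "2 * real (n choose 2) \<le> (real n)\<^sup>2"
        by (metis of_nat_mono of_nat_mult of_nat_numeral power2_eq_square)
      hence "8 / (real n)\<^sup>2 * real (n choose 2) \<le> 4" using n by (simp add: field_simps)
      hence "8 / (real n)\<^sup>2 * real (n choose 2) * ?P \<le> 4 * ?P" by (intro mult_right_mono) auto
      thus ?thesis by simp
    qed
    have "4 / (real n)\<^sup>2 * (real n * (\<integral>\<omega>. g1 (env \<omega>) \<partial>M)) \<le> 4 / (real n)\<^sup>2 * (real n * (?P / x))"
      using G1 by (intro mult_left_mono) auto
    moreover have "8 / real n * (real n * ?P) = 8 * ?P" using n by simp
    ultimately show ?thesis using ch by linarith
  qed
  also have "\<dots> = 4 / (real n * x) * ?P" using n by (simp add: power2_eq_square)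
  finally show ?thesis by (simp add: S_def)
qed

text \<open>Chebyshev's inequality is applied to the first large box in a fixed enumeration only, which avoids a
  union bound.\<close>

lemma measure_no_full_box:
  assumes x: "x > 0" and n: "1 \<le> n"
  shows "emeasure M {\<omega> \<in> space M. (\<exists>i. length i = k \<and> x \<le> bx (env \<omega>) i) \<and>
      \<not> (\<exists>i. length i = k \<and> x \<le> bx (env \<omega>) i \<and> real n * x / 2 \<le> real (num_balls n i \<omega>))}
    \<le> ennreal (4 / (real n * x))" (is "emeasure M ?E \<le> _")
proof -
  define Q where "Q i = {e \<in> space PE. length i = k \<and> x \<le> bx e i \<and>
      (\<forall>i'. length i' = k \<longrightarrow> to_nat i' < to_nat i \<longrightarrow> bx e i' < x)}" for i :: "nat list"
  have Q [measurable]: "Q i \<in> sets PE" for i unfolding Q_def by measurable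
  have disj: "disjoint_family Q"
    unfolding disjoint_family_on_def
  proof (intro ballI impI)
    fix i j :: "nat list" assume "i \<noteq> j"
    hence "to_nat i < to_nat j \<or> to_nat j < to_nat i" using injD[OF inj_to_nat] by (metis linorder_neqE_nat)
    thus "Q i \<inter> Q j = {}" by (fastforce simp: Q_def)
  qed
  define R where "R i = {\<omega> \<in> space M. env \<omega> \<in> Q i}" for i
  define F where "F i = {\<omega> \<in> space M. env \<omega> \<in> Q i \<and> real (num_balls n i \<omega>) < real n * x / 2}" for i
  have R: "R i \<in> sets M" for i
    using measurable_sets[OF measurable_environment Q] by (simp add: R_def vimage_def Int_def conj_commute)
  have F: "F i \<in> sets M" for i
  proof -
    have "F i = R i \<inter> {\<omega> \<in> space M. real (num_balls n i \<omega>) < real n * x / 2}" by (auto simp: F_def R_def)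
    thus ?thesis using R by simp
  qed
  have "?E \<subseteq> (\<Union>i. F i)"
  proof
    fix \<omega> assume \<omega>: "\<omega> \<in> ?E"
    define T where "T = {i. length i = k \<and> x \<le> bx (env \<omega>) i}"
    define i where "i = (ARG_MIN to_nat i. i \<in> T)"
    have "\<exists>i. i \<in> T" using \<omega> by (auto simp: T_def)
    hence i: "i \<in> T" "\<And>j. j \<in> T \<Longrightarrow> to_nat i \<le> to_nat j"
      unfolding i_def using arg_min_nat_lemma[of "\<lambda>i. i \<in> T"] by blast+
    have "env \<omega> \<in> Q i" using i \<omega> measurable_space[OF measurable_environment] by (force simp: Q_def T_def)
    thus "\<omega> \<in> (\<Union>i. F i)" using i \<omega> by (auto simp: F_def T_def not_le intro!: exI[of _ i])
  qed
  hence "emeasure M ?E \<le> emeasure M (\<Union>i. F i)" using F by (intro emeasure_mono) auto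
  also have "\<dots> \<le> (\<integral>\<^sup>+i. emeasure M (F i) \<partial>count_space UNIV)"
    by (rule emeasure_UN_le_nn_integral) (rule F)
  also have "\<dots> \<le> (\<integral>\<^sup>+i. ennreal (4 / (real n * x)) * emeasure M (R i) \<partial>count_space UNIV)"
  proof (rule nn_integral_mono)
    fix i
    have "measure M (F i) \<le> 4 / (real n * x) * measure M (R i)"
      unfolding F_def R_def by (rule measure_count_small[OF Q _ x n]) (simp add: Q_def)
    thus "emeasure M (F i) \<le> ennreal (4 / (real n * x)) * emeasure M (R i)"
      using x by (simp add: emeasure_eq_measure ennreal_mult[symmetric] ennreal_leI)
  qed
  also have "\<dots> = ennreal (4 / (real n * x)) * (\<integral>\<^sup>+i. emeasure M (R i) \<partial>count_space UNIV)"
    by (rule nn_integral_cmult) simp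
  also have "(\<integral>\<^sup>+i. emeasure M (R i) \<partial>count_space UNIV) = emeasure M (\<Union>i. R i)"
    using R disj by (intro emeasure_UN_countable[symmetric]) (auto simp: disjoint_family_on_def R_def)
  also have "\<dots> \<le> 1" by (rule emeasure_le_1)
  finally show ?thesis by (simp add: mult_left_mono)
qed

section \<open>From full boxes to heights\<close>

lemma height_le:
  assumes "\<And>i. length i = k \<Longrightarrow> real (num_balls n i \<omega>) < y"
  shows "height \<rho> \<xi> \<omega> n y \<le> enat k"
  unfolding height_def using assms by (intro Inf_lower) (auto simp: num_balls_def)

text \<open>Ball counts and sizes only grow towards the root, so every ancestor of \<open>i\<close>
  is a box with at least \<open>y\<close> balls. No generation up to \<open>k\<close> qualifies in
  the infimum, hence the \<open>Suc\<close>. An empty set, with infimum infinity, is covered as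
  well.\<close>

lemma height_ge:
  assumes i: "length i = k" "0 < bx (env \<omega>) i" "y \<le> real (num_balls n i \<omega>)"
  shows "enat (Suc k) \<le> height \<rho> \<xi> \<omega> n y"
  unfolding height_def
proof (rule Inf_greatest, clarify)
  fix k' assume *: "\<forall>i. length i = k' \<and> 0 < box_size \<rho> \<omega> i \<longrightarrow> real (balls_in_box \<xi> \<omega> n i) < y"
  show "enat (Suc k) \<le> enat k'"
  proof (rule ccontr)
    assume "\<not> enat (Suc k) \<le> enat k'"
    hence k': "k' \<le> k" by simp
    let ?j = "take k' i"
    have len: "length ?j = k'" using k' i by simp
    have "bx (env \<omega>) i = bx (env \<omega>) ?j * bx (\<lambda>j. env \<omega> (?j @ j)) (drop k' i)"
      by (subst bx_append[symmetric]) simp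
    hence pos: "0 < bx (env \<omega>) ?j" using i(2) bx_nonneg[of "env \<omega>" ?j] by (metis less_eq_real_def mult_zero_left)
    have "balls_in_box \<xi> \<omega> n i \<le> balls_in_box \<xi> \<omega> n ?j"
      unfolding balls_in_box_def
    proof (rule card_mono)
      show "{m. m < n \<and> stake (length i) (\<xi> m \<omega>) = i} \<subseteq> {m. m < n \<and> stake (length ?j) (\<xi> m \<omega>) = ?j}"
      proof clarify
        fix m assume m: "stake (length i) (\<xi> m \<omega>) = i"
        have "take k' (stake (length i) (\<xi> m \<omega>)) = stake k' (\<xi> m \<omega>)" using k' i by (simp add: take_stake min_def)
        thus "stake (length ?j) (\<xi> m \<omega>) = ?j" using m len by simp
      qed
    qed simp
    moreover have "real (balls_in_box \<xi> \<omega> n ?j) < y"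
      using * len pos by (auto simp: box_size_eq_bx env_def)
    ultimately show False using i(3) by (simp add: num_balls_def)
  qed
qed

lemma count_mono: "n \<le> n' \<Longrightarrow> num_balls n i \<omega> \<le> num_balls n' i \<omega>"
  unfolding num_balls_def balls_in_box_def by (intro card_mono) auto

end

section \<open>Heights\<close>

text \<open>\<open>J n\<close> is the integer part of the binary logarithm of \<open>n\<close>, with
  an unspecified value at 0. It links the Borel-Cantelli estimates along powers of 2 to all
  \<open>n\<close>, through monotonicity of the counts.\<close>

lemma dyadic_index:
  obtains J :: "nat \<Rightarrow> nat" where "filterlim J at_top sequentially"
    "\<And>n. 1 \<le> n \<Longrightarrow> 2 ^ J n \<le> n" "\<And>n. 1 \<le> n \<Longrightarrow> n < 2 ^ (J n + 1)"
proof -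
  have "\<exists>j. 1 \<le> n \<longrightarrow> 2 ^ j \<le> n \<and> n < 2 ^ (j + 1)" for n :: nat
    using ex_power_ivl1[of 2 n] by auto
  then obtain J where J: "\<And>n :: nat. 1 \<le> n \<Longrightarrow> 2 ^ J n \<le> n \<and> n < 2 ^ (J n + 1)" by metis
  have "filterlim J at_top sequentially"
    unfolding filterlim_at_top
  proof
    fix Z
    show "\<forall>\<^sub>F n in sequentially. Z \<le> J n"
      using eventually_ge_at_top[of "2 ^ Z"]
    proof eventually_elim
      case (elim n)
      have "1 \<le> n" using elim order_trans[of 1 "2 ^ Z" n] by simp
      hence "(2::nat) ^ Z < 2 ^ (J n + 1)" using J[of n] elim by linarith
      thus ?case by (simp del: power_Suc)
    qed
  qed
  thus ?thesis using that[of J] J by blast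
qed

lemma dyadic_bounds:
  assumes "2 ^ j \<le> n" "n < 2 ^ (j + 1)"
  shows "real j * ln 2 \<le> ln (real n)" "ln (real n) \<le> real j * ln 2 + ln 2"
proof -
  have n: "n > 0" using assms(1) by (metis gr0I le_zero_eq power_not_zero zero_neq_numeral)
  have "(2::real) ^ j \<le> real n" using assms(1) by (metis of_nat_le_iff of_nat_numeral of_nat_power)
  hence "ln ((2::real) ^ j) \<le> ln (real n)" using n by simp
  thus "real j * ln 2 \<le> ln (real n)" by (simp add: ln_realpow)
  have "real n \<le> (2::real) ^ (j + 1)" using assms(2) by (metis less_imp_le of_nat_le_iff of_nat_numeral of_nat_power)
  hence "ln (real n) \<le> ln ((2::real) ^ (j + 1))" using n by simp
  thus "ln (real n) \<le> real j * ln 2 + ln 2" by (simp only: ln_realpow) (simp add: algebra_simps)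
qed

lemma eventually_ln_ln_ge: "\<forall>\<^sub>F n in sequentially. c \<le> ln (ln (real n))"
  by real_asymp

lemma ln_dyadic_le:
  assumes "2 ^ j \<le> n" "n < 2 ^ (j + 1)" "1 \<le> j" "2 \<le> ln (real n)"
  shows "ln (real j) \<le> 2 * ln (ln (real n))"
proof -
  have ln2: "1 / 2 \<le> ln (2::real)" using ln_ge_iff[of 2 "1/2"] exp_half_le2 by simp
  have "real j * (1 / 2) \<le> real j * ln 2" using ln2 by (intro mult_left_mono) auto
  also have "\<dots> \<le> ln (real n)" by (rule dyadic_bounds(1)[OF assms(1,2)])
  finally have "real j \<le> 2 * ln (real n)" by simp
  also have "\<dots> \<le> ln (real n) * ln (real n)" using assms(4) by (intro mult_right_mono) auto
  finally have "ln (real j) \<le> ln (ln (real n) * ln (real n))" using assms(3,4) by (intro ln_mono) auto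
  thus ?thesis using assms(4) by (simp add: ln_mult)
qed

text \<open>Here \<open>t\<close> stands for \<open>\<theta>\<^sup>*\<close>, and \<open>J n\<close> is the dyadic scale of \<open>n\<close>.\<close>

locale occupancy_setting = nested_occupancy +
  fixes \<alpha> t :: real and J :: "nat \<Rightarrow> nat"
  assumes nongeom: "\<not> geometric_law \<nu>"
    and \<alpha>: "0 < \<alpha>" "\<alpha> < 1"
    and t: "t > 1"
    and J_lim: "filterlim J at_top sequentially"
    and J1: "\<And>n. 1 \<le> n \<Longrightarrow> 2 ^ J n \<le> n" and J2: "\<And>n. 1 \<le> n \<Longrightarrow> n < 2 ^ (J n + 1)"

sublocale occupancy_setting \<subseteq> nongeom_law \<nu>
  by unfold_locales (rule nongeom)

section \<open>Almost sure bounds on the height\<close>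

context occupancy_setting
begin

definition mu where "mu = \<mu> t"

lemma mu: "mu > 0" unfolding mu_def by (rule mu_pos[OF t])

abbreviation H :: "'a \<Rightarrow> nat \<Rightarrow> enat" where
  "H \<omega> n \<equiv> height \<rho> \<xi> \<omega> n (real n powr \<alpha>)"

lemma eventually_J: "eventually P sequentially \<Longrightarrow> \<forall>\<^sub>F n in sequentially. P (J n)"
  by (rule eventually_compose_filterlim[OF _ J_lim])

lemma L_fun_t: "L_fun \<nu> t = ennreal (lap.G 0 t)"
proof -
  have "L_fun \<nu> t < \<infinity>" using lap.integrable_G[OF t, of 0] integrable_lam_iff[of t] by simp
  thus ?thesis by (simp add: L_real_eq_G[symmetric] L_real_def)
qed

lemma AE_height_upper:
  assumes crit: "ln (lap.G 0 t) + t * mu = 0"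
  obtains K where "K > 0" "AE \<omega> in M. \<forall>\<^sub>F n in sequentially.
    ereal_of_enat (H \<omega> n) \<le> ereal ((1 - \<alpha>) / mu * ln (real n) + K * ln (ln (real n)))"
proof -
  \<comment> \<open>\<open>t \<kappa> = 2\<close> turns the logarithmic correction in
    \<open>k j\<close> into the summable factor \<open>j^(-2)\<close>.\<close>
  define \<kappa> where "\<kappa> = 2 / t"
  have \<kappa>: "\<kappa> > 0" "t * \<kappa> = 2" using t by (auto simp: \<kappa>_def)
  define k where "k j = nat \<lceil>((1 - \<alpha>) * (real j * ln 2) + \<kappa> * ln (real j)) / mu\<rceil>" for j
  have k0: "0 \<le> ((1 - \<alpha>) * (real j * ln 2) + \<kappa> * ln (real j)) / mu" if "1 \<le> j" for j
    using that \<alpha> \<kappa> mu by (intro divide_nonneg_nonneg add_nonneg_nonneg mult_nonneg_nonneg) auto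
  have k1: "(1 - \<alpha>) * (real j * ln 2) + \<kappa> * ln (real j) \<le> mu * real (k j)" if "1 \<le> j" for j
  proof -
    have "((1 - \<alpha>) * (real j * ln 2) + \<kappa> * ln (real j)) / mu \<le> real (k j)" unfolding k_def using k0[OF that] by linarith
    thus ?thesis using mu by (simp add: pos_divide_le_eq mult.commute)
  qed
  have k2: "real (k j) \<le> ((1 - \<alpha>) * (real j * ln 2) + \<kappa> * ln (real j)) / mu + 1" if "1 \<le> j" for j
    unfolding k_def using k0[OF that] by linarith
  \<comment> \<open>\<open>emeasure_count_ge\<close> needs a factorial moment of order at least the
    exponent \<open>t\<close>.\<close>
  define r where "r = nat \<lceil>t\<rceil>"
  have r: "t \<le> real r" "1 \<le> r" unfolding r_def using t by linarith+
  define y where "y j = (2::real) powr (real j * \<alpha>)" for j :: nat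
  \<comment> \<open>The worst case for all \<open>n\<close> between \<open>2^j\<close> and
    \<open>2^(j+1)\<close>: the largest number of balls against the smallest threshold.\<close>
  define E where "E j = {\<omega> \<in> space M. \<exists>i. length i = k j \<and> y j \<le> real (num_balls (2 ^ (j + 1)) i \<omega>)}" for j
  have E: "E j \<in> sets M" for j unfolding E_def by measurable
  define D where "D = (1 + real r ^ r) * 2 powr t"
  have D: "D > 0" by (simp add: D_def add_pos_nonneg)
  have bound: "measure M (E j) \<le> D * real j powr (- 2)" if j: "1 \<le> j" and ry: "real r \<le> y j" for j
  proof -
    have G0: "lap.G 0 t > 0" by (rule G_pos[OF t])
    have "emeasure M (E j) \<le> ennreal ((1 + real r ^ r) * (real (2 ^ (j + 1)) / y j) powr t) * L_fun \<nu> t ^ k j"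
      unfolding E_def using t r ry by (intro emeasure_ex_count_ge) auto
    also have "\<dots> = ennreal ((1 + real r ^ r) * (real (2 ^ (j + 1)) / y j) powr t * lap.G 0 t ^ k j)"
      using G0 by (simp add: L_fun_t ennreal_power ennreal_mult)
    finally have "measure M (E j) \<le> (1 + real r ^ r) * (real (2 ^ (j + 1)) / y j) powr t * lap.G 0 t ^ k j"
      using G0 by (simp add: emeasure_eq_measure)
    also have "(real (2 ^ (j + 1)) / y j) powr t = 2 powr t * exp (t * ((1 - \<alpha>) * (real j * ln 2)))"
    proof -
      have "real (2 ^ (j + 1)) = 2 powr (real j + 1)" by (simp add: powr_add powr_realpow)
      hence "real (2 ^ (j + 1)) / y j = 2 powr (1 + (1 - \<alpha>) * real j)"
        by (simp add: y_def powr_diff[symmetric] algebra_simps)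
      hence "(real (2 ^ (j + 1)) / y j) powr t = 2 powr ((1 + (1 - \<alpha>) * real j) * t)" by (simp add: powr_powr)
      also have "\<dots> = 2 powr t * 2 powr ((1 - \<alpha>) * real j * t)" by (simp add: distrib_right powr_add)
      also have "2 powr ((1 - \<alpha>) * real j * t) = exp (t * ((1 - \<alpha>) * (real j * ln 2)))" by (simp add: powr_def mult_ac)
      finally show ?thesis .
    qed
    also have "lap.G 0 t ^ k j \<le> exp (- (t * ((1 - \<alpha>) * (real j * ln 2) + \<kappa> * ln (real j))))"
    proof -
      have "lap.G 0 t = exp (ln (lap.G 0 t))" using G0 by simp
      also have "ln (lap.G 0 t) = - (t * mu)" using crit by linarith
      finally have "lap.G 0 t ^ k j = exp (- (t * (mu * real (k j))))" by (simp add: exp_of_nat_mult[symmetric] mult_ac)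
      also have "\<dots> \<le> exp (- (t * ((1 - \<alpha>) * (real j * ln 2) + \<kappa> * ln (real j))))"
        using k1[OF j] t by (simp add: mult_left_mono)
      finally show ?thesis .
    qed
    finally have "measure M (E j) \<le> (1 + real r ^ r) * (2 powr t * exp (t * ((1 - \<alpha>) * (real j * ln 2))))
       * exp (- (t * ((1 - \<alpha>) * (real j * ln 2) + \<kappa> * ln (real j))))"
      by (simp add: mult_left_mono add_nonneg_nonneg)
    also have "\<dots> = D * (exp (t * ((1 - \<alpha>) * (real j * ln 2))) * exp (- (t * ((1 - \<alpha>) * (real j * ln 2) + \<kappa> * ln (real j)))))"
      by (simp add: D_def)
    also have "exp (t * ((1 - \<alpha>) * (real j * ln 2))) * exp (- (t * ((1 - \<alpha>) * (real j * ln 2) + \<kappa> * ln (real j)))) = exp (- (t * \<kappa>) * ln (real j))"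
      by (subst exp_add[symmetric]) (simp add: algebra_simps)
    also have "\<dots> = real j powr (- 2)" using j \<kappa> by (simp add: powr_def)
    finally show ?thesis .
  qed
  have "AE \<omega> in M. \<forall>\<^sub>F j in sequentially. \<omega> \<in> space M - E j"
  proof (rule borel_cantelli_AE1)
    show "emeasure M (E j) < \<infinity>" for j using emeasure_finite[of "E j"] by (simp add: less_top[symmetric])
    have "filterlim (\<lambda>j. y j) at_top sequentially" unfolding y_def using \<alpha> by real_asymp
    hence "\<forall>\<^sub>F j in sequentially. real r \<le> y j" by (simp add: filterlim_at_top)
    hence ev: "\<forall>\<^sub>F j in sequentially. norm (measure M (E j)) \<le> D * real j powr (- 2)"
      using eventually_ge_at_top[of 1] by eventually_elim (use bound in simp)
    show "summable (\<lambda>j. measure M (E j))"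
      by (rule summable_comparison_test_ev[OF ev]) (intro summable_mult, simp add: summable_real_powr_iff)
  qed (rule E)
  \<comment> \<open>\<open>2 \<kappa> / mu\<close> comes from \<open>ln j <= 2 ln ln n\<close>, and
    1 from the ceiling in \<open>k j\<close>.\<close>
  define K where "K = 2 * \<kappa> / mu + 1"
  have "K > 0" using \<kappa> mu by (simp add: K_def add_pos_pos)
  moreover have "AE \<omega> in M. \<forall>\<^sub>F n in sequentially.
    ereal_of_enat (H \<omega> n) \<le> ereal ((1 - \<alpha>) / mu * ln (real n) + K * ln (ln (real n)))"
    using \<open>AE \<omega> in M. \<forall>\<^sub>F j in sequentially. \<omega> \<in> space M - E j\<close>
  proof eventually_elim
    case (elim \<omega>)
    have e2: "\<forall>\<^sub>F n in sequentially. 2 \<le> ln (real n)" by real_asymp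
    show ?case
      using eventually_J[OF elim] eventually_J[OF eventually_ge_at_top[of 1]] eventually_ge_at_top[of 1] eventually_ln_ln_ge[of 1] e2
    proof eventually_elim
      case (elim n)
      let ?j = "J n"
      note jn = J1[OF elim(3)] J2[OF elim(3)]
      have "y ?j \<le> real n powr \<alpha>"
      proof -
        have y: "y ?j = (2 ^ ?j) powr \<alpha>" by (simp add: y_def powr_powr[symmetric] powr_realpow)
        have "(2::real) ^ ?j \<le> real n" using jn(1) by (metis of_nat_le_iff of_nat_numeral of_nat_power)
        hence "((2::real) ^ ?j) powr \<alpha> \<le> real n powr \<alpha>" using \<alpha> by (intro powr_mono2) auto
        thus ?thesis unfolding y .
      qed
      hence "real (num_balls n i \<omega>) < real n powr \<alpha>" if "length i = k ?j" for i
        using elim(1) that count_mono[of n "2 ^ (?j + 1)" i \<omega>] jn(2) by (force simp: E_def)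
      hence "H \<omega> n \<le> enat (k ?j)" by (rule height_le)
      hence "ereal_of_enat (H \<omega> n) \<le> ereal_of_enat (enat (k ?j))" by (simp only: ereal_of_enat_le_iff)
      also have "\<dots> = ereal (real (k ?j))" by simp
      also have "real (k ?j) \<le> (1 - \<alpha>) / mu * ln (real n) + K * ln (ln (real n))"
      proof -
        have "real (k ?j) \<le> ((1 - \<alpha>) * (real ?j * ln 2) + \<kappa> * ln (real ?j)) / mu + 1" by (rule k2[OF elim(2)])
        also have "\<dots> \<le> ((1 - \<alpha>) * ln (real n) + \<kappa> * (2 * ln (ln (real n)))) / mu + ln (ln (real n))"
          using dyadic_bounds(1)[OF jn] ln_dyadic_le[OF jn elim(2,5)] \<alpha> \<kappa> mu elim(4)
          by (intro add_mono divide_right_mono mult_left_mono) auto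
        also have "\<dots> = (1 - \<alpha>) / mu * ln (real n) + K * ln (ln (real n))"
          using mu by (simp add: K_def field_simps)
        finally show ?thesis .
      qed
      finally show ?case by simp
    qed
  qed
  ultimately show ?thesis by (rule that)
qed

text \<open>With \<open>2^j\<close> balls, a box of size \<open>4 * 2^(-(1 - \<alpha>) j)\<close>
  expects \<open>4 * 2^(\<alpha> j)\<close> of them. Half of this,
  \<open>2 * 2^(\<alpha> j)\<close>, still exceeds the largest threshold
  \<open>2^(\<alpha> (j + 1))\<close> of the dyadic block, and by \<open>measure_no_full_box\<close>
  the failure probability is at most \<open>2^(- \<alpha> j)\<close>.\<close>

lemma AE_height_lower:
  assumes k: "AE e in PE. \<forall>\<^sub>F j in sequentially. \<exists>i. length i = k j \<and> 4 * 2 powr (- (1 - \<alpha>) * real j) \<le> bx e i"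
  shows "AE \<omega> in M. \<forall>\<^sub>F n in sequentially. enat (Suc (k (J n))) \<le> H \<omega> n"
proof -
  define x where "x j = 4 * (2::real) powr (- (1 - \<alpha>) * real j)" for j :: nat
  have x: "x j > 0" for j by (simp add: x_def)
  have nx: "real (2 ^ j) * x j = 4 * 2 powr (\<alpha> * real j)" for j
  proof -
    have "real (2 ^ j) = 2 powr (real j)" by (simp add: powr_realpow)
    thus ?thesis by (simp add: x_def algebra_simps flip: powr_add)
  qed
  define E where "E j = {\<omega> \<in> space M. (\<exists>i. length i = k j \<and> x j \<le> bx (env \<omega>) i) \<and>
      \<not> (\<exists>i. length i = k j \<and> x j \<le> bx (env \<omega>) i \<and> real (2 ^ j) * x j / 2 \<le> real (num_balls (2 ^ j) i \<omega>))}" for j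
  have bxm [measurable]: "(\<lambda>\<omega>. bx (env \<omega>) i) \<in> borel_measurable M" for i
    by (rule measurable_compose[OF measurable_environment]) measurable
  have E: "E j \<in> sets M" for j unfolding E_def by measurable
  have bound: "measure M (E j) \<le> (2 powr (- \<alpha>)) ^ j" for j
  proof -
    have "emeasure M (E j) \<le> ennreal (4 / (real (2 ^ j) * x j))"
      unfolding E_def by (rule measure_no_full_box[OF x]) simp
    hence "measure M (E j) \<le> 4 / (real (2 ^ j) * x j)" using x[of j] by (simp add: emeasure_eq_measure)
    also have "\<dots> = 2 powr (- (\<alpha> * real j))" unfolding nx by (simp add: powr_minus field_simps)
    also have "\<dots> = (2 powr (- \<alpha>)) ^ j" by (simp add: powr_powr flip: powr_realpow)
    finally show ?thesis .
  qed
  have "AE \<omega> in M. \<forall>\<^sub>F j in sequentially. \<omega> \<in> space M - E j"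
  proof (rule borel_cantelli_AE1)
    show "emeasure M (E j) < \<infinity>" for j using emeasure_finite[of "E j"] by (simp add: less_top[symmetric])
    have "2 powr (- \<alpha>) < (2::real) powr 0" using \<alpha> by (intro powr_less_mono) auto
    thus "summable (\<lambda>j. measure M (E j))"
      using bound by (intro summable_comparison_test'[OF summable_geometric[of "2 powr (- \<alpha>)"]]) auto
  qed (rule E)
  moreover have "AE \<omega> in M. \<forall>\<^sub>F j in sequentially. \<exists>i. length i = k j \<and> x j \<le> bx (env \<omega>) i"
    using AE_environment[OF k] by (simp add: x_def)
  ultimately show ?thesis
  proof eventually_elim
    case (elim \<omega>)
    show ?case
      using eventually_J[OF elim(1)] eventually_J[OF elim(2)] eventually_ge_at_top[of 1]
    proof eventually_elim
      case (elim n)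
      let ?j = "J n"
      note jn = J1[OF elim(3)] J2[OF elim(3)]
      obtain i where i: "length i = k ?j" "x ?j \<le> bx (env \<omega>) i" "real (2 ^ ?j) * x ?j / 2 \<le> real (num_balls (2 ^ ?j) i \<omega>)"
        using elim(1,2) by (auto simp: E_def)
      have "real n powr \<alpha> \<le> (2 powr (real ?j + 1)) powr \<alpha>"
      proof (rule powr_mono2)
        have "real n \<le> 2 ^ (?j + 1)" using jn(2) by (metis less_imp_le of_nat_le_iff of_nat_numeral of_nat_power)
        thus "real n \<le> 2 powr (real ?j + 1)" by (simp add: powr_add powr_realpow)
      qed (use \<alpha> in auto)
      also have "\<dots> = 2 powr (\<alpha> * real ?j + \<alpha>)" by (simp add: powr_powr algebra_simps)
      also have "\<dots> \<le> 2 powr (\<alpha> * real ?j + 1)" using \<alpha> by (intro powr_mono) auto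
      also have "\<dots> = real (2 ^ ?j) * x ?j / 2" unfolding nx by (simp add: powr_add)
      also have "\<dots> \<le> real (num_balls (2 ^ ?j) i \<omega>)" by (rule i)
      also have "\<dots> \<le> real (num_balls n i \<omega>)" using count_mono[OF jn(1)] by simp
      finally have "real n powr \<alpha> \<le> real (num_balls n i \<omega>)" .
      thus ?case using i(1,2) x[of ?j] by (intro height_ge[OF i(1)]) auto
    qed
  qed
qed

lemma AE_height_lower_first_order:
  assumes near: "\<And>\<eta>. \<eta> > 0 \<Longrightarrow> \<exists>\<theta>>1. t - \<eta> < \<theta> \<and> \<theta> < t \<and> ln (lap.G 0 \<theta>) + \<theta> * \<mu> \<theta> > 0"
    and \<epsilon>: "0 < \<epsilon>" "\<epsilon> < 1"
  shows "AE \<omega> in M. \<forall>\<^sub>F n in sequentially. ereal ((1 - 2 * \<epsilon>) * ((1 - \<alpha>) / mu * ln (real n))) \<le> ereal_of_enat (H \<omega> n)"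
proof -
  \<comment> \<open>With this bound on the speed,
    \<open>(1 - \<epsilon>) m' / mu = 1 - \<epsilon> / 2\<close>; the remaining fraction
    \<open>\<epsilon> / 2\<close> pays for the random constant \<open>N\<close> and for
    \<open>ln 4\<close>.\<close>
  define m' where "m' = mu * ((1 - \<epsilon> / 2) / (1 - \<epsilon>))"
  have "mu * 1 < m'" unfolding m'_def using mu \<epsilon> by (intro mult_strict_left_mono) (auto simp: less_divide_eq)
  hence "\<forall>\<^sub>F x in at t. \<mu> x < m'"
    using isCont_mu[OF t] unfolding isCont_def mu_def by (intro order_tendstoD) auto
  then obtain d where d: "d > 0" "\<And>x. x \<noteq> t \<Longrightarrow> dist x t < d \<Longrightarrow> \<mu> x < m'" by (auto simp: eventually_at)
  obtain \<theta> where \<theta>: "\<theta> > 1" "t - d < \<theta>" "\<theta> < t" "ln (lap.G 0 \<theta>) + \<theta> * \<mu> \<theta> > 0" using near[OF d(1)] by blast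
  have \<mu>\<theta>: "\<mu> \<theta> < m'" using \<theta> by (intro d(2)) (auto simp: dist_real_def)
  have "0 < ln (lap.G 0 \<theta> * exp (\<theta> * \<mu> \<theta>))" using \<theta>(4) G_pos[OF \<theta>(1), of 0] by (simp add: ln_mult)
  hence Lam: "Lam \<theta> > 1" using G_pos[OF \<theta>(1), of 0] unfolding Lam_def by (subst (asm) ln_gt_zero_iff) auto
  define k where "k j = nat \<lfloor>(1 - \<epsilon>) * ((1 - \<alpha>) * (real j * ln 2)) / mu\<rfloor>" for j
  have k0: "0 \<le> (1 - \<epsilon>) * ((1 - \<alpha>) * (real j * ln 2)) / mu" for j using \<epsilon> \<alpha> mu by simp
  have k1: "real (k j) \<le> (1 - \<epsilon>) * ((1 - \<alpha>) * (real j * ln 2)) / mu"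
    "(1 - \<epsilon>) * ((1 - \<alpha>) * (real j * ln 2)) / mu \<le> real (Suc (k j))" for j
    unfolding k_def using k0[of j] by linarith+
  have "AE e in PE. \<forall>\<^sub>F j in sequentially. \<exists>i. length i = k j \<and> 4 * 2 powr (- (1 - \<alpha>) * real j) \<le> bx e i"
    using AE_exp_lower[OF \<theta>(1) Lam]
  proof eventually_elim
    case (elim e)
    then obtain N :: nat where N: "\<And>m. \<exists>i. length i = m \<and> bx e i \<ge> exp (- (real m * \<mu> \<theta>) - N)" by blast
    have "\<forall>\<^sub>F j in sequentially. real N + ln 4 \<le> \<epsilon> / 2 * ((1 - \<alpha>) * (real j * ln 2))"
      using \<epsilon> \<alpha> by real_asymp
    thus ?case
    proof eventually_elim
      case (elim j)
      obtain i where i: "length i = k j" "exp (- (real (k j) * \<mu> \<theta>) - N) \<le> bx e i" using N by blast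
      have "real (k j) * \<mu> \<theta> \<le> (1 - \<epsilon>) * ((1 - \<alpha>) * (real j * ln 2)) / mu * m'"
        using k1(1)[of j] \<mu>\<theta> k0[of j] mu_pos[OF \<theta>(1)] by (intro mult_mono) auto
      also have "\<dots> = (1 - \<epsilon> / 2) * ((1 - \<alpha>) * (real j * ln 2))"
        using mu \<epsilon> by (simp add: m'_def)
      also have "\<dots> = (1 - \<alpha>) * (real j * ln 2) - \<epsilon> / 2 * ((1 - \<alpha>) * (real j * ln 2))" by (simp add: left_diff_distrib)
      finally have "ln 4 - (1 - \<alpha>) * (real j * ln 2) \<le> - (real (k j) * \<mu> \<theta>) - N" using elim by linarith
      hence "exp (ln 4 - (1 - \<alpha>) * (real j * ln 2)) \<le> exp (- (real (k j) * \<mu> \<theta>) - N)" by (simp only: exp_le_cancel_iff)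
      moreover have "exp (ln 4 - (1 - \<alpha>) * (real j * ln 2)) = 4 * 2 powr (- (1 - \<alpha>) * real j)"
        by (simp add: exp_diff exp_add powr_def exp_minus field_simps)
      ultimately show ?case using i by (intro exI[of _ i]) simp
    qed
  qed
  from AE_height_lower[OF this] show ?thesis
  proof eventually_elim
    case (elim \<omega>)
    \<comment> \<open>The second \<epsilon> in the statement absorbs the rounding of
      \<open>n\<close> to its dyadic scale.\<close>
    have "\<forall>\<^sub>F n in sequentially. (1 - \<epsilon>) * ln 2 \<le> \<epsilon> * ln (real n)" using \<epsilon> by real_asymp
    thus ?case using elim eventually_ge_at_top[of 1]
    proof eventually_elim
      case (elim n)
      note jn = J1[OF elim(3)] J2[OF elim(3)]
      have "(1 - 2 * \<epsilon>) * ln (real n) \<le> (1 - \<epsilon>) * (ln (real n) - ln 2)" using elim(1) by (simp add: algebra_simps)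
      also have "\<dots> \<le> (1 - \<epsilon>) * (real (J n) * ln 2)" using dyadic_bounds(2)[OF jn] \<epsilon> by (intro mult_left_mono) auto
      finally have "(1 - \<alpha>) / mu * ((1 - 2 * \<epsilon>) * ln (real n)) \<le> (1 - \<alpha>) / mu * ((1 - \<epsilon>) * (real (J n) * ln 2))"
        using \<alpha> mu by (intro mult_left_mono) auto
      also have "\<dots> = (1 - \<epsilon>) * ((1 - \<alpha>) * (real (J n) * ln 2)) / mu" by simp
      also have "\<dots> \<le> real (Suc (k (J n)))" by (rule k1)
      finally have "ereal ((1 - 2 * \<epsilon>) * ((1 - \<alpha>) / mu * ln (real n))) \<le> ereal_of_enat (enat (Suc (k (J n))))" by (simp add: mult_ac)
      also have "\<dots> \<le> ereal_of_enat (H \<omega> n)" using elim(2) by (simp only: ereal_of_enat_le_iff)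
      finally show ?case .
    qed
  qed
qed

lemma AE_height_lower_second_order:
  assumes crit: "ln (lap.G 0 t) + t * mu = 0" and \<delta>: "\<delta> > 0" "L_fun \<nu> (- \<delta>) < \<infinity>"
  obtains K where "K > 0" "AE \<omega> in M. \<forall>\<^sub>F n in sequentially.
    ereal ((1 - \<alpha>) / mu * ln (real n) - K * ln (ln (real n))) \<le> ereal_of_enat (H \<omega> n)"
proof -
  have G0: "lap.G 0 t > 0" by (rule G_pos[OF t])
  have "lap.G 0 t * exp (t * mu) = exp (ln (lap.G 0 t) + t * mu)" using G0 by (simp add: exp_add)
  hence Lam: "Lam t \<ge> 1" using crit by (simp add: Lam_def mu_def)
  obtain K C where K: "K > 0" and C: "C > 0" and
    KC: "AE e in PE. \<forall>\<^sub>F k in sequentially. \<exists>i. length i = k \<and> bx e i \<ge> exp (- (real k * mu)) * real k powr (- K) / C"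
    by (rule AE_critical_lower[OF t Lam \<delta>, folded mu_def]) (rule that)
  \<comment> \<open>One more than the \<open>K\<close> lost in \<open>AE_critical_lower\<close>:
    after \<open>j^(-K)\<close> is paid, one power of \<open>j\<close> is left to beat the
    constants, see \<open>ev2\<close>.\<close>
  define \<kappa> where "\<kappa> = K + 1"
  have \<kappa>: "\<kappa> > 0" using K by (simp add: \<kappa>_def)
  define F where "F j = ((1 - \<alpha>) * (real j * ln 2) - \<kappa> * ln (real j)) / mu" for j :: nat
  define k where "k j = nat \<lfloor>F j\<rfloor>" for j
  have Flim: "filterlim F at_top sequentially" unfolding F_def using \<alpha> mu \<kappa> by real_asymp
  have klim: "filterlim k at_top sequentially"
    unfolding filterlim_at_top
  proof
    fix Z
    have "\<forall>\<^sub>F j in sequentially. real Z \<le> F j" using Flim by (simp add: filterlim_at_top)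
    thus "\<forall>\<^sub>F j in sequentially. Z \<le> k j" by eventually_elim (simp add: k_def le_nat_floor)
  qed
  define c where "c = (1 - \<alpha>) * ln 2 / mu"
  have c: "c > 0" using \<alpha> mu by (simp add: c_def)
  have ev1: "\<forall>\<^sub>F j in sequentially. 1 \<le> F j" using Flim by (simp add: filterlim_at_top)
  have ev2: "\<forall>\<^sub>F j in sequentially. 4 * C * c powr K \<le> real j" by real_asymp
  have "AE e in PE. \<forall>\<^sub>F j in sequentially. \<exists>i. length i = k j \<and> 4 * 2 powr (- (1 - \<alpha>) * real j) \<le> bx e i"
    using KC
  proof eventually_elim
    case (elim e)
    from eventually_compose_filterlim[OF elim klim] ev1 ev2 eventually_ge_at_top[of 1]
    show ?case
    proof eventually_elim
      case (elim j)
      obtain i where i: "length i = k j" "exp (- (real (k j) * mu)) * real (k j) powr (- K) / C \<le> bx e i" using elim(1) by blast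
      have kF: "real (k j) \<le> F j" "1 \<le> k j" unfolding k_def using elim(2) by linarith+
      have "F j \<le> c * real j"
      proof -
        have "F j \<le> ((1 - \<alpha>) * (real j * ln 2)) / mu"
          unfolding F_def using \<kappa> elim(4) mu by (intro divide_right_mono) auto
        thus ?thesis by (simp add: c_def mult_ac)
      qed
      hence kc: "real (k j) \<le> c * real j" using kF by linarith
      have e1: "exp (- ((1 - \<alpha>) * (real j * ln 2))) * real j powr \<kappa> \<le> exp (- (real (k j) * mu))"
      proof -
        have "real (k j) * mu \<le> F j * mu" using kF mu by (intro mult_right_mono) auto
        also have "\<dots> = (1 - \<alpha>) * (real j * ln 2) - \<kappa> * ln (real j)" using mu by (simp add: F_def)
        finally have "exp (- ((1 - \<alpha>) * (real j * ln 2)) + \<kappa> * ln (real j)) \<le> exp (- (real (k j) * mu))" by simp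
        thus ?thesis using elim(4) by (simp only: exp_add) (simp add: powr_def)
      qed
      have e2: "c powr (- K) * real j powr (- K) \<le> real (k j) powr (- K)"
      proof -
        have "(c * real j) powr (- K) \<le> real (k j) powr (- K)" using kc kF K by (intro powr_mono2') auto
        thus ?thesis using c by (simp add: powr_mult)
      qed
      have "4 * 2 powr (- (1 - \<alpha>) * real j) = exp (- ((1 - \<alpha>) * (real j * ln 2))) * 4"
        by (simp add: powr_def algebra_simps)
      also have "\<dots> \<le> exp (- ((1 - \<alpha>) * (real j * ln 2))) * (real j * c powr (- K) / C)"
        using elim(3) c C by (intro mult_left_mono) (auto simp: powr_minus field_simps)
      also have "exp (- ((1 - \<alpha>) * (real j * ln 2))) * (real j * c powr (- K) / C)
        = (exp (- ((1 - \<alpha>) * (real j * ln 2))) * real j powr \<kappa>) * (c powr (- K) * real j powr (- K)) / C"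
      proof -
        have rj: "real j powr \<kappa> * real j powr (- K) = real j" using elim(4) by (simp add: \<kappa>_def flip: powr_add)
        have "E * (rj * ck / C) = (E * a) * (ck * b) / C" if "a * b = rj" for E rj ck a b :: real
          unfolding that[symmetric] by simp
        from this[OF rj] show ?thesis .
      qed
      also have "\<dots> \<le> exp (- (real (k j) * mu)) * real (k j) powr (- K) / C"
        using e1 e2 C by (intro divide_right_mono mult_mono) auto
      also have "\<dots> \<le> bx e i" by (rule i)
      finally show ?case using i by blast
    qed
  qed
  note low = AE_height_lower[OF this]
  \<comment> \<open>\<open>(1 - \<alpha>) ln 2\<close> accounts for the dyadic rounding and
    \<open>2 \<kappa>\<close> for \<open>ln j <= 2 ln ln n\<close>; the floor in \<open>k\<close> is
    offset by the \<open>Suc\<close> in \<open>AE_height_lower\<close>.\<close>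
  define K' where "K' = ((1 - \<alpha>) * ln 2 + 2 * \<kappa>) / mu"
  have "K' > 0" using \<alpha> \<kappa> mu by (auto simp: K'_def intro!: divide_pos_pos add_nonneg_pos)
  moreover from low have "AE \<omega> in M. \<forall>\<^sub>F n in sequentially.
    ereal ((1 - \<alpha>) / mu * ln (real n) - K' * ln (ln (real n))) \<le> ereal_of_enat (H \<omega> n)"
  proof eventually_elim
    case (elim \<omega>)
    have e2: "\<forall>\<^sub>F n in sequentially. 2 \<le> ln (real n)" by real_asymp
    show ?case
      using elim eventually_J[OF eventually_ge_at_top[of 1]] eventually_ge_at_top[of 1] eventually_ln_ln_ge[of 1] e2
    proof eventually_elim
      case (elim n)
      note jn = J1[OF elim(3)] J2[OF elim(3)]
      have "(1 - \<alpha>) / mu * ln (real n) - K' * ln (ln (real n))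
         = ((1 - \<alpha>) * (ln (real n) - ln 2 * ln (ln (real n))) - \<kappa> * (2 * ln (ln (real n)))) / mu"
        using mu by (simp add: K'_def field_simps)
      also have "\<dots> \<le> F (J n)"
        unfolding F_def
      proof (intro divide_right_mono diff_mono mult_left_mono)
        have "ln 2 * 1 \<le> ln 2 * ln (ln (real n))" using elim(4) by (intro mult_left_mono) auto
        thus "ln (real n) - ln 2 * ln (ln (real n)) \<le> real (J n) * ln 2" using dyadic_bounds(2)[OF jn] by linarith
        show "ln (real (J n)) \<le> 2 * ln (ln (real n))" by (rule ln_dyadic_le[OF jn elim(2,5)])
      qed (use \<alpha> \<kappa> mu in auto)
      also have "\<dots> \<le> real (Suc (k (J n)))" unfolding k_def by linarith
      finally have "ereal ((1 - \<alpha>) / mu * ln (real n) - K' * ln (ln (real n))) \<le> ereal_of_enat (enat (Suc (k (J n))))" by simp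
      also have "\<dots> \<le> ereal_of_enat (H \<omega> n)" using elim(1) by (simp only: ereal_of_enat_le_iff)
      finally show ?case .
    qed
  qed
  ultimately show ?thesis by (rule that)
qed

end

section \<open>Conclusion of the limit theorem\<close>

text \<open>The upper bound makes \<open>h n\<close> eventually finite, so the limit can be taken
  among reals. The lower bounds form a countable family, so that they hold simultaneously outside
  one null set.\<close>

lemma ereal_ratio_tendsto_1:
  fixes h :: "nat \<Rightarrow> ereal"
  assumes A: "A > 0"
    and up: "\<forall>\<^sub>F n in sequentially. h n \<le> ereal (A * ln (real n) + K * ln (ln (real n)))"
    and low: "\<And>N :: nat. \<forall>\<^sub>F n in sequentially. ereal ((1 - 2 / real (N + 2)) * (A * ln (real n))) \<le> h n"
  shows "(\<lambda>n. h n / ereal (A * ln (real n))) \<longlonglongrightarrow> 1"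
proof -
  define f where "f n = real_of_ereal (h n) / (A * ln (real n))" for n
  have pos: "\<forall>\<^sub>F n in sequentially. 0 < A * ln (real n)" using A by real_asymp
  have fin: "\<forall>\<^sub>F n in sequentially. h n = ereal (real_of_ereal (h n))"
    using up low[of 0] pos
  proof eventually_elim
    case (elim n)
    thus ?case by (cases "h n") auto
  qed
  have "f \<longlonglongrightarrow> 1"
  proof (rule order_tendstoI)
    fix a :: real assume "a < 1"
    then obtain N :: nat where N: "2 / (1 - a) < real N" using reals_Archimedean2 by blast
    hence "2 < real N * (1 - a)" using \<open>a < 1\<close> by (simp add: pos_divide_less_eq)
    also have "\<dots> \<le> real (N + 2) * (1 - a)" using \<open>a < 1\<close> by (intro mult_right_mono) auto
    finally have "2 / real (N + 2) < 1 - a" by (subst pos_divide_less_eq) (auto simp: mult.commute)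
    hence aN: "a < 1 - 2 / real (N + 2)" by linarith
    show "\<forall>\<^sub>F n in sequentially. a < f n"
      using low[of N] fin pos
    proof eventually_elim
      case (elim n)
      have "(1 - 2 / real (N + 2)) * (A * ln (real n)) \<le> real_of_ereal (h n)"
        using elim(1) by (subst (asm) elim(2)) simp
      hence "1 - 2 / real (N + 2) \<le> f n" unfolding f_def using elim(3) by (subst pos_le_divide_eq) auto
      thus ?case using aN by linarith
    qed
  next
    fix a :: real assume a: "a > 1"
    have "(\<lambda>n. (A * ln (real n) + K * ln (ln (real n))) / (A * ln (real n))) \<longlonglongrightarrow> 1" using A by real_asymp
    hence "\<forall>\<^sub>F n in sequentially. (A * ln (real n) + K * ln (ln (real n))) / (A * ln (real n)) < a"
      using a by (rule order_tendstoD)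
    thus "\<forall>\<^sub>F n in sequentially. f n < a"
      using up fin pos
    proof eventually_elim
      case (elim n)
      have "real_of_ereal (h n) \<le> A * ln (real n) + K * ln (ln (real n))"
        using elim(2) by (subst (asm) elim(3)) simp
      hence "f n \<le> (A * ln (real n) + K * ln (ln (real n))) / (A * ln (real n))"
        unfolding f_def using elim(4) by (intro divide_right_mono) auto
      thus ?case using elim(1) by linarith
    qed
  qed
  hence "(\<lambda>n. ereal (f n)) \<longlonglongrightarrow> ereal 1" by (simp only: lim_ereal)
  moreover have "\<forall>\<^sub>F n in sequentially. ereal (f n) = h n / ereal (A * ln (real n))"
    using fin pos
  proof eventually_elim
    case (elim n)
    have ne: "A \<noteq> 0" "ln (real n) \<noteq> 0" using elim(2) by auto
    show ?case by (subst elim(1)) (simp add: f_def ne)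
  qed
  ultimately have "(\<lambda>n. h n / ereal (A * ln (real n))) \<longlonglongrightarrow> ereal 1"
    by (rule Lim_transform_eventually)
  thus ?thesis by (simp add: one_ereal_def)
qed

theorem proposition1:
  fixes M :: "'w measure" and \<nu> :: "nat measure measure"
    and \<rho> :: "nat list \<Rightarrow> 'w \<Rightarrow> nat measure" and \<xi> :: "nat \<Rightarrow> 'w \<Rightarrow> nat stream"
    and \<alpha> :: real
  assumes "nested_occupancy M \<nu> \<rho> \<xi>"
    and "\<not> geometric_law \<nu>"
    and "\<theta>_star \<nu> < \<infinity>"
    and "0 < \<alpha>" and "\<alpha> < 1"
  shows
    "(AE \<omega> in M. (\<lambda>n. ereal_of_enat (height \<rho> \<xi> \<omega> n (real n powr \<alpha>)) / ereal ((1 - \<alpha>) * C_star \<nu> * ln (real n))) \<longlonglongrightarrow> 1) \<and>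
     (AE \<omega> in M. \<exists>K::real. \<forall>\<^sub>F n in sequentially.
        ereal_of_enat (height \<rho> \<xi> \<omega> n (real n powr \<alpha>)) \<le> ereal ((1 - \<alpha>) * C_star \<nu> * ln (real n) + K * ln (ln (real n)))) \<and>
     ((\<exists>\<delta>>0. L_fun \<nu> (- \<delta>) < \<infinity> \<and> num_atoms_moment \<nu> (1 + \<delta>) < \<infinity>) \<longrightarrow>
      (AE \<omega> in M. \<exists>K::real. \<forall>\<^sub>F n in sequentially.
        \<bar>ereal_of_enat (height \<rho> \<xi> \<omega> n (real n powr \<alpha>)) - ereal ((1 - \<alpha>) * C_star \<nu> * ln (real n))\<bar> \<le> ereal (K * ln (ln (real n)))))"
proof -
  interpret nested_occupancy M \<nu> \<rho> \<xi> by fact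
  interpret nongeom_law \<nu> by unfold_locales fact
  obtain t where t: "t > 1" and crit: "ln (lap.G 0 t) + t * \<mu> t = 0"
    and near: "\<And>\<eta>. \<eta> > 0 \<Longrightarrow> \<exists>\<theta>>1. t - \<eta> < \<theta> \<and> \<theta> < t \<and> ln (lap.G 0 \<theta>) + \<theta> * \<mu> \<theta> > 0"
    and C: "C_star \<nu> = 1 / \<mu> t"
    by (rule theta_star_props[OF \<open>\<theta>_star \<nu> < \<infinity>\<close>]) (rule that)
  obtain J :: "nat \<Rightarrow> nat" where J: "filterlim J at_top sequentially"
    "\<And>n. 1 \<le> n \<Longrightarrow> 2 ^ J n \<le> n" "\<And>n. 1 \<le> n \<Longrightarrow> n < 2 ^ (J n + 1)"
    by (rule dyadic_index) (rule that)
  interpret S: occupancy_setting M \<nu> \<rho> \<xi> \<alpha> t J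
    by unfold_locales (use assms t J in auto)
  define A where "A = (1 - \<alpha>) * C_star \<nu>"
  have Ae: "(1 - \<alpha>) / S.mu = A" by (simp add: A_def C S.mu_def)
  have A: "A > 0" unfolding Ae[symmetric] using S.mu \<open>\<alpha> < 1\<close> by simp
  have crit': "ln (lap.G 0 t) + t * S.mu = 0" unfolding S.mu_def by (rule crit)
  obtain K where up: "AE \<omega> in M. \<forall>\<^sub>F n in sequentially.
      ereal_of_enat (S.H \<omega> n) \<le> ereal (A * ln (real n) + K * ln (ln (real n)))"
    by (rule S.AE_height_upper[OF crit', unfolded Ae]) (rule that)
  have low: "AE \<omega> in M. \<forall>N. \<forall>\<^sub>F n in sequentially. ereal ((1 - 2 / real (N + 2)) * (A * ln (real n))) \<le> ereal_of_enat (S.H \<omega> n)"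
  proof (subst AE_all_countable, rule allI)
    fix N :: nat
    show "AE \<omega> in M. \<forall>\<^sub>F n in sequentially. ereal ((1 - 2 / real (N + 2)) * (A * ln (real n))) \<le> ereal_of_enat (S.H \<omega> n)"
      using S.AE_height_lower_first_order[OF near, of "1 / real (N + 2)"] unfolding Ae by simp
  qed
  have first: "AE \<omega> in M. (\<lambda>n. ereal_of_enat (S.H \<omega> n) / ereal (A * ln (real n))) \<longlonglongrightarrow> 1"
    using up low by eventually_elim (rule ereal_ratio_tendsto_1[OF A], auto)
  have third: "AE \<omega> in M. \<exists>K::real. \<forall>\<^sub>F n in sequentially.
        \<bar>ereal_of_enat (S.H \<omega> n) - ereal (A * ln (real n))\<bar> \<le> ereal (K * ln (ln (real n)))"
    if \<delta>: "\<delta> > 0" "L_fun \<nu> (- \<delta>) < \<infinity>" for \<delta>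
  proof -
    obtain K' where low2: "AE \<omega> in M. \<forall>\<^sub>F n in sequentially.
      ereal (A * ln (real n) - K' * ln (ln (real n))) \<le> ereal_of_enat (S.H \<omega> n)"
      by (rule S.AE_height_lower_second_order[OF crit' \<delta>, unfolded Ae]) (rule that)
    show ?thesis using up low2
    proof eventually_elim
      case (elim \<omega>)
      from elim eventually_ln_ln_ge[of 0]
      \<comment> \<open>The absolute values give a single constant for both sides; the comparison
        uses that \<open>ln ln n\<close> is eventually nonnegative.\<close>
      have "\<forall>\<^sub>F n in sequentially. \<bar>ereal_of_enat (S.H \<omega> n) - ereal (A * ln (real n))\<bar> \<le> ereal ((\<bar>K\<bar> + \<bar>K'\<bar>) * ln (ln (real n)))"
      proof eventually_elim
        case (elim n)
        then obtain h where h: "ereal_of_enat (S.H \<omega> n) = ereal h" by (cases "ereal_of_enat (S.H \<omega> n)") auto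
        let ?l = "ln (ln (real n))"
        have "K * ?l \<le> (\<bar>K\<bar> + \<bar>K'\<bar>) * ?l" "K' * ?l \<le> (\<bar>K\<bar> + \<bar>K'\<bar>) * ?l"
          using elim(3) by (auto intro!: mult_right_mono)
        hence "\<bar>h - A * ln (real n)\<bar> \<le> (\<bar>K\<bar> + \<bar>K'\<bar>) * ?l" using elim(1,2) unfolding h by simp
        thus ?case unfolding h by simp
      qed
      thus ?case by blast
    qed
  qed
  have second: "AE \<omega> in M. \<exists>K::real. \<forall>\<^sub>F n in sequentially.
      ereal_of_enat (S.H \<omega> n) \<le> ereal (A * ln (real n) + K * ln (ln (real n)))"
    using up by eventually_elim (rule exI)
  show ?thesis
  proof (intro conjI impI)
    assume "\<exists>\<delta>>0. L_fun \<nu> (- \<delta>) < \<infinity> \<and> num_atoms_moment \<nu> (1 + \<delta>) < \<infinity>"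
    then obtain \<delta> where "\<delta> > 0" "L_fun \<nu> (- \<delta>) < \<infinity>" by blast
    from third[OF this] show "AE \<omega> in M. \<exists>K::real. \<forall>\<^sub>F n in sequentially.
        \<bar>ereal_of_enat (height \<rho> \<xi> \<omega> n (real n powr \<alpha>)) - ereal ((1 - \<alpha>) * C_star \<nu> * ln (real n))\<bar> \<le> ereal (K * ln (ln (real n)))"
      unfolding A_def .
  qed (use first second in \<open>simp_all only: A_def\<close>)
qed

end
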